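(* For every countable ordinal $\xi$, the space $X_{G_\xi}$ does not contain a normalized sequence generating an $\ell_1$-spreading model.
   Context: General notation. $\mathbb N=\{1,2,\dots\}$, $(e_n)$ is the unit vector basis of $c_{00}(\mathbb N)$, $e_n^*$ the coordinate functionals; an element $f\in c_{00}(\mathbb N)$ acts on $c_{00}(\mathbb N)$ by $f(x)=\sum_n f(n)x(n)$. For an interval $E\subset\mathbb N$, $Ef$ is the restriction of $f$ to $E$. $f<g$ means $\max\operatorname{supp}f<\min\operatorname{supp}g$. Schreier families. $\mathcal S_0=\{\{n\}:n\in\mathbb N\}\cup\{\emptyset\}$; $\mathcal S_{\xi+1}=\{F_1\cup\dots\cup F_m: m\in\mathbb N,\ F_i\in\mathcal S_\xi,\ m\le F_1<\dots<F_m\}$; for limit $\xi<\omega_1$ fix $\xi_n\nearrow\xi$ and set $\mathcal S_\xi=\{F: F\in\mathcal S_{\xi_n}\text{ and }n\le F\text{ for some }n\}$. In particular $\mathcal S_1=\{F\text{ finite}:\#F\le\min F\}\cup\{\emptyset\}$. The set $G_\xi$. Fix $\xi<\omega_1$. Let $m_1=2^5$, $m_{j+1}=m_j^5$, $n_1=2^6$, $n_{j+1}=(2n_j)^{s_j}$ where $2^{s_j}=m_{j+1}^3$. Put $G_0=\{\pm e_n^*:n\in\mathbb N\}$ and, for $j\in\mathbb N$, $G_1^j=\{m_{2j-1}^{-2}\sum_{i\in B}\varepsilon_ie_i^*: B\subset\mathbb N,\ 1\le\#B\le n_{2j-1},\ \varepsilon_i\in\{-1,1\}\}$, $G_1=\bigcup_jG_1^j$;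 for $f\in G_1^j$ put $\operatorname{ind}(f)=j$. Let $\mathcal U$ be the set of finite sequences $(f_1,\dots,f_d)$ with $f_1<\dots<f_d$, $f_i\in G_1^{j_i}$, $j_1<\dots<j_d$. Fix a partition $\mathbb N=M_1\cup M_2$ into infinite disjoint sets and an injective map $\sigma_1:\mathcal U\to M_2$ with $\sigma_1(f_1,\dots,f_{i+1})>\sigma_1(f_1,\dots,f_i)$ always. A special sequence is $(f_1,\dots,f_d)\in\mathcal U$ such that $\{\min\operatorname{supp}f_i:i\le d\}\in\mathcal S_\xi$, $f_1\in G_1^{j_1}$ with $j_1\in M_1$, and $f_{i+1}\in G_1^{\sigma_1(f_1,\dots,f_i)}$ for $1\le i<d$. Put $G_{sp}=\{E\sum_{i=1}^d\varepsilon_if_i:(f_1,\dots,f_d)\text{ special},\ \varepsilon_i\in\{-1,1\},\ E\text{ an interval}\}$, and for $\phi=E\sum\varepsilon_if_i\in G_{sp}$ put $\operatorname{ind}(\phi)=\{\operatorname{ind}(f_i):Ef_i\neq0\}$ (for $\phi\in G_1^j$, $\operatorname{ind}(\phi)$ is identified with $\{j\}$). Put $G_{\ell_2}=\{\sum_{i=1}^da_i\phi_i: d\in\mathbb N,\ a_i\in\mathbb Q,\ \sum a_i^2\le1,\ \phi_i\in G_{sp}\cup G_1,\ (\operatorname{ind}\phi_i)_{i=1}^d\text{ pairwise disjoint}\}$ and $G_\xi=G_0\cup G_1\cup G_{sp}\cup G_{\ell_2}$. Finally $\|x\|_{G_\xi}=\sup\{\phi(x):\phi\in G_\xi\}$ for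 $x\in c_{00}(\mathbb N)$ and $X_{G_\xi}$ is the completion of $(c_{00}(\mathbb N),\|\cdot\|_{G_\xi})$. A normalized basic sequence $(x_i)_{i\in\mathbb N}$ generates an $\ell_1$-spreading model if there is $C\ge1$ such that for every $F\in\mathcal S_1$ the sequence $(x_i)_{i\in F}$ is $C$-equivalent to the unit vector basis of $\ell_1^{\#F}$. *)

theory Defs
  imports "HOL-Analysis.Analysis" "HOL-Library.Countable_Set_Type"
begin

section \<open>Countable ordinals\<close>

text \<open>
  The elements of the successor cardinal of \<^term>\<open>natLeq\<close>, i.e. of \<open>\<omega>\<^sub>1\<close>, are exactly the countable
  ordinals: initial segments are countable and the type is uncountable
  (\<open>countable_initial_segment\<close> and \<open>uncountable_ordinals\<close> below).
\<close>

typedef countable_ordinal = "Field (cardSuc natLeq)"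
  using Field_cardSuc_not_empty[OF natLeq_Card_order] by blast

lemma wo_cardSuc_natLeq: "Well_order (cardSuc natLeq)"
  by (rule cardSuc_Well_order[OF natLeq_Card_order])

instantiation countable_ordinal :: wellorder
begin

definition less_eq_countable_ordinal :: "countable_ordinal \<Rightarrow> countable_ordinal \<Rightarrow> bool" where
  "x \<le> y \<longleftrightarrow> (Rep_countable_ordinal x, Rep_countable_ordinal y) \<in> cardSuc natLeq"

definition less_countable_ordinal :: "countable_ordinal \<Rightarrow> countable_ordinal \<Rightarrow> bool" where
  "x < y \<longleftrightarrow> x \<le> y \<and> x \<noteq> y" for x y :: countable_ordinal

instance
proof
  have lin: "linear_order_on (Field (cardSuc natLeq)) (cardSuc natLeq)"
    and wf: "wf (cardSuc natLeq - Id)"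
    using wo_cardSuc_natLeq by (auto simp: well_order_on_def)
  have re: "refl_on (Field (cardSuc natLeq)) (cardSuc natLeq)" and tr: "trans (cardSuc natLeq)"
    and an: "antisym (cardSuc natLeq)" and tot: "total_on (Field (cardSuc natLeq)) (cardSuc natLeq)"
    using lin by (auto simp: linear_order_on_def partial_order_on_def preorder_on_def)
  fix x y z :: countable_ordinal
  show refl: "x \<le> x"
    using re Rep_countable_ordinal[of x] by (auto simp: less_eq_countable_ordinal_def refl_on_def)
  show antis: "x = y" if "x \<le> y" "y \<le> x"
    using that an unfolding less_eq_countable_ordinal_def antisym_def
    by (metis Rep_countable_ordinal_inject)
  show "(x < y) = (x \<le> y \<and> \<not> y \<le> x)"
    using an refl unfolding less_countable_ordinal_def less_eq_countable_ordinal_def antisym_def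
    by (metis Rep_countable_ordinal_inject)
  show "x \<le> z" if "x \<le> y" "y \<le> z"
    using that tr by (auto simp: less_eq_countable_ordinal_def elim: transE)
  show "x \<le> y \<or> y \<le> x"
    using tot re Rep_countable_ordinal[of x] Rep_countable_ordinal[of y]
    unfolding less_eq_countable_ordinal_def total_on_def refl_on_def by metis
next
  fix P :: "countable_ordinal \<Rightarrow> bool" and a
  assume step: "\<And>x. (\<And>y. y < x \<Longrightarrow> P y) \<Longrightarrow> P x"
  have wf: "wf (cardSuc natLeq - Id)"
    using wo_cardSuc_natLeq by (auto simp: well_order_on_def)
  have "wf {(x, y). x < (y :: countable_ordinal)}"
    by (rule wf_subset[OF wf_inv_image[OF wf, of Rep_countable_ordinal]])
       (auto simp: less_countable_ordinal_def less_eq_countable_ordinal_def Rep_countable_ordinal_inject)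
  then show "P a" by (induction a rule: wf_induct_rule) (use step in blast)
qed

end

lemma countable_initial_segment: "countable {..\<xi>}" for \<xi> :: countable_ordinal
proof -
  let ?r = "cardSuc natLeq"
  have co: "Card_order ?r" by (rule cardSuc_Card_order[OF natLeq_Card_order])
  have "(card_of (underS ?r (Rep_countable_ordinal \<xi>)), ?r) \<in> ordLess"
    by (rule card_of_underS[OF co Rep_countable_ordinal])
  then have "(card_of (underS ?r (Rep_countable_ordinal \<xi>)), natLeq) \<in> ordLeq"
    using cardSuc_ordLeq_ordLess[OF natLeq_Card_order card_of_Card_order] by blast
  then have c: "countable (underS ?r (Rep_countable_ordinal \<xi>))"
    by (simp add: countable_card_le_natLeq)
  have "Rep_countable_ordinal ` {..<\<xi>} \<subseteq> underS ?r (Rep_countable_ordinal \<xi>)"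
    by (auto simp: underS_def less_countable_ordinal_def less_eq_countable_ordinal_def
        Rep_countable_ordinal_inject)
  then have "countable (Rep_countable_ordinal ` {..<\<xi>})"
    using c countable_subset by blast
  then have "countable {..<\<xi>}"
    by (rule countable_image_inj_on) (auto simp: inj_on_def Rep_countable_ordinal_inject)
  then show ?thesis
    by (metis countable_insert ivl_disj_un_singleton(2) Un_insert_right sup_bot_right)
qed

lemma uncountable_ordinals: "\<not> countable (UNIV :: countable_ordinal set)"
proof
  let ?r = "cardSuc natLeq"
  assume "countable (UNIV :: countable_ordinal set)"
  then have "countable (range Rep_countable_ordinal)" by blast
  then have "countable (Field ?r)"
    using type_definition.Rep_range[OF type_definition_countable_ordinal] by simp
  then have "(card_of (Field ?r), natLeq) \<in> ordLeq" by (simp add: countable_card_le_natLeq)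
  then have "(?r, natLeq) \<in> ordLeq"
    using card_of_Field_ordIso[OF cardSuc_Card_order[OF natLeq_Card_order]]
      ordIso_ordLeq_trans ordIso_symmetric by blast
  then show False
    using cardSuc_greater[OF natLeq_Card_order] not_ordLess_ordLeq by blast
qed

definition ord_zero :: countable_ordinal where
  "ord_zero = (LEAST \<xi>. True)"

definition ord_succ :: "countable_ordinal \<Rightarrow> countable_ordinal" where
  "ord_succ \<xi> = (LEAST \<eta>. \<xi> < \<eta>)"

definition ord_limit :: "countable_ordinal \<Rightarrow> bool" where
  "ord_limit \<xi> \<longleftrightarrow> \<xi> \<noteq> ord_zero \<and> (\<forall>\<eta>. \<xi> \<noteq> ord_succ \<eta>)"

lemma less_ord_succ: "\<xi> < ord_succ \<xi>"
proof -
  have "\<exists>\<eta>. \<xi> < \<eta>"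
  proof (rule ccontr)
    assume "\<nexists>\<eta>. \<xi> < \<eta>"
    then have "(UNIV :: countable_ordinal set) = {..\<xi>}" by (auto simp: not_less)
    then show False using countable_initial_segment uncountable_ordinals by metis
  qed
  then show ?thesis unfolding ord_succ_def by (metis LeastI)
qed

section \<open>Schreier families\<close>

text \<open>
  \<open>\<nat> = {1, 2, \<dots>}\<close> throughout: index 0 of type \<^typ>\<open>nat\<close> is never used.
  \<open>fundamental_sequences L\<close> says that \<open>L \<xi>\<close>, read on indices \<open>n \<ge> 1\<close>, is the chosen
  sequence \<open>\<xi>\<^sub>n \<nearrow> \<xi>\<close> for every limit \<open>\<xi>\<close>; values of \<open>L\<close> elsewhere are irrelevant.
\<close>

definition fundamental_sequences :: "(countable_ordinal \<Rightarrow> nat \<Rightarrow> countable_ordinal) \<Rightarrow> bool" where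
  "fundamental_sequences L \<longleftrightarrow>
     (\<forall>\<xi>. ord_limit \<xi> \<longrightarrow>
        (\<forall>n\<ge>1. L \<xi> n < L \<xi> (Suc n) \<and> L \<xi> n < \<xi>) \<and>
        (\<forall>\<eta><\<xi>. \<exists>n\<ge>1. \<eta> < L \<xi> n))"

text \<open>
  \<open>schreier L \<xi> F\<close> means \<open>F \<in> \<S>\<^sub>\<xi>\<close>. Some of the sets \<open>F i\<close> in the successor step may be empty;
  hence \<open>m \<le> F\<^sub>1 < \<dots> < F\<^sub>m\<close> is required of all the elements and of all pairs.
\<close>

inductive schreier ::
  "(countable_ordinal \<Rightarrow> nat \<Rightarrow> countable_ordinal) \<Rightarrow> countable_ordinal \<Rightarrow> nat set \<Rightarrow> bool"
  for L where
  zero_empty: "schreier L ord_zero {}"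
| zero_singleton: "1 \<le> n \<Longrightarrow> schreier L ord_zero {n}"
| succ: "1 \<le> m \<Longrightarrow> (\<forall>i\<in>{1..m}. schreier L \<xi> (F i)) \<Longrightarrow>
    (\<forall>i\<in>{1..m}. \<forall>k\<in>F i. m \<le> k) \<Longrightarrow>
    (\<forall>i\<in>{1..m}. \<forall>j\<in>{1..m}. i < j \<longrightarrow> (\<forall>k\<in>F i. \<forall>l\<in>F j. k < l)) \<Longrightarrow>
    schreier L (ord_succ \<xi>) (\<Union>i\<in>{1..m}. F i)"
| limit: "ord_limit \<xi> \<Longrightarrow> 1 \<le> n \<Longrightarrow> schreier L (L \<xi> n) F \<Longrightarrow> (\<forall>k\<in>F. n \<le> k) \<Longrightarrow> schreier L \<xi> F"

definition schreier1 :: "nat set set" where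
  "schreier1 = {F. finite F \<and> F \<noteq> {} \<and> 0 \<notin> F \<and> card F \<le> Min F} \<union> {{}}"

lemma schreier_zero_iff: "schreier L ord_zero F \<longleftrightarrow> F = {} \<or> (\<exists>n\<ge>1. F = {n})"
proof
  have "\<not> \<xi> < ord_zero" for \<xi> by (simp add: ord_zero_def Least_le not_less)
  then have ne: "ord_succ \<xi> \<noteq> ord_zero" for \<xi> using less_ord_succ by metis
  assume "schreier L ord_zero F"
  then show "F = {} \<or> (\<exists>n\<ge>1. F = {n})"
    by (cases rule: schreier.cases) (use ne in \<open>auto simp: ord_limit_def dest: sym\<close>)
qed (auto intro: schreier.intros)

lemma ord_succ_inject: "ord_succ \<xi> = ord_succ \<eta> \<Longrightarrow> \<xi> = \<eta>"
  by (metis Least_le less_ord_succ linorder_neq_iff not_less ord_succ_def)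

lemma schreier_one_iff: "schreier L (ord_succ ord_zero) F \<longleftrightarrow> F \<in> schreier1"
proof
  have "\<not> \<xi> < ord_zero" for \<xi> by (simp add: ord_zero_def Least_le not_less)
  then have ne: "ord_succ \<xi> \<noteq> ord_zero" for \<xi> using less_ord_succ by metis
  assume "schreier L (ord_succ ord_zero) F"
  then show "F \<in> schreier1"
  proof (cases rule: schreier.cases)
    case (succ m \<xi> G)
    then have "\<xi> = ord_zero" using ord_succ_inject by metis
    with succ have G: "\<forall>i\<in>{1..m}. G i = {} \<or> (\<exists>n\<ge>1. G i = {n})"
      by (simp add: schreier_zero_iff)
    then have c1: "finite (G i) \<and> card (G i) \<le> 1 \<and> 0 \<notin> G i" if "i \<in> {1..m}" for i
      using that by fastforce
    have "card F \<le> (\<Sum>i\<in>{1..m}. card (G i))"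
      using succ card_UN_le[of "{1..m}" G] by simp
    also have "\<dots> \<le> (\<Sum>i\<in>{1..m}. 1)" by (rule sum_mono) (use c1 in blast)
    finally have "card F \<le> m" by simp
    moreover have "finite F" "0 \<notin> F" using succ c1 by auto
    moreover have "m \<le> Min F" if "F \<noteq> {}" using succ that \<open>finite F\<close> by auto
    ultimately show ?thesis unfolding schreier1_def using order_trans by blast
  qed (use ne in \<open>auto simp: ord_limit_def\<close>)
next
  assume F: "F \<in> schreier1"
  show "schreier L (ord_succ ord_zero) F"
  proof (cases "F = {}")
    case True
    then show ?thesis
      using schreier.succ[of 1 L ord_zero "\<lambda>_. {}"] by (simp add: zero_empty)
  next
    case False
    with F have fin: "finite F" and z: "0 \<notin> F" and c: "card F \<le> Min F"
      by (auto simp: schreier1_def)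
    let ?xs = "sorted_list_of_set F"
    let ?G = "\<lambda>i. {?xs ! (i - 1)}"
    have len: "length ?xs = card F" using fin by simp
    have mem: "?xs ! (i - 1) \<in> F" if "i \<in> {1..card F}" for i
    proof -
      have "i - 1 < length ?xs" using that len by simp presburger
      then show ?thesis using nth_mem fin by (metis set_sorted_list_of_set)
    qed
    have "F = (\<Union>i\<in>{1..card F}. ?G i)"
    proof (intro equalityI subsetI)
      fix k assume "k \<in> F"
      then obtain i where "i < card F" "?xs ! i = k"
        using fin len by (metis in_set_conv_nth set_sorted_list_of_set)
      then show "k \<in> (\<Union>i\<in>{1..card F}. ?G i)" by (intro UN_I[of "Suc i"]) auto
    qed (use mem in auto)
    moreover have "schreier L (ord_succ ord_zero) (\<Union>i\<in>{1..card F}. ?G i)"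
    proof (rule schreier.succ)
      show "1 \<le> card F" using False fin by (simp add: Suc_le_eq card_gt_0_iff)
      show "\<forall>i\<in>{1..card F}. schreier L ord_zero (?G i)"
      proof
        fix i assume "i \<in> {1..card F}"
        then have "1 \<le> ?xs ! (i - 1)" using mem z by (metis less_one not_less)
        then show "schreier L ord_zero (?G i)" by (rule zero_singleton)
      qed
      show "\<forall>i\<in>{1..card F}. \<forall>k\<in>?G i. card F \<le> k"
        using mem c fin False by (auto intro: order_trans[OF c] Min_le)
      show "\<forall>i\<in>{1..card F}. \<forall>j\<in>{1..card F}. i < j \<longrightarrow> (\<forall>k\<in>?G i. \<forall>l\<in>?G j. k < l)"
      proof (intro ballI impI)
        fix i j k l assume *: "i \<in> {1..card F}" "j \<in> {1..card F}" "i < j" "k \<in> ?G i" "l \<in> ?G j"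
        have "sorted_wrt (<) ?xs" by (rule strict_sorted_list_of_set)
        moreover have "i - 1 < j - 1" "j - 1 < length ?xs" using * len by auto
        ultimately show "k < l" using * sorted_wrt_nth_less[of "(<)" ?xs "i - 1" "j - 1"] by simp
      qed
    qed
    ultimately show ?thesis by simp
  qed
qed

section \<open>The norming set\<close>

definition c00 :: "(nat \<Rightarrow> real) set" where
  "c00 = {x. finite {n. x n \<noteq> 0} \<and> x 0 = 0}"

definition supp :: "(nat \<Rightarrow> real) \<Rightarrow> nat set" where
  "supp f = {n. f n \<noteq> 0}"

definition act :: "(nat \<Rightarrow> real) \<Rightarrow> (nat \<Rightarrow> real) \<Rightarrow> real" where
  "act f x = (\<Sum>n\<in>supp f. f n * x n)"

definition restr :: "nat set \<Rightarrow> (nat \<Rightarrow> real) \<Rightarrow> (nat \<Rightarrow> real)" where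
  "restr E f = (\<lambda>n. if n \<in> E then f n else 0)"

definition nat_interval :: "nat set \<Rightarrow> bool" where
  "nat_interval E \<longleftrightarrow> 0 \<notin> E \<and> (\<forall>a\<in>E. \<forall>b\<in>E. {a..b} \<subseteq> E)"

text \<open>The values of the next three sequences at index 0 are dummies.\<close>

fun m_seq :: "nat \<Rightarrow> nat" where
  "m_seq 0 = 0"
| "m_seq (Suc 0) = 2 ^ 5"
| "m_seq (Suc (Suc j)) = m_seq (Suc j) ^ 5"

definition s_seq :: "nat \<Rightarrow> nat" where
  "s_seq j = (THE s. 2 ^ s = m_seq (Suc j) ^ 3)"

fun n_seq :: "nat \<Rightarrow> nat" where
  "n_seq 0 = 0"
| "n_seq (Suc 0) = 2 ^ 6"
| "n_seq (Suc (Suc j)) = (2 * n_seq (Suc j)) ^ s_seq (Suc j)"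

lemma m_seq_closed: "m_seq (Suc j) = 2 ^ (5 ^ Suc j)"
  by (induction j) (simp_all add: power_mult[symmetric] mult.commute)

lemma s_seq_spec: "2 ^ s_seq j = m_seq (Suc j) ^ 3"
  unfolding s_seq_def
  by (rule theI[of _ "5 ^ Suc j * 3"]) (simp_all add: m_seq_closed power_mult[symmetric])

definition G0 :: "(nat \<Rightarrow> real) set" where
  "G0 = {(\<lambda>k. if k = n then \<epsilon> else 0) | n \<epsilon>. 1 \<le> n \<and> \<epsilon> \<in> {-1, 1}}"

definition G1j :: "nat \<Rightarrow> (nat \<Rightarrow> real) set" where
  "G1j j = {(\<lambda>k. if k \<in> B then \<epsilon> k / real (m_seq (2 * j - 1)) ^ 2 else 0) | B \<epsilon>.
      finite B \<and> 0 \<notin> B \<and> 1 \<le> card B \<and> card B \<le> n_seq (2 * j - 1) \<and> (\<forall>k\<in>B. \<epsilon> k \<in> {-1, 1})}"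

definition G1 :: "(nat \<Rightarrow> real) set" where
  "G1 = (\<Union>j\<in>{1..}. G1j j)"

definition ind :: "(nat \<Rightarrow> real) \<Rightarrow> nat" where
  "ind f = (THE j. 1 \<le> j \<and> f \<in> G1j j)"

definition U_seqs :: "(nat \<Rightarrow> real) list set" where
  "U_seqs = {fs. fs \<noteq> [] \<and> sorted_wrt (\<lambda>f g. Max (supp f) < Min (supp g)) fs \<and>
     (\<exists>js. list_all2 (\<lambda>f j. 1 \<le> j \<and> f \<in> G1j j) fs js \<and> sorted_wrt (<) js)}"

definition special_coding :: "nat set \<Rightarrow> nat set \<Rightarrow> ((nat \<Rightarrow> real) list \<Rightarrow> nat) \<Rightarrow> bool" where
  "special_coding M1 M2 \<sigma> \<longleftrightarrow>
     M1 \<union> M2 = {1..} \<and> M1 \<inter> M2 = {} \<and> infinite M1 \<and> infinite M2 \<and>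
     inj_on \<sigma> U_seqs \<and> \<sigma> ` U_seqs \<subseteq> M2 \<and>
     (\<forall>fs f. fs \<noteq> [] \<and> fs @ [f] \<in> U_seqs \<longrightarrow> \<sigma> fs < \<sigma> (fs @ [f]))"

text \<open>Lists are indexed from 0, so \<open>fs ! i\<close> is \<open>f\<^sub>i\<^sub>+\<^sub>1\<close> and \<open>take i fs\<close> is \<open>(f\<^sub>1, \<dots>, f\<^sub>i)\<close>.\<close>

definition special_seqs ::
  "(countable_ordinal \<Rightarrow> nat \<Rightarrow> countable_ordinal) \<Rightarrow> nat set \<Rightarrow> ((nat \<Rightarrow> real) list \<Rightarrow> nat) \<Rightarrow>
   countable_ordinal \<Rightarrow> (nat \<Rightarrow> real) list set" where
  "special_seqs L M1 \<sigma> \<xi> = {fs \<in> U_seqs.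
     schreier L \<xi> ((\<lambda>f. Min (supp f)) ` set fs) \<and>
     (\<exists>j\<in>M1. fs ! 0 \<in> G1j j) \<and>
     (\<forall>i. 1 \<le> i \<and> i < length fs \<longrightarrow> fs ! i \<in> G1j (\<sigma> (take i fs)))}"

text \<open>
  A functional \<open>\<phi> = E \<Sum> \<epsilon>\<^sub>i f\<^sub>i\<close> is carried together with its index set \<open>ind \<phi> = {ind f\<^sub>i : E f\<^sub>i \<noteq> 0}\<close>.
\<close>

definition Gsp_ind ::
  "(countable_ordinal \<Rightarrow> nat \<Rightarrow> countable_ordinal) \<Rightarrow> nat set \<Rightarrow> ((nat \<Rightarrow> real) list \<Rightarrow> nat) \<Rightarrow>
   countable_ordinal \<Rightarrow> ((nat \<Rightarrow> real) \<times> nat set) set" where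
  "Gsp_ind L M1 \<sigma> \<xi> =
     {(restr E (\<lambda>n. \<Sum>i<length fs. \<epsilon> i * (fs ! i) n),
       {ind (fs ! i) | i. i < length fs \<and> restr E (fs ! i) \<noteq> (\<lambda>n. 0)}) | E fs \<epsilon>.
       nat_interval E \<and> fs \<in> special_seqs L M1 \<sigma> \<xi> \<and> (\<forall>i<length fs. \<epsilon> i \<in> {-1, 1})}"

definition Gsp ::
  "(countable_ordinal \<Rightarrow> nat \<Rightarrow> countable_ordinal) \<Rightarrow> nat set \<Rightarrow> ((nat \<Rightarrow> real) list \<Rightarrow> nat) \<Rightarrow>
   countable_ordinal \<Rightarrow> (nat \<Rightarrow> real) set" where
  "Gsp L M1 \<sigma> \<xi> = fst ` Gsp_ind L M1 \<sigma> \<xi>"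

definition G1_ind :: "((nat \<Rightarrow> real) \<times> nat set) set" where
  "G1_ind = {(f, {j}) | f j. 1 \<le> j \<and> f \<in> G1j j}"

definition Gl2 ::
  "(countable_ordinal \<Rightarrow> nat \<Rightarrow> countable_ordinal) \<Rightarrow> nat set \<Rightarrow> ((nat \<Rightarrow> real) list \<Rightarrow> nat) \<Rightarrow>
   countable_ordinal \<Rightarrow> (nat \<Rightarrow> real) set" where
  "Gl2 L M1 \<sigma> \<xi> =
     {(\<lambda>n. \<Sum>i\<in>{1..d}. a i * \<phi> i n) | (d :: nat) a \<phi> I.
       1 \<le> d \<and> (\<forall>i\<in>{1..d}. a i \<in> \<rat>) \<and> (\<Sum>i\<in>{1..d}. (a i)\<^sup>2) \<le> 1 \<and>
       (\<forall>i\<in>{1..d}. (\<phi> i, I i) \<in> Gsp_ind L M1 \<sigma> \<xi> \<union> G1_ind) \<and>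
       (\<forall>i\<in>{1..d}. \<forall>k\<in>{1..d}. i \<noteq> k \<longrightarrow> I i \<inter> I k = {})}"

definition G_set ::
  "(countable_ordinal \<Rightarrow> nat \<Rightarrow> countable_ordinal) \<Rightarrow> nat set \<Rightarrow> ((nat \<Rightarrow> real) list \<Rightarrow> nat) \<Rightarrow>
   countable_ordinal \<Rightarrow> (nat \<Rightarrow> real) set" where
  "G_set L M1 \<sigma> \<xi> = G0 \<union> G1 \<union> Gsp L M1 \<sigma> \<xi> \<union> Gl2 L M1 \<sigma> \<xi>"

definition G_norm ::
  "(countable_ordinal \<Rightarrow> nat \<Rightarrow> countable_ordinal) \<Rightarrow> nat set \<Rightarrow> ((nat \<Rightarrow> real) list \<Rightarrow> nat) \<Rightarrow>
   countable_ordinal \<Rightarrow> (nat \<Rightarrow> real) \<Rightarrow> real" where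
  "G_norm L M1 \<sigma> \<xi> x = (SUP \<phi>\<in>G_set L M1 \<sigma> \<xi>. act \<phi> x)"

section \<open>Completions and spreading models\<close>

text \<open>
  \<open>X\<close>, a closed subspace of a Banach space, is a completion of \<open>(c\<^sub>0\<^sub>0, N)\<close> via the isometric
  embedding \<open>J\<close>; only the values of \<open>J\<close> on \<open>c\<^sub>0\<^sub>0\<close> matter.
\<close>

definition completion_of_c00 ::
  "((nat \<Rightarrow> real) \<Rightarrow> real) \<Rightarrow> ((nat \<Rightarrow> real) \<Rightarrow> 'b::banach) \<Rightarrow> 'b set \<Rightarrow> bool" where
  "completion_of_c00 N J X \<longleftrightarrow>
     (\<forall>x\<in>c00. \<forall>y\<in>c00. J (\<lambda>n. x n + y n) = J x + J y) \<and>
     (\<forall>c. \<forall>x\<in>c00. J (\<lambda>n. c * x n) = c *\<^sub>R J x) \<and>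
     (\<forall>x\<in>c00. norm (J x) = N x) \<and>
     X = closure (J ` c00)"

definition basic_sequence :: "(nat \<Rightarrow> 'b::real_normed_vector) \<Rightarrow> bool" where
  "basic_sequence x \<longleftrightarrow> (\<forall>y\<in>closure (span (range x)). \<exists>!a. (\<lambda>i. a i *\<^sub>R x i) sums y)"

definition l1_equivalent_on :: "real \<Rightarrow> nat set \<Rightarrow> (nat \<Rightarrow> 'b::real_normed_vector) \<Rightarrow> bool" where
  "l1_equivalent_on C F x \<longleftrightarrow>
     (\<forall>a. (1 / C) * (\<Sum>i\<in>F. \<bar>a i\<bar>) \<le> norm (\<Sum>i\<in>F. a i *\<^sub>R x i) \<and>
          norm (\<Sum>i\<in>F. a i *\<^sub>R x i) \<le> C * (\<Sum>i\<in>F. \<bar>a i\<bar>))"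

text \<open>The sequence is \<open>(x\<^sub>i)\<close> with \<open>i \<ge> 1\<close>, whence the shift in \<^const>\<open>basic_sequence\<close>.\<close>

definition generates_l1_spreading_model :: "(nat \<Rightarrow> 'b::real_normed_vector) \<Rightarrow> bool" where
  "generates_l1_spreading_model x \<longleftrightarrow>
     (\<forall>i\<ge>1. norm (x i) = 1) \<and> basic_sequence (\<lambda>i. x (Suc i)) \<and>
     (\<exists>C\<ge>1. \<forall>F\<in>schreier1. l1_equivalent_on C F x)"

end

theory Submission
  imports Defs "HOL-Library.Ramsey" "HOL-Complex_Analysis.Great_Picard"
begin

text \<open>
  Approximating, passing to a subsequence and taking differences reduces the claim to showing that a
  bounded block sequence \<open>(y\<^sub>k)\<close> has arbitrarily long averages of small norm.
  A block acts essentially only through finitely many indices. Small indices are harmless, since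
  functionals of bounded index have bounded \<open>\<ell>\<^sub>1\<close>-norm and averages have small sup-norm, and
  lower \<open>\<ell>\<^sub>2\<close>-estimates over disjoint sets of indices yield a subsequence whose blocks live on
  successive intervals of indices \<open>J\<^sub>k\<close>. The rows of an \<open>\<ell>\<^sub>2\<close>-combination of special functionals then
  form a matrix with columns in the unit ball of \<open>\<ell>\<^sub>2\<close>, and an average of \<open>n\<close> columns has norm of
  order \<open>1/\<surd>n\<close> unless some special functional is large on many blocks. This is excluded along a
  subsequence as for James trees: special sequences sharing an index share their initial
  segment, and the branches are well founded because \<open>S\<^sub>\<xi>\<close> is compact.
\<close>

section \<open>Schreier families\<close>

text \<open>Column bounds alone do not make averages small: a row of constant size across
  \<open>n\<close> blocks contributes \<open>n\<close>, whereas sparse rows contribute about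
  \<open>sqrt n\<close>. The obstacle is therefore a single special functional that acts on many
  blocks. The sets in \<open>schreier L \<xi>\<close> have in general no uniform bound on their
  size, but along a fixed sequence of successive finite blocks some \<open>K\<close> exists such
  that each of them misses one of the first \<open>K + 1\<close> blocks, and the argument uses
  \<open>\<xi>\<close> through this fact alone. Functionals are cut by indices rather than by
  position, because \<open>Gl2\<close> asks for disjoint index sets; a special functional cut to an
  interval of indices is special or zero, so pieces can be recombined and tested against the norm.
  Differences are taken because the given sequence may have a nonzero pointwise limit.\<close>

lemma not_less_ord_zero: "\<not> \<eta> < ord_zero"
  by (simp add: ord_zero_def Least_le not_less)

lemma ord_succ_neq_zero: "ord_succ \<eta> \<noteq> ord_zero"
  using less_ord_succ not_less_ord_zero by metis

lemma schreier_succD: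
  assumes "schreier L (ord_succ \<xi>) F"
  obtains m and G :: "nat \<Rightarrow> nat set" where "F = (\<Union>i\<in>{1..m}. G i)" "\<forall>i\<in>{1..m}. schreier L \<xi> (G i)"
    "\<forall>i\<in>{1..m}. \<forall>k\<in>G i. m \<le> k"
    "\<forall>i\<in>{1..m}. \<forall>j\<in>{1..m}. i < j \<longrightarrow> (\<forall>k\<in>G i. \<forall>l\<in>G j. k < l)"
  using assms
proof (cases rule: schreier.cases)
  case (succ m \<eta> G)
  then have "\<eta> = \<xi>" using ord_succ_inject by metis
  with succ that[of G m] show ?thesis by blast
qed (use ord_succ_neq_zero in \<open>auto simp: ord_limit_def\<close>)

lemma schreier_limitD:
  assumes "schreier L \<xi> F" "ord_limit \<xi>"
  obtains n where "1 \<le> n" "schreier L (L \<xi> n) F" "\<forall>k\<in>F. n \<le> k"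
  using assms by (cases rule: schreier.cases) (auto simp: ord_limit_def)

text \<open>If a later \<open>G i\<close> has a point in \<open>T r\<close>, then \<open>G 0\<close>
  ends before that point and so misses every \<open>T s\<close> with \<open>s > r\<close>. Only the
  remaining sets then matter, from the block after \<open>r\<^sub>0+K\<close> on; otherwise
  \<open>T r\<close> itself is missed by the whole union.\<close>

lemma union_misses_block:
  fixes T :: "nat \<Rightarrow> nat set"
  assumes succ: "\<And>r s a b. r < s \<Longrightarrow> a \<in> T r \<Longrightarrow> b \<in> T s \<Longrightarrow> a < b"
    and miss: "\<And>r\<^sub>0. \<exists>K. \<forall>F. P F \<longrightarrow> (\<exists>r\<in>{r\<^sub>0..r\<^sub>0+K}. F \<inter> T r = {})"
  shows "\<exists>K. \<forall>G :: nat \<Rightarrow> nat set. (\<forall>i<m. P (G i)) \<longrightarrow>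
    (\<forall>i j k l. i < j \<longrightarrow> j < m \<longrightarrow> k \<in> G i \<longrightarrow> l \<in> G j \<longrightarrow> k < l) \<longrightarrow>
    (\<exists>r\<in>{r\<^sub>0..r\<^sub>0+K}. (\<Union>i<m. G i) \<inter> T r = {})"
proof (induction m arbitrary: r\<^sub>0)
  case 0
  show ?case by (intro exI[of _ 0]) auto
next
  case (Suc m)
  obtain K where K: "\<And>F. P F \<Longrightarrow> \<exists>r\<in>{r\<^sub>0..r\<^sub>0+K}. F \<inter> T r = {}"
    using miss by metis
  obtain K' where K': "\<And>G :: nat \<Rightarrow> nat set. (\<forall>i<m. P (G i)) \<Longrightarrow>
    (\<forall>i j k l. i < j \<longrightarrow> j < m \<longrightarrow> k \<in> G i \<longrightarrow> l \<in> G j \<longrightarrow> k < l) \<Longrightarrow>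
    (\<exists>r\<in>{Suc (r\<^sub>0+K)..Suc (r\<^sub>0+K)+K'}. (\<Union>i<m. G i) \<inter> T r = {})"
    using Suc.IH[of "Suc (r\<^sub>0+K)"] by blast
  show ?case
  proof (intro exI[of _ "K + K' + 1"] allI impI)
    fix G :: "nat \<Rightarrow> nat set"
    assume P: "\<forall>i<Suc m. P (G i)"
      and ord: "\<forall>i j k l. i < j \<longrightarrow> j < Suc m \<longrightarrow> k \<in> G i \<longrightarrow> l \<in> G j \<longrightarrow> k < l"
    have split: "(\<Union>i<Suc m. G i) = G 0 \<union> (\<Union>i<m. G (Suc i))"
      by (auto simp: less_Suc_eq_0_disj)
    obtain r where r: "r \<in> {r\<^sub>0..r\<^sub>0+K}" "G 0 \<inter> T r = {}" using K P by blast
    show "\<exists>r\<in>{r\<^sub>0..r\<^sub>0+(K+K'+1)}. (\<Union>i<Suc m. G i) \<inter> T r = {}"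
    proof (cases "(\<Union>i<m. G (Suc i)) \<inter> T r = {}")
      case True
      with r split show ?thesis by (intro bexI[of _ r]) auto
    next
      case False
      then obtain i a where a: "i < m" "a \<in> G (Suc i)" "a \<in> T r" by auto
      have "\<exists>r\<in>{Suc (r\<^sub>0+K)..Suc (r\<^sub>0+K)+K'}. (\<Union>i<m. G (Suc i)) \<inter> T r = {}"
        by (rule K') (use P ord Suc_less_eq in blast)+
      then obtain s where s: "s \<in> {Suc (r\<^sub>0+K)..Suc (r\<^sub>0+K)+K'}" "(\<Union>i<m. G (Suc i)) \<inter> T s = {}"
        by blast
      have "G 0 \<inter> T s = {}"
      proof (rule ccontr)
        assume "G 0 \<inter> T s \<noteq> {}"
        then obtain b where b: "b \<in> G 0" "b \<in> T s" by blast
        have "b < a" using ord a b by blast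
        moreover have "a < b" using succ[of r s a b] r s a b by auto
        ultimately show False by simp
      qed
      then show ?thesis using s split by (intro bexI[of _ s]) auto
    qed
  qed
qed

text \<open>A finitary form of the compactness of \<open>S\<^sub>\<xi>\<close>.\<close>

lemma schreier_misses_block:
  fixes T :: "nat \<Rightarrow> nat set"
  assumes L: "fundamental_sequences L"
    and fin: "\<And>r. finite (T r)"
    and succ: "\<And>r s a b. r < s \<Longrightarrow> a \<in> T r \<Longrightarrow> b \<in> T s \<Longrightarrow> a < b"
  shows "\<exists>K. \<forall>F. schreier L \<xi> F \<longrightarrow> (\<exists>r\<in>{r\<^sub>0..r\<^sub>0+K}. F \<inter> T r = {})"
proof (induction \<xi> arbitrary: r\<^sub>0 rule: less_induct)
  case (less \<xi>)
  \<comment> \<open>A set missing \<open>T r\<^sub>0\<close> is settled by \<open>r\<^sub>0\<close>.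
    Any other set has an element at most \<open>M\<close>, which bounds the parameter
    \<open>m\<close> (successor) or \<open>n\<close> (limit) in its construction, so finitely many
    bounds from smaller ordinals suffice.\<close>
  obtain M where M: "\<And>a. a \<in> T r\<^sub>0 \<Longrightarrow> a \<le> M" using fin[of r\<^sub>0] finite_nat_set_iff_bounded_le by metis
  consider "\<xi> = ord_zero" | \<eta> where "\<xi> = ord_succ \<eta>" | "ord_limit \<xi>"
    by (auto simp: ord_limit_def)
  then show ?case
  proof cases
    case 1
    show ?thesis
    proof (intro exI[of _ 1] allI impI)
      fix F assume "schreier L \<xi> F"
      then consider "F = {}" | n where "F = {n}" using 1 schreier_zero_iff by blast
      then show "\<exists>r\<in>{r\<^sub>0..r\<^sub>0+1}. F \<inter> T r = {}"
      proof cases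
        case (2 n)
        have "n \<notin> T r\<^sub>0 \<or> n \<notin> T (Suc r\<^sub>0)" using succ[of r\<^sub>0 "Suc r\<^sub>0" n n] by auto
        then show ?thesis using 2 by (auto simp: atLeastAtMostSuc_conv)
      qed auto
    qed
  next
    case (2 \<eta>)
    have IH: "\<exists>K. \<forall>F. schreier L \<eta> F \<longrightarrow> (\<exists>r\<in>{r..r+K}. F \<inter> T r = {})" for r
      using less.IH[of \<eta> r] 2 less_ord_succ by blast
    define Q where "Q m K \<longleftrightarrow> (\<forall>G :: nat \<Rightarrow> nat set. (\<forall>i<m. schreier L \<eta> (G i)) \<longrightarrow>
        (\<forall>i j k l. i < j \<longrightarrow> j < m \<longrightarrow> k \<in> G i \<longrightarrow> l \<in> G j \<longrightarrow> k < l) \<longrightarrow>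
        (\<exists>r\<in>{r\<^sub>0..r\<^sub>0+K}. (\<Union>i<m. G i) \<inter> T r = {}))" for m K
    have "\<exists>K. Q m K" for m unfolding Q_def
    proof (rule union_misses_block[where T = T and P = "schreier L \<eta>"])
      show "a < b" if "r < s" "a \<in> T r" "b \<in> T s" for r s a b
        using succ that by blast
    qed (rule IH)
    then obtain K where K: "\<And>m. Q m (K m)" by metis
    show ?thesis
    proof (intro exI[of _ "Max (K ` {..M})"] allI impI)
      fix F assume "schreier L \<xi> F"
      with 2 have "schreier L (ord_succ \<eta>) F" by simp
      then obtain m and G :: "nat \<Rightarrow> nat set" where G: "F = (\<Union>i\<in>{1..m}. G i)"
        "\<forall>i\<in>{1..m}. schreier L \<eta> (G i)" "\<forall>i\<in>{1..m}. \<forall>k\<in>G i. m \<le> k"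
        "\<forall>i\<in>{1..m}. \<forall>j\<in>{1..m}. i < j \<longrightarrow> (\<forall>k\<in>G i. \<forall>l\<in>G j. k < l)"
        by (rule schreier_succD)
      show "\<exists>r\<in>{r\<^sub>0..r\<^sub>0+Max (K ` {..M})}. F \<inter> T r = {}"
      proof (cases "F \<inter> T r\<^sub>0 = {}")
        case False
        then have "m \<le> M" using G M by (metis UN_E disjoint_iff order_trans)
        then have le: "K m \<le> Max (K ` {..M})" by simp
        have F: "F = (\<Union>i<m. G (Suc i))"
          unfolding G(1) image_Suc_lessThan[symmetric] by (simp add: image_image)
        have "\<exists>r\<in>{r\<^sub>0..r\<^sub>0+K m}. F \<inter> T r = {}"
          unfolding F
        proof (rule K[of m, unfolded Q_def, rule_format])
          show "schreier L \<eta> (G (Suc i))" if "i < m" for i using G(2) that by simp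
          show "k < l" if "i < j" "j < m" "k \<in> G (Suc i)" "l \<in> G (Suc j)" for i j k l
            using G(4)[rule_format, of "Suc i" "Suc j" k l] that by simp
        qed
        then show ?thesis using le by (meson atLeastAtMost_iff add_left_mono order_trans)
      qed auto
    qed
  next
    case 3
    then have "L \<xi> n < \<xi>" if "1 \<le> n" for n using L that by (auto simp: fundamental_sequences_def)
    then have "\<exists>K. \<forall>F. schreier L (L \<xi> n) F \<longrightarrow> (\<exists>r\<in>{r\<^sub>0..r\<^sub>0+K}. F \<inter> T r = {})" if "1 \<le> n" for n
      using less.IH[of "L \<xi> n"] that by blast
    then obtain K where K: "\<And>n F. 1 \<le> n \<Longrightarrow> schreier L (L \<xi> n) F \<Longrightarrow> \<exists>r\<in>{r\<^sub>0..r\<^sub>0+K n}. F \<inter> T r = {}"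
      by metis
    show ?thesis
    proof (intro exI[of _ "Max (K ` {..M})"] allI impI)
      fix F assume "schreier L \<xi> F"
      then obtain n where n: "1 \<le> n" "schreier L (L \<xi> n) F" "\<forall>k\<in>F. n \<le> k"
        using 3 by (rule schreier_limitD)
      show "\<exists>r\<in>{r\<^sub>0..r\<^sub>0+Max (K ` {..M})}. F \<inter> T r = {}"
      proof (cases "F \<inter> T r\<^sub>0 = {}")
        case False
        then have "n \<le> M" using n M by (metis disjoint_iff order_trans)
        then have le: "K n \<le> Max (K ` {..M})" by simp
        show ?thesis using K[OF n(1,2)] le by (meson atLeastAtMost_iff add_left_mono order_trans)
      qed auto
    qed
  qed
qed

section \<open>Ramsey and matrix lemmas\<close>

lemma ramsey_pairs:
  fixes Z :: "nat set"
  assumes "infinite Z"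
  obtains Y where "Y \<subseteq> Z" "infinite Y"
    "(\<forall>x\<in>Y. \<forall>y\<in>Y. x < y \<longrightarrow> P x y) \<or> (\<forall>x\<in>Y. \<forall>y\<in>Y. x < y \<longrightarrow> \<not> P x y)"
proof -
  define f where "f X = (if P (Min X) (Max X) then 0 else 1 :: nat)" for X
  have "\<forall>X. X \<subseteq> Z \<and> finite X \<and> card X = 2 \<longrightarrow> f X < 2" by (simp add: f_def)
  from Ramsey[OF assms this] obtain Y t where Y: "Y \<subseteq> Z" "infinite Y"
    "\<And>X. X \<subseteq> Y \<and> finite X \<and> card X = 2 \<Longrightarrow> f X = t" by metis
  have "f {x, y} = t" "f {x, y} = (if P x y then 0 else 1)" if "x \<in> Y" "y \<in> Y" "x < y" for x y
  proof -
    show "f {x, y} = t" by (rule Y(3)) (use that in auto)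
    have "Min {x, y} = x" "Max {x, y} = y" using that by simp_all
    then show "f {x, y} = (if P x y then 0 else 1)" by (simp only: f_def)
  qed
  then have "(if P x y then 0 else 1) = t" if "x \<in> Y" "y \<in> Y" "x < y" for x y using that by metis
  then show thesis using that[OF Y(1,2)] by (cases "t = 0") (metis zero_neq_one)+
qed

lemma ramsey_triples:
  fixes Z :: "nat set"
  assumes "infinite Z"
  obtains Y where "Y \<subseteq> Z" "infinite Y"
    "(\<forall>x\<in>Y. \<forall>y\<in>Y. \<forall>z\<in>Y. x < y \<longrightarrow> y < z \<longrightarrow> P x y z) \<or>
     (\<forall>x\<in>Y. \<forall>y\<in>Y. \<forall>z\<in>Y. x < y \<longrightarrow> y < z \<longrightarrow> \<not> P x y z)"
proof -
  define f where "f X = (if P (Min X) (Min (X - {Min X})) (Max X) then 0 else 1 :: nat)" for X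
  have "\<forall>X. X \<subseteq> Z \<and> finite X \<and> card X = 3 \<longrightarrow> f X < 2" by (simp add: f_def)
  from Ramsey[OF assms this] obtain Y t where Y: "Y \<subseteq> Z" "infinite Y"
    "\<And>X. X \<subseteq> Y \<and> finite X \<and> card X = 3 \<Longrightarrow> f X = t" by metis
  have "f {x, y, z} = t" "f {x, y, z} = (if P x y z then 0 else 1)"
    if "x \<in> Y" "y \<in> Y" "z \<in> Y" "x < y" "y < z" for x y z
  proof -
    show "f {x, y, z} = t" by (rule Y(3)) (use that in auto)
    have "Min {x, y, z} = x" "Max {x, y, z} = z" using that by simp_all
    moreover have "{x, y, z} - {x} = {y, z}" "Min {y, z} = y" using that by auto
    ultimately show "f {x, y, z} = (if P x y z then 0 else 1)" by (simp only: f_def)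
  qed
  then have "(if P x y z then 0 else 1) = t" if "x \<in> Y" "y \<in> Y" "z \<in> Y" "x < y" "y < z" for x y z
    using that by metis
  then show thesis using that[OF Y(1,2)] by (cases "t = 0") (metis zero_neq_one)+
qed

text \<open>\<open>Gl2\<close> admits rational coefficients only. This lets real ones be tested
  against the norm, in particular those obtained by normalizing a vector of values.\<close>

lemma sum_le_of_rational_sums:
  fixes a v :: "'i \<Rightarrow> real"
  assumes fin: "finite S" and a: "(\<Sum>i\<in>S. (a i)\<^sup>2) \<le> 1"
    and rat: "\<And>q. (\<forall>i\<in>S. q i \<in> \<rat>) \<Longrightarrow> (\<Sum>i\<in>S. (q i)\<^sup>2) \<le> 1 \<Longrightarrow> (\<Sum>i\<in>S. q i * v i) \<le> N"
  shows "(\<Sum>i\<in>S. a i * v i) \<le> N"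
proof (rule field_le_epsilon)
  fix e :: real assume e: "0 < e"
  define V where "V = 1 + (\<Sum>i\<in>S. \<bar>v i\<bar>)"
  have V: "V > 0" unfolding V_def by (simp add: add_pos_nonneg sum_nonneg)
  \<comment> \<open>Rounding towards zero keeps the sum of squares at most 1.\<close>
  have approx: "\<exists>q\<in>\<rat>. \<bar>q\<bar> \<le> \<bar>t\<bar> \<and> \<bar>t - q\<bar> \<le> d" if "0 < d" for t d :: real
  proof -
    consider "t = 0" | "t > 0" | "t < 0" by linarith
    then show ?thesis
    proof cases
      case 2
      then obtain q where "q \<in> \<rat>" "max 0 (t - d) < q" "q < t"
        using Rats_dense_in_real[of "max 0 (t - d)" t] \<open>0 < d\<close> by auto
      then show ?thesis by (intro bexI[of _ q]) auto
    next
      case 3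
      then obtain q where "q \<in> \<rat>" "t < q" "q < min 0 (t + d)"
        using Rats_dense_in_real[of t "min 0 (t + d)"] \<open>0 < d\<close> by auto
      then show ?thesis by (intro bexI[of _ q]) auto
    qed (use that in \<open>auto intro!: bexI[of _ 0]\<close>)
  qed
  have "\<forall>i. \<exists>q\<in>\<rat>. \<bar>q\<bar> \<le> \<bar>a i\<bar> \<and> \<bar>a i - q\<bar> \<le> e / V"
    using approx e V by simp
  then obtain q where q: "\<And>i. q i \<in> \<rat>" "\<And>i. \<bar>q i\<bar> \<le> \<bar>a i\<bar>" "\<And>i. \<bar>a i - q i\<bar> \<le> e / V"
    by metis
  have "(\<Sum>i\<in>S. (q i)\<^sup>2) \<le> (\<Sum>i\<in>S. (a i)\<^sup>2)"
    by (intro sum_mono) (use q in \<open>simp add: abs_le_square_iff\<close>)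
  then have *: "(\<Sum>i\<in>S. q i * v i) \<le> N" using rat q(1) a by simp
  have "(\<Sum>i\<in>S. a i * v i) = (\<Sum>i\<in>S. q i * v i) + (\<Sum>i\<in>S. (a i - q i) * v i)"
    by (simp add: sum.distrib[symmetric] algebra_simps)
  also have "(\<Sum>i\<in>S. (a i - q i) * v i) \<le> (\<Sum>i\<in>S. e / V * \<bar>v i\<bar>)"
  proof (rule sum_mono)
    fix i
    have "(a i - q i) * v i \<le> \<bar>a i - q i\<bar> * \<bar>v i\<bar>" by (metis abs_ge_self abs_mult)
    also have "\<dots> \<le> e / V * \<bar>v i\<bar>" using q(3) by (intro mult_right_mono) auto
    finally show "(a i - q i) * v i \<le> e / V * \<bar>v i\<bar>" .
  qed
  also have "\<dots> = e / V * (\<Sum>i\<in>S. \<bar>v i\<bar>)" by (simp add: sum_distrib_left)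
  also have "\<dots> \<le> e / V * V" using e V by (intro mult_left_mono) (auto simp: V_def)
  also have "\<dots> = e" using V by simp
  finally show "(\<Sum>i\<in>S. a i * v i) \<le> N + e" using * by simp
qed

text \<open>Cauchy-Schwarz: with at most one selected entry per row each weight \<open>a i\<close>
  is counted once, while the \<open>n\<close> columns together have square sum at most
  \<open>n\<close>.\<close>

lemma sum_selected_entries_le:
  fixes b :: "'i \<Rightarrow> nat \<Rightarrow> real"
  assumes fin: "finite S" and a: "(\<Sum>i\<in>S. (a i)\<^sup>2) \<le> 1"
    and col: "\<And>t. t < n \<Longrightarrow> (\<Sum>i\<in>S. (b i t)\<^sup>2) \<le> 1"
    and sel: "P \<subseteq> S \<times> {..<n}" and uniq: "\<And>i s t. (i, s) \<in> P \<Longrightarrow> (i, t) \<in> P \<Longrightarrow> s = t"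
  shows "(\<Sum>(i, t)\<in>P. \<bar>a i * b i t\<bar>) \<le> sqrt n"
proof -
  have finP: "finite P" using sel fin finite_subset by fastforce
  have "inj_on fst P" using uniq by (auto simp: inj_on_def)
  then have "(\<Sum>(i, t)\<in>P. (a i)\<^sup>2) = (\<Sum>i\<in>fst ` P. (a i)\<^sup>2)"
    by (simp add: sum.reindex case_prod_beta)
  also have "\<dots> \<le> (\<Sum>i\<in>S. (a i)\<^sup>2)"
    using sel by (intro sum_mono2) (auto simp: fin)
  finally have 1: "(\<Sum>(i, t)\<in>P. (a i)\<^sup>2) \<le> 1" using a by simp
  have "(\<Sum>(i, t)\<in>P. (b i t)\<^sup>2) \<le> (\<Sum>(i, t)\<in>S \<times> {..<n}. (b i t)\<^sup>2)"
    using sel by (intro sum_mono2) (auto simp: fin)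
  also have "\<dots> = (\<Sum>t<n. \<Sum>i\<in>S. (b i t)\<^sup>2)"
    by (simp add: sum.cartesian_product[symmetric] sum.swap[of _ S])
  also have "\<dots> \<le> (\<Sum>t<n. 1)" by (rule sum_mono) (use col in auto)
  finally have 2: "(\<Sum>(i, t)\<in>P. (b i t)\<^sup>2) \<le> n" by simp
  have "(\<Sum>(i, t)\<in>P. \<bar>a i * b i t\<bar>) = (\<Sum>p\<in>P. \<bar>a (fst p)\<bar> * \<bar>b (fst p) (snd p)\<bar>)"
    by (simp add: case_prod_beta abs_mult)
  also have "\<dots> \<le> L2_set (\<lambda>p. a (fst p)) P * L2_set (\<lambda>p. b (fst p) (snd p)) P"
    by (rule L2_set_mult_ineq)
  also have "\<dots> \<le> 1 * sqrt n"
    using 1 2 by (intro mult_mono) (auto simp: L2_set_def case_prod_beta sum_nonneg)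
  finally show ?thesis by simp
qed

text \<open>
  Each row contributes through its first nonzero entry, through at most one later entry exceeding
  the threshold set by that first one, and through small entries.
\<close>

lemma matrix_sum_le:
  fixes b :: "'i \<Rightarrow> nat \<Rightarrow> real" and \<eta> :: "nat \<Rightarrow> real"
  assumes fin: "finite S" and a: "(\<Sum>i\<in>S. (a i)\<^sup>2) \<le> 1"
    and col: "\<And>t. t < n \<Longrightarrow> (\<Sum>i\<in>S. (b i t)\<^sup>2) \<le> 1"
    and \<eta>: "\<And>s. s < n \<Longrightarrow> 0 < \<eta> s" "\<And>s. s < n \<Longrightarrow> card {i\<in>S. b i s \<noteq> 0} * \<eta> s \<le> \<epsilon> / n"
    and one: "\<And>i s t t'. i \<in> S \<Longrightarrow> s < t \<Longrightarrow> t < t' \<Longrightarrow> t' < n \<Longrightarrow> b i t \<noteq> 0 \<Longrightarrow> \<bar>b i t'\<bar> < \<eta> s"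
  shows "(\<Sum>t<n. \<Sum>i\<in>S. a i * b i t) \<le> 2 * sqrt n + n * \<epsilon>"
proof (cases "n = 0")
  case False
  define A where "A = {(i, t). i \<in> S \<and> t < n \<and> b i t \<noteq> 0 \<and> (\<forall>s<t. b i s = 0)}"
  define B where "B = {(i, t). i \<in> S \<and> t < n \<and> (\<exists>s<t. (\<forall>r<s. b i r = 0) \<and> b i s \<noteq> 0 \<and> \<eta> s \<le> \<bar>b i t\<bar>)}"
  define D where "D = {(i, t). i \<in> S \<and> t < n \<and> (\<exists>s<t. b i s \<noteq> 0 \<and> \<bar>b i t\<bar> < \<eta> s)}"
  have a1: "\<bar>a i\<bar> \<le> 1" if "i \<in> S" for i
  proof -
    have "(a i)\<^sup>2 \<le> (\<Sum>i\<in>S. (a i)\<^sup>2)" by (rule member_le_sum) (use that fin in auto)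
    then have "(a i)\<^sup>2 \<le> 1" using a by linarith
    then show ?thesis using abs_square_le_1 by blast
  qed
  have sub: "A \<subseteq> S \<times> {..<n}" "B \<subseteq> S \<times> {..<n}" "D \<subseteq> S \<times> {..<n}"
    by (auto simp: A_def B_def D_def)
  have finABD: "finite A" "finite B" "finite D"
    using sub fin by (meson finite_SigmaI finite_lessThan finite_subset)+
  have A: "(\<Sum>(i, t)\<in>A. \<bar>a i * b i t\<bar>) \<le> sqrt n"
  proof (rule sum_selected_entries_le[OF fin a col sub(1)])
    fix i s t assume "(i, s) \<in> A" "(i, t) \<in> A"
    then show "s = t" unfolding A_def by (cases s t rule: linorder_cases) auto
  qed
  \<comment> \<open>Two large later entries in one row refer to the same first nonzero position
    \<open>s\<close>, and \<open>one\<close>, applied to the nonzero entry at \<open>t\<close>, puts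
    the entry at \<open>t'\<close> below \<open>\<eta> s\<close>.\<close>
  have contra: False if h: "(i, t) \<in> B" "(i, t') \<in> B" "t < t'" for i t t'
  proof -
    obtain s where s: "s < t" "\<forall>r<s. b i r = 0" "b i s \<noteq> 0" "\<eta> s \<le> \<bar>b i t\<bar>" "i \<in> S" "t' < n"
      using h unfolding B_def mem_Collect_eq case_prod_conv by blast
    obtain s' where s': "s' < t'" "\<forall>r<s'. b i r = 0" "b i s' \<noteq> 0" "\<eta> s' \<le> \<bar>b i t'\<bar>"
      using h unfolding B_def mem_Collect_eq case_prod_conv by blast
    have "s = s'" using s s' by (metis linorder_neqE_nat)
    moreover have "\<eta> s > 0" using \<eta>(1)[of s] s that(3) by simp
    then have "b i t \<noteq> 0" using s by auto
    then have "\<bar>b i t'\<bar> < \<eta> s" using one[of i s t t'] s that(3) by simp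
    ultimately show False using s' by simp
  qed
  have B: "(\<Sum>(i, t)\<in>B. \<bar>a i * b i t\<bar>) \<le> sqrt n"
  proof (rule sum_selected_entries_le[OF fin a col sub(2)])
    fix i s t assume "(i, s) \<in> B" "(i, t) \<in> B"
    then show "s = t" using contra[of i s t] contra[of i t s] by (cases s t rule: linorder_cases) auto
  qed
  \<comment> \<open>A small entry is charged to \<open>\<eta> s\<close> for an earlier nonzero
    entry. For each \<open>t\<close>, column \<open>s\<close> is charged at most
    \<open>\<epsilon> / n\<close> in total, and there are \<open>n\<close> choices of each of
    \<open>s\<close> and \<open>t\<close>.\<close>
  have "(\<Sum>(i, t)\<in>D. \<bar>a i * b i t\<bar>) \<le> (\<Sum>(i, t)\<in>D. \<Sum>s<n. if b i s \<noteq> 0 then \<eta> s else 0)"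
  proof (rule sum_mono, clarify)
    fix i t assume "(i, t) \<in> D"
    then obtain s where s: "s < t" "b i s \<noteq> 0" "\<bar>b i t\<bar> < \<eta> s" "i \<in> S" "t < n" unfolding D_def by auto
    have "\<bar>a i * b i t\<bar> \<le> 1 * \<bar>b i t\<bar>" unfolding abs_mult using a1 s by (intro mult_right_mono) auto
    also have "\<dots> \<le> (if b i s \<noteq> 0 then \<eta> s else 0)" using s by simp
    also have "\<dots> \<le> (\<Sum>s<n. if b i s \<noteq> 0 then \<eta> s else 0)"
      by (rule member_le_sum) (use s \<eta>(1) in \<open>auto simp: less_imp_le\<close>)
    finally show "\<bar>a i * b i t\<bar> \<le> (\<Sum>s<n. if b i s \<noteq> 0 then \<eta> s else 0)" .
  qed
  also have "\<dots> \<le> (\<Sum>(i, t)\<in>S \<times> {..<n}. \<Sum>s<n. if b i s \<noteq> 0 then \<eta> s else 0)"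
    using sub fin by (intro sum_mono2) (auto intro!: sum_nonneg simp: less_imp_le \<eta>(1))
  also have "\<dots> = n * (\<Sum>s<n. \<Sum>i\<in>S. if b i s \<noteq> 0 then \<eta> s else 0)"
    by (simp add: sum.cartesian_product[symmetric] sum.swap[of _ S] sum_distrib_left)
  also have "\<dots> = n * (\<Sum>s<n. card {i\<in>S. b i s \<noteq> 0} * \<eta> s)"
    using fin by (simp add: sum.If_cases Int_def conj_commute)
  also have "\<dots> \<le> n * (\<Sum>s<n. \<epsilon> / n)"
    by (intro mult_left_mono sum_mono) (use \<eta>(2) in auto)
  also have "\<dots> = n * \<epsilon>" using False by simp
  finally have D: "(\<Sum>(i, t)\<in>D. \<bar>a i * b i t\<bar>) \<le> n * \<epsilon>" .
  have cover: "a i * b i t = 0" if "(i, t) \<in> S \<times> {..<n} - (A \<union> B \<union> D)" for i t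
  proof (rule ccontr)
    assume "a i * b i t \<noteq> 0"
    then have nz: "b i t \<noteq> 0" by simp
    define s where "s = (LEAST s. b i s \<noteq> 0)"
    have s: "b i s \<noteq> 0" "\<forall>r<s. b i r = 0" "s \<le> t"
      unfolding s_def using LeastI[of "\<lambda>s. b i s \<noteq> 0", OF nz] Least_le[of "\<lambda>s. b i s \<noteq> 0", OF nz]
      by (auto dest: not_less_Least)
    have "(i, t) \<in> A \<union> B \<union> D"
    proof (cases "s = t")
      case True
      then show ?thesis using s that by (auto simp: A_def)
    next
      case False
      then have "s < t" using s by simp
      then show ?thesis using s that by (cases "\<eta> s \<le> \<bar>b i t\<bar>") (auto simp: B_def D_def)
    qed
    then show False using that by blast
  qed
  have "(\<Sum>t<n. \<Sum>i\<in>S. a i * b i t) = (\<Sum>(i, t)\<in>S \<times> {..<n}. a i * b i t)"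
    by (simp add: sum.cartesian_product[symmetric] sum.swap[of _ S])
  also have "\<dots> \<le> (\<Sum>(i, t)\<in>S \<times> {..<n}. \<bar>a i * b i t\<bar>)"
    by (rule sum_mono) auto
  also have "\<dots> = (\<Sum>(i, t)\<in>A \<union> B \<union> D. \<bar>a i * b i t\<bar>)"
  proof (rule sum.mono_neutral_right)
    show "\<forall>p\<in>S \<times> {..<n} - (A \<union> B \<union> D). (case p of (i, t) \<Rightarrow> \<bar>a i * b i t\<bar>) = 0"
    proof
      fix p assume p: "p \<in> S \<times> {..<n} - (A \<union> B \<union> D)"
      obtain i t where "p = (i, t)" by (cases p)
      then show "(case p of (i, t) \<Rightarrow> \<bar>a i * b i t\<bar>) = 0" using cover[of i t] p by simp
    qed
  qed (use fin sub in auto)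
  also have "\<dots> \<le> (\<Sum>(i, t)\<in>A. \<bar>a i * b i t\<bar>) + (\<Sum>(i, t)\<in>B. \<bar>a i * b i t\<bar>) + (\<Sum>(i, t)\<in>D. \<bar>a i * b i t\<bar>)"
  proof -
    have un: "sum g (U \<union> V) \<le> sum g U + sum g V" if "finite U" "finite V" "\<And>p. 0 \<le> g p"
      for g :: "'i \<times> nat \<Rightarrow> real" and U V
      using sum.union_inter[OF that(1,2), of g] sum_nonneg[of "U \<inter> V" g] that(3) by simp
    show ?thesis
      using un[of "A \<union> B" D "\<lambda>(i, t). \<bar>a i * b i t\<bar>"] un[of A B "\<lambda>(i, t). \<bar>a i * b i t\<bar>"] finABD
      by (simp add: case_prod_beta)
  qed
  finally show ?thesis using A B D by simp
qed simp

section \<open>Levels of functionals\<close>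

text \<open>The common modulus of the nonzero coordinates of a functional in \<open>G1j j\<close>.
  It is injective in \<open>j\<close>, and its decay is used only in the geometric form
  \<open>lev_le\<close>.\<close>

definition lev :: "nat \<Rightarrow> real" where
  "lev j = 1 / real (m_seq (2 * j - 1)) ^ 2"

lemma lev_eq: "1 \<le> j \<Longrightarrow> lev j = (1/2) ^ (2 * 5 ^ (2 * j - 1))"
proof -
  assume "1 \<le> j"
  then have "2 * j - 1 = Suc (2 * j - 2)" by simp
  then have "m_seq (2 * j - 1) = 2 ^ (5 ^ (2 * j - 1))" by (metis m_seq_closed)
  then show ?thesis by (simp add: lev_def power_mult[symmetric] power_one_over mult.commute)
qed

lemma lev_pos: "1 \<le> j \<Longrightarrow> 0 < lev j"
  by (simp add: lev_eq)

lemma lev_le: assumes "1 \<le> j" shows "lev j \<le> (1/2) ^ j"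
proof -
  have "j \<le> 2 * j - 1" using assms by simp
  also have "2 * j - 1 < 2 ^ (2 * j - 1)" by (rule less_exp)
  also have "\<dots> \<le> 5 ^ (2 * j - 1)" by (rule power_mono) auto
  finally have "j \<le> 2 * 5 ^ (2 * j - 1)" by simp
  then show ?thesis unfolding lev_eq[OF assms] by (intro power_decreasing) auto
qed

lemma lev_inject: "1 \<le> i \<Longrightarrow> 1 \<le> j \<Longrightarrow> lev i = lev j \<longleftrightarrow> i = j"
  by (auto simp: lev_eq power_inject_exp' dest: power_inject_exp')

text \<open>Defined from values alone, so that disjointness of index sets refers to no
  representation; \<open>Gsp_ind_idx\<close> and \<open>G1j_graded\<close> identify it with the
  index sets attached to special functionals and to members of \<open>G1\<close>.\<close>

definition idx :: "(nat \<Rightarrow> real) \<Rightarrow> nat set" where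
  "idx \<phi> = {j. 1 \<le> j \<and> (\<exists>n. \<bar>\<phi> n\<bar> = lev j)}"

text \<open>
  The level of a coordinate of a functional is encoded in its absolute value, so the part of
  \<open>\<phi> = E \<Sum> \<epsilon>\<^sub>i f\<^sub>i\<close> with \<open>ind f\<^sub>i \<in> J\<close> is determined by \<open>\<phi>\<close> alone.
\<close>

definition index_cut :: "nat set \<Rightarrow> (nat \<Rightarrow> real) \<Rightarrow> nat \<Rightarrow> real" where
  "index_cut J \<phi> n = (if \<exists>j\<in>J. 1 \<le> j \<and> \<bar>\<phi> n\<bar> = lev j then \<phi> n else 0)"

text \<open>What special functionals, members of \<open>G1\<close> and zero have in common. The last
  clause is the source of all support bounds: a level occupies no more coordinates than it can in
  one functional of that index.\<close>

definition graded :: "(nat \<Rightarrow> real) \<Rightarrow> bool" where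
  "graded \<phi> \<longleftrightarrow> finite (supp \<phi>) \<and> (\<forall>n. \<phi> n \<noteq> 0 \<longrightarrow> (\<exists>j\<ge>1. \<bar>\<phi> n\<bar> = lev j)) \<and>
    (\<forall>j\<ge>1. card {n. \<bar>\<phi> n\<bar> = lev j} \<le> n_seq (2 * j - 1))"

lemma idx_cut: "idx (index_cut J \<phi>) \<subseteq> idx \<phi> \<inter> J"
proof
  fix j assume "j \<in> idx (index_cut J \<phi>)"
  then obtain n where n: "1 \<le> j" "\<bar>index_cut J \<phi> n\<bar> = lev j" by (auto simp: idx_def)
  then have "index_cut J \<phi> n \<noteq> 0" using lev_pos by fastforce
  then obtain i where i: "i \<in> J" "1 \<le> i" "\<bar>\<phi> n\<bar> = lev i" "index_cut J \<phi> n = \<phi> n"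
    unfolding index_cut_def by (metis (no_types, lifting))
  then have "i = j" using n lev_inject by metis
  then show "j \<in> idx \<phi> \<inter> J" using i n by (auto simp: idx_def)
qed

lemma cut_Un:
  assumes "J \<inter> K = {}"
  shows "index_cut (J \<union> K) \<phi> n = index_cut J \<phi> n + index_cut K \<phi> n"
proof -
  have "\<not> ((\<exists>j\<in>J. 1 \<le> j \<and> \<bar>\<phi> n\<bar> = lev j) \<and> (\<exists>j\<in>K. 1 \<le> j \<and> \<bar>\<phi> n\<bar> = lev j))"
    using assms lev_inject by (metis disjoint_iff)
  then show ?thesis by (auto simp: index_cut_def)
qed

lemma cut_UNIV: "graded \<phi> \<Longrightarrow> index_cut UNIV \<phi> = \<phi>"
  by (auto simp: index_cut_def graded_def fun_eq_iff)

lemma cut_id: "graded \<phi> \<Longrightarrow> idx \<phi> \<subseteq> J \<Longrightarrow> index_cut J \<phi> = \<phi>"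
  by (fastforce simp: index_cut_def graded_def fun_eq_iff idx_def)

lemma cut_empty: "idx \<phi> \<inter> J = {} \<Longrightarrow> index_cut J \<phi> = (\<lambda>n. 0)"
  by (fastforce simp: index_cut_def idx_def fun_eq_iff)

lemma G1jD:
  assumes "f \<in> G1j j" "1 \<le> j"
  shows "finite (supp f)" "supp f \<noteq> {}" "card (supp f) \<le> n_seq (2 * j - 1)"
    "f n \<noteq> 0 \<Longrightarrow> \<bar>f n\<bar> = lev j" "f 0 = 0"
proof -
  have "m_seq (2 * j - 1) \<noteq> 0"
    using m_seq_closed[of "2 * j - 2"] assms(2) by (simp add: Suc_diff_Suc numeral_2_eq_2)
  then have pos: "real (m_seq (2 * j - 1)) ^ 2 \<noteq> 0" by simp
  obtain B \<epsilon> where B: "f = (\<lambda>k. if k \<in> B then \<epsilon> k / real (m_seq (2 * j - 1)) ^ 2 else 0)"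
    "finite B" "0 \<notin> B" "1 \<le> card B" "card B \<le> n_seq (2 * j - 1)" "\<forall>k\<in>B. \<epsilon> k \<in> {-1, 1}"
    using assms(1) unfolding G1j_def by blast
  have "supp f = B" using pos B(6) by (auto simp: supp_def B(1))
  then show "finite (supp f)" "supp f \<noteq> {}" "card (supp f) \<le> n_seq (2 * j - 1)" using B by auto
  show "\<bar>f n\<bar> = lev j" if "f n \<noteq> 0"
  proof -
    have "n \<in> B" using that B(1) by (auto split: if_splits)
    then have "\<epsilon> n = 1 \<or> \<epsilon> n = -1" using B(6) by auto
    then show ?thesis using \<open>n \<in> B\<close> by (auto simp: B(1) lev_def)
  qed
  show "f 0 = 0" using B by simp
qed

lemma ind_eq:
  assumes "f \<in> G1j j" "1 \<le> j"
  shows "ind f = j"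
proof -
  have *: "i = j" if "1 \<le> i" "f \<in> G1j i" for i
  proof -
    obtain n where "f n \<noteq> 0" using G1jD(2)[OF assms] by (auto simp: supp_def)
    then have "lev i = lev j" using G1jD(4) that assms by metis
    then show ?thesis using lev_inject that assms by simp
  qed
  show ?thesis unfolding ind_def by (rule the_equality) (use assms * in blast)+
qed

lemma G1j_graded:
  assumes "f \<in> G1j j" "1 \<le> j"
  shows "graded f" "idx f = {j}"
proof -
  have lev: "\<bar>f n\<bar> = lev i \<longleftrightarrow> f n \<noteq> 0 \<and> i = j" if "1 \<le> i" for i n
  proof
    assume "\<bar>f n\<bar> = lev i"
    then have "f n \<noteq> 0" using lev_pos[OF that] by auto
    then show "f n \<noteq> 0 \<and> i = j"
      using G1jD(4)[OF assms] lev_inject that assms(2) \<open>\<bar>f n\<bar> = lev i\<close> by metis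
  qed (use G1jD(4)[OF assms] in auto)
  have "card {n. \<bar>f n\<bar> = lev i} \<le> n_seq (2 * i - 1)" if "1 \<le> i" for i
    unfolding lev[OF that] using G1jD(3)[OF assms] by (cases "i = j") (simp_all add: supp_def)
  then show "graded f"
    unfolding graded_def using G1jD[OF assms] assms(2) by blast
  show "idx f = {j}"
    using lev G1jD(2)[OF assms] assms(2) by (auto simp: idx_def supp_def)
qed

section \<open>Special sequences\<close>

lemma U_seqsD:
  assumes "fs \<in> U_seqs"
  shows "i < length fs \<Longrightarrow> fs ! i \<in> G1j (ind (fs ! i)) \<and> 1 \<le> ind (fs ! i)"
    "i < k \<Longrightarrow> k < length fs \<Longrightarrow> ind (fs ! i) < ind (fs ! k)"
    "i < k \<Longrightarrow> k < length fs \<Longrightarrow> a \<in> supp (fs ! i) \<Longrightarrow> b \<in> supp (fs ! k) \<Longrightarrow>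
      a < Min (supp (fs ! k)) \<and> Max (supp (fs ! i)) < b"
proof -
  obtain js where js: "list_all2 (\<lambda>f j. 1 \<le> j \<and> f \<in> G1j j) fs js" "sorted_wrt (<) js"
    and s: "sorted_wrt (\<lambda>f g. Max (supp f) < Min (supp g)) fs"
    using assms unfolding U_seqs_def by blast
  have len: "length js = length fs" using js(1) by (simp add: list_all2_lengthD)
  have mem: "1 \<le> js ! i \<and> fs ! i \<in> G1j (js ! i)" if "i < length fs" for i
    using js(1) that by (simp add: list_all2_conv_all_nth)
  have ind: "ind (fs ! i) = js ! i" if "i < length fs" for i
    using mem[OF that] ind_eq by simp
  show "i < length fs \<Longrightarrow> fs ! i \<in> G1j (ind (fs ! i)) \<and> 1 \<le> ind (fs ! i)" for i
    using mem ind by simp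
  show "i < k \<Longrightarrow> k < length fs \<Longrightarrow> ind (fs ! i) < ind (fs ! k)" for i k
    using ind js(2) len by (simp add: sorted_wrt_nth_less)
  show "a < Min (supp (fs ! k)) \<and> Max (supp (fs ! i)) < b"
    if "i < k" "k < length fs" "a \<in> supp (fs ! i)" "b \<in> supp (fs ! k)" for i k a b
  proof -
    have "Max (supp (fs ! i)) < Min (supp (fs ! k))" 
      by (rule sorted_wrt_nth_less[OF s that(1,2)])
    moreover have "finite (supp (fs ! i))" "finite (supp (fs ! k))"
      using mem that G1jD(1) by (metis order.strict_trans)+
    ultimately show ?thesis using that by (meson Max_ge Min_le le_less_trans less_le_trans)
  qed
qed

lemma U_seqs_supp_less:
  assumes "fs \<in> U_seqs" "i < k" "k < length fs" "a \<in> supp (fs ! i)" "b \<in> supp (fs ! k)"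
  shows "a < b"
proof -
  have "finite (supp (fs ! i))" using U_seqsD(1)[OF assms(1), of i] G1jD(1) assms(2,3) by (meson less_trans)
  then have "a \<le> Max (supp (fs ! i))" using assms(4) by simp
  then show ?thesis using U_seqsD(3)[OF assms] by linarith
qed

lemma U_seqs_sum_nth:
  assumes "fs \<in> U_seqs" "i < length fs" "n \<in> supp (fs ! i)"
  shows "(\<Sum>k<length fs. \<epsilon> k * (fs ! k) n) = \<epsilon> i * (fs ! i) n"
proof -
  have "(fs ! k) n = 0" if "k < length fs" "k \<noteq> i" for k
  proof (rule ccontr)
    assume "(fs ! k) n \<noteq> 0"
    then have "n \<in> supp (fs ! k)" by (simp add: supp_def)
    then show False
      using U_seqs_supp_less[OF assms(1), of i k n n] U_seqs_supp_less[OF assms(1), of k i n n]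
        assms that by (cases i k rule: linorder_cases) auto
  qed
  then have "(\<Sum>k<length fs. \<epsilon> k * (fs ! k) n) = (\<Sum>k\<in>{i}. \<epsilon> k * (fs ! k) n)"
    using assms by (intro sum.mono_neutral_right) auto
  then show ?thesis by simp
qed

locale coding =
  fixes L :: "countable_ordinal \<Rightarrow> nat \<Rightarrow> countable_ordinal"
    and M1 M2 :: "nat set"
    and \<sigma> :: "(nat \<Rightarrow> real) list \<Rightarrow> nat"
    and \<xi> :: countable_ordinal
  assumes fundamental: "fundamental_sequences L"
    and coding: "special_coding M1 M2 \<sigma>"
begin

abbreviation "N \<equiv> G_norm L M1 \<sigma> \<xi>"

text \<open>The tree property. After the first entry an index is \<open>\<sigma>\<close> of the
  preceding segment, and \<open>\<sigma>\<close> is injective on \<open>U_seqs\<close>. First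
  entries have indices in \<open>M1\<close>, later ones in \<open>M2\<close>, so a first entry never
  shares its index with a later one. The entries at \<open>i\<close> and \<open>k\<close> themselves
  may differ.\<close>

lemma special_seqs_share:
  assumes f: "fs \<in> special_seqs L M1 \<sigma> \<xi>" and g: "gs \<in> special_seqs L M1 \<sigma> \<xi>"
    and "i < length fs" "k < length gs" "ind (fs ! i) = ind (gs ! k)"
  shows "take i fs = take k gs"
proof -
  have M: "M1 \<inter> M2 = {}" "M1 \<subseteq> {1..}" "inj_on \<sigma> U_seqs" "\<sigma> ` U_seqs \<subseteq> M2"
    using coding by (auto simp: special_coding_def)
  have M2: "M2 \<subseteq> {1..}" using coding by (auto simp: special_coding_def)
  have first: "ind (fs ! 0) \<in> M1" if "fs \<in> special_seqs L M1 \<sigma> \<xi>" for fs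
  proof -
    have "\<exists>j\<in>M1. fs ! 0 \<in> G1j j" using that by (simp add: special_seqs_def)
    then show ?thesis using ind_eq M(2) by (metis atLeast_iff subsetD)
  qed
  have later: "take i fs \<in> U_seqs \<and> ind (fs ! i) = \<sigma> (take i fs)"
    if "fs \<in> special_seqs L M1 \<sigma> \<xi>" "0 < i" "i < length fs" for fs i
  proof -
    have U: "fs \<in> U_seqs" using that by (simp add: special_seqs_def)
    then obtain js where js: "list_all2 (\<lambda>f j. 1 \<le> j \<and> f \<in> G1j j) fs js" "sorted_wrt (<) js"
      "sorted_wrt (\<lambda>f g. Max (supp f) < Min (supp g)) fs" unfolding U_seqs_def by blast
    have "list_all2 (\<lambda>f j. 1 \<le> j \<and> f \<in> G1j j) (take i fs) (take i js)"
      using js(1) by (rule list_all2_takeI)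
    then have "take i fs \<in> U_seqs"
      unfolding U_seqs_def using js(2,3) that by (auto intro!: sorted_wrt_take)
    moreover from this have "1 \<le> \<sigma> (take i fs)" using M(4) M2 by fastforce
    moreover have "fs ! i \<in> G1j (\<sigma> (take i fs))" using that by (auto simp: special_seqs_def)
    ultimately show ?thesis using ind_eq by blast
  qed
  show ?thesis
  proof (cases "i = 0 \<or> k = 0")
    case True
    then have "i = 0 \<and> k = 0"
      using first[OF f] first[OF g] later[OF f, of i] later[OF g, of k] assms M by (metis disjoint_iff image_subset_iff not_gr_zero)
    then show ?thesis by simp
  next
    case False
    then show ?thesis
      using later[OF f, of i] later[OF g, of k] assms M(3) by (metis inj_onD not_gr_zero)
  qed
qed

lemma GspE:
  assumes "(\<phi>, I) \<in> Gsp_ind L M1 \<sigma> \<xi>"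
  obtains E fs \<epsilon> where "nat_interval E" "fs \<in> special_seqs L M1 \<sigma> \<xi>" "fs \<in> U_seqs"
    "\<forall>i<length fs. \<epsilon> i \<in> {-1, 1}"
    "\<phi> = restr E (\<lambda>n. \<Sum>i<length fs. \<epsilon> i * (fs ! i) n)"
    "I = {ind (fs ! i) | i. i < length fs \<and> restr E (fs ! i) \<noteq> (\<lambda>n. 0)}"
    "\<forall>n. \<phi> n \<noteq> 0 \<longrightarrow> (\<exists>i<length fs. n \<in> supp (fs ! i) \<and> n \<in> E)"
    "\<forall>i n. i < length fs \<longrightarrow> n \<in> supp (fs ! i) \<longrightarrow> n \<in> E \<longrightarrow> \<bar>\<phi> n\<bar> = lev (ind (fs ! i))"
proof -
  obtain E fs \<epsilon> where *: "nat_interval E" "fs \<in> special_seqs L M1 \<sigma> \<xi>"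
    "\<forall>i<length fs. \<epsilon> i \<in> {-1, 1 :: real}"
    "\<phi> = restr E (\<lambda>n. \<Sum>i<length fs. \<epsilon> i * (fs ! i) n)"
    "I = {ind (fs ! i) | i. i < length fs \<and> restr E (fs ! i) \<noteq> (\<lambda>n. 0)}"
    using assms unfolding Gsp_ind_def by blast
  have U: "fs \<in> U_seqs" using *(2) by (simp add: special_seqs_def)
  have nz: "\<exists>i<length fs. n \<in> supp (fs ! i) \<and> n \<in> E" if "\<phi> n \<noteq> 0" for n
  proof (rule ccontr)
    assume "\<not> ?thesis"
    then have "\<phi> n = 0" by (auto simp: *(4) restr_def supp_def intro!: sum.neutral)
    then show False using that by simp
  qed
  have "\<bar>\<phi> n\<bar> = lev (ind (fs ! i))" if "i < length fs" "n \<in> supp (fs ! i)" "n \<in> E" for i n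
  proof -
    have "\<phi> n = \<epsilon> i * (fs ! i) n" using U_seqs_sum_nth[OF U that(1,2)] that(3) by (simp add: *(4) restr_def)
    moreover have "\<epsilon> i = 1 \<or> \<epsilon> i = -1" using *(3) that(1) by auto
    ultimately have "\<bar>\<phi> n\<bar> = \<bar>(fs ! i) n\<bar>" by auto
    then show ?thesis using G1jD(4) U_seqsD(1)[OF U that(1)] that(2) by (simp add: supp_def)
  qed
  then show thesis using that[of E fs \<epsilon>] * U nz by blast
qed

text \<open>Supports within a special sequence are disjoint, so a nonzero coordinate of
  \<open>\<phi>\<close> has the modulus of the only member carrying it, and injectivity of
  \<open>lev\<close> returns the index of that member.\<close>

lemma Gsp_ind_idx:
  assumes "(\<phi>, I) \<in> Gsp_ind L M1 \<sigma> \<xi>"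
  shows "I = idx \<phi>"
proof -
  obtain E fs \<epsilon> where rep: "nat_interval E" "fs \<in> special_seqs L M1 \<sigma> \<xi>" "fs \<in> U_seqs"
    "\<forall>i<length fs. \<epsilon> i \<in> {-1, 1}"
    "\<phi> = restr E (\<lambda>n. \<Sum>i<length fs. \<epsilon> i * (fs ! i) n)"
    "I = {ind (fs ! i) | i. i < length fs \<and> restr E (fs ! i) \<noteq> (\<lambda>n. 0)}"
    "\<forall>n. \<phi> n \<noteq> 0 \<longrightarrow> (\<exists>i<length fs. n \<in> supp (fs ! i) \<and> n \<in> E)"
    "\<forall>i n. i < length fs \<longrightarrow> n \<in> supp (fs ! i) \<longrightarrow> n \<in> E \<longrightarrow> \<bar>\<phi> n\<bar> = lev (ind (fs ! i))"
    by (rule GspE[OF assms])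
  note * = rep[rule_format]
  have I: "j \<in> I \<longleftrightarrow> (\<exists>i n. i < length fs \<and> n \<in> supp (fs ! i) \<and> n \<in> E \<and> j = ind (fs ! i))" for j
    unfolding *(6) by (auto simp: restr_def supp_def fun_eq_iff split: if_splits)
  show ?thesis
  proof (rule set_eqI, rule iffI)
    fix j assume "j \<in> I"
    then show "j \<in> idx \<phi>" unfolding I idx_def using *(8) U_seqsD(1)[OF *(3)] by blast
  next
    fix j assume "j \<in> idx \<phi>"
    then obtain n where n: "1 \<le> j" "\<bar>\<phi> n\<bar> = lev j" by (auto simp: idx_def)
    then have "\<phi> n \<noteq> 0" using lev_pos by fastforce
    then obtain i where i: "i < length fs" "n \<in> supp (fs ! i)" "n \<in> E" using *(7) by blast
    then have "lev (ind (fs ! i)) = lev j" using *(8) n by metis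
    then have "ind (fs ! i) = j" using U_seqsD(1)[OF *(3)] i(1) n(1) lev_inject by blast
    then show "j \<in> I" unfolding I using i by blast
  qed
qed

text \<open>Indices strictly increase along the sequence, so all coordinates of modulus
  \<open>lev j\<close> come from one member, whose support size is bounded by the definition of
  \<open>G1j\<close>.\<close>

lemma Gsp_graded:
  assumes "\<phi> \<in> Gsp L M1 \<sigma> \<xi>"
  shows "graded \<phi>"
proof -
  obtain I where I: "(\<phi>, I) \<in> Gsp_ind L M1 \<sigma> \<xi>" using assms by (auto simp: Gsp_def)
  obtain E fs \<epsilon> where rep: "nat_interval E" "fs \<in> special_seqs L M1 \<sigma> \<xi>" "fs \<in> U_seqs"
    "\<forall>i<length fs. \<epsilon> i \<in> {-1, 1}"
    "\<phi> = restr E (\<lambda>n. \<Sum>i<length fs. \<epsilon> i * (fs ! i) n)"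
    "I = {ind (fs ! i) | i. i < length fs \<and> restr E (fs ! i) \<noteq> (\<lambda>n. 0)}"
    "\<forall>n. \<phi> n \<noteq> 0 \<longrightarrow> (\<exists>i<length fs. n \<in> supp (fs ! i) \<and> n \<in> E)"
    "\<forall>i n. i < length fs \<longrightarrow> n \<in> supp (fs ! i) \<longrightarrow> n \<in> E \<longrightarrow> \<bar>\<phi> n\<bar> = lev (ind (fs ! i))"
    by (rule GspE[OF I])
  note * = rep[rule_format]
  have fin: "finite (supp (fs ! i))" if "i < length fs" for i
    using U_seqsD(1)[OF *(3) that] G1jD(1) by blast
  have "supp \<phi> \<subseteq> (\<Union>i<length fs. supp (fs ! i))" using *(7) by (auto simp: supp_def)
  then have "finite (supp \<phi>)" using fin by (meson finite_UN_I finite_lessThan finite_subset lessThan_iff)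
  moreover have "\<exists>j\<ge>1. \<bar>\<phi> n\<bar> = lev j" if "\<phi> n \<noteq> 0" for n
    using *(7)[OF that] *(8) U_seqsD(1)[OF *(3)] by blast
  moreover have "card {n. \<bar>\<phi> n\<bar> = lev j} \<le> n_seq (2 * j - 1)" if j: "1 \<le> j" for j
  proof (cases "{n. \<bar>\<phi> n\<bar> = lev j} = {}")
    case False
    have key: "\<exists>i<length fs. n \<in> supp (fs ! i) \<and> ind (fs ! i) = j" if "\<bar>\<phi> n\<bar> = lev j" for n
    proof -
      have "\<phi> n \<noteq> 0" using that lev_pos[OF j] by auto
      then obtain i where i: "i < length fs" "n \<in> supp (fs ! i)" "n \<in> E" using *(7) by blast
      then have "lev (ind (fs ! i)) = lev j" using *(8) that by metis
      then have "ind (fs ! i) = j" using U_seqsD(1)[OF *(3)] i(1) j lev_inject by blast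
      then show ?thesis using i by blast
    qed
    then obtain i where i: "i < length fs" "ind (fs ! i) = j" using False by blast
    have "{n. \<bar>\<phi> n\<bar> = lev j} \<subseteq> supp (fs ! i)"
    proof
      fix n assume "n \<in> {n. \<bar>\<phi> n\<bar> = lev j}"
      then obtain k where k: "k < length fs" "n \<in> supp (fs ! k)" "ind (fs ! k) = j" using key by blast
      then have "k = i" using U_seqsD(2)[OF *(3)] i by (metis linorder_neqE_nat nless_le)
      then show "n \<in> supp (fs ! i)" using k by simp
    qed
    then have "card {n. \<bar>\<phi> n\<bar> = lev j} \<le> card (supp (fs ! i))" using fin[OF i(1)] by (rule card_mono[rotated])
    also have "\<dots> \<le> n_seq (2 * j - 1)" using G1jD(3) U_seqsD(1)[OF *(3) i(1)] i(2) by blast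
    finally show ?thesis .
  qed simp
  ultimately show ?thesis unfolding graded_def by blast
qed

text \<open>
  Indices increase along a special sequence, so cutting to an interval of indices amounts to
  shrinking \<open>E\<close>.
\<close>

lemma Gsp_cut:
  assumes "\<phi> \<in> Gsp L M1 \<sigma> \<xi>" and J: "\<And>a b c. a \<in> J \<Longrightarrow> c \<in> J \<Longrightarrow> a \<le> b \<Longrightarrow> b \<le> c \<Longrightarrow> b \<in> J"
  shows "index_cut J \<phi> \<in> Gsp L M1 \<sigma> \<xi>"
proof -
  obtain I where I: "(\<phi>, I) \<in> Gsp_ind L M1 \<sigma> \<xi>" using assms by (auto simp: Gsp_def)
  obtain E fs \<epsilon> where rep: "nat_interval E" "fs \<in> special_seqs L M1 \<sigma> \<xi>" "fs \<in> U_seqs"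
    "\<forall>i<length fs. \<epsilon> i \<in> {-1, 1}"
    "\<phi> = restr E (\<lambda>n. \<Sum>i<length fs. \<epsilon> i * (fs ! i) n)"
    "I = {ind (fs ! i) | i. i < length fs \<and> restr E (fs ! i) \<noteq> (\<lambda>n. 0)}"
    "\<forall>n. \<phi> n \<noteq> 0 \<longrightarrow> (\<exists>i<length fs. n \<in> supp (fs ! i) \<and> n \<in> E)"
    "\<forall>i n. i < length fs \<longrightarrow> n \<in> supp (fs ! i) \<longrightarrow> n \<in> E \<longrightarrow> \<bar>\<phi> n\<bar> = lev (ind (fs ! i))"
    by (rule GspE[OF I])
  note * = rep[rule_format]
  define S where "S = {i. i < length fs \<and> ind (fs ! i) \<in> J}"
  \<comment> \<open>\<open>E\<close> cut down to the hull of the supports of the members with index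
    in \<open>J\<close>.\<close>
  define E' where "E' = {n\<in>E. \<exists>p\<in>S. \<exists>q\<in>S. Min (supp (fs ! p)) \<le> n \<and> n \<le> Max (supp (fs ! q))}"
  have fin: "finite (supp (fs ! i))" if "i < length fs" for i
    using U_seqsD(1)[OF *(3) that] G1jD(1) by blast
  have "nat_interval E'"
    unfolding nat_interval_def
  proof (intro conjI ballI subsetI)
    show "0 \<notin> E'" using *(1) by (auto simp: E'_def nat_interval_def)
    fix a b n assume ab: "a \<in> E'" "b \<in> E'" and n: "n \<in> {a..b}"
    have "n \<in> E" using *(1) ab n by (auto simp: E'_def nat_interval_def subset_iff)
    obtain p where "p \<in> S" "Min (supp (fs ! p)) \<le> a" using ab by (auto simp: E'_def)
    moreover obtain q where "q \<in> S" "b \<le> Max (supp (fs ! q))" using ab by (auto simp: E'_def)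
    ultimately show "n \<in> E'" using \<open>n \<in> E\<close> n unfolding E'_def by (auto intro: order_trans)
  qed
  moreover have "index_cut J \<phi> = restr E' (\<lambda>n. \<Sum>i<length fs. \<epsilon> i * (fs ! i) n)"
  proof
    fix n
    show "index_cut J \<phi> n = restr E' (\<lambda>n. \<Sum>i<length fs. \<epsilon> i * (fs ! i) n) n"
    proof (cases "\<phi> n = 0")
      case True
      then show ?thesis by (auto simp: index_cut_def *(5) restr_def E'_def)
    next
      case False
      then obtain i where i: "i < length fs" "n \<in> supp (fs ! i)" "n \<in> E" using *(7) by blast
      have lev: "\<bar>\<phi> n\<bar> = lev (ind (fs ! i))" using *(8) i by blast
      have "(\<exists>j\<in>J. 1 \<le> j \<and> \<bar>\<phi> n\<bar> = lev j) \<longleftrightarrow> i \<in> S"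
        using lev U_seqsD(1)[OF *(3) i(1)] lev_inject i(1) by (auto simp: S_def)
      moreover have "i \<in> S \<longleftrightarrow> n \<in> E'"
      proof
        assume "i \<in> S"
        then show "n \<in> E'" using i fin by (auto simp: E'_def intro!: bexI[of _ i])
      next
        assume "n \<in> E'"
        then obtain p q where pq: "p \<in> S" "q \<in> S" "Min (supp (fs ! p)) \<le> n" "n \<le> Max (supp (fs ! q))"
          by (auto simp: E'_def)
        have len: "p < length fs" "q < length fs" using pq by (auto simp: S_def)
        have ne: "supp (fs ! p) \<noteq> {}" "supp (fs ! q) \<noteq> {}"
          using U_seqsD(1)[OF *(3)] len G1jD(2) by blast+
        \<comment> \<open>Supports are successive, so a point of member \<open>i\<close> inside the
          hull forces \<open>p \<le> i \<le> q\<close>. Its index then lies between two elements of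
          the convex set \<open>J\<close>.\<close>
        have "p \<le> i"
        proof (rule ccontr)
          assume "\<not> p \<le> i"
          then have "n < Min (supp (fs ! p))" using U_seqsD(3)[OF *(3), of i p n] i len ne by auto
          then show False using pq by simp
        qed
        moreover have "i \<le> q"
        proof (rule ccontr)
          assume "\<not> i \<le> q"
          then have "Max (supp (fs ! q)) < n" using U_seqsD(3)[OF *(3), of q i _ n] i len ne by auto
          then show False using pq by simp
        qed
        ultimately have "ind (fs ! p) \<le> ind (fs ! i)" "ind (fs ! i) \<le> ind (fs ! q)"
          using U_seqsD(2)[OF *(3)] i len by (metis le_eq_less_or_eq order_refl)+
        then show "i \<in> S" using J pq i by (auto simp: S_def)
      qed
      moreover have "\<phi> n = (\<Sum>i<length fs. \<epsilon> i * (fs ! i) n)" using False by (auto simp: *(5) restr_def)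
      ultimately show ?thesis by (simp add: index_cut_def restr_def)
    qed
  qed
  ultimately have "(index_cut J \<phi>, {ind (fs ! i) | i. i < length fs \<and> restr E' (fs ! i) \<noteq> (\<lambda>n. 0)})
      \<in> Gsp_ind L M1 \<sigma> \<xi>"
    unfolding Gsp_ind_def using *(2,4) by blast
  then show ?thesis unfolding Gsp_def by force
qed

text \<open>The zero functional is included so that cutting to an interval of indices does not leave the set.\<close>

definition norming_rows :: "(nat \<Rightarrow> real) set" where
  "norming_rows = Gsp L M1 \<sigma> \<xi> \<union> G1 \<union> {\<lambda>n. 0}"

lemma rows_graded: "\<phi> \<in> norming_rows \<Longrightarrow> graded \<phi>"
proof -
  have "graded (\<lambda>n. 0)"
    using lev_pos by (auto simp: graded_def supp_def)
  then show "\<phi> \<in> norming_rows \<Longrightarrow> graded \<phi>"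
    using Gsp_graded G1j_graded by (auto simp: norming_rows_def G1_def)
qed

lemma rows_cut:
  assumes "\<phi> \<in> norming_rows" and J: "\<And>a b c. a \<in> J \<Longrightarrow> c \<in> J \<Longrightarrow> a \<le> b \<Longrightarrow> b \<le> c \<Longrightarrow> b \<in> J"
  shows "index_cut J \<phi> \<in> norming_rows"
proof -
  consider "\<phi> \<in> Gsp L M1 \<sigma> \<xi>" | "\<phi> \<in> G1" | "\<phi> = (\<lambda>n. 0)"
    using assms(1) unfolding norming_rows_def by blast
  then show ?thesis
  proof cases
    case 1
    have "index_cut J \<phi> \<in> Gsp L M1 \<sigma> \<xi>" by (rule Gsp_cut[OF 1]) (rule J)
    then show ?thesis unfolding norming_rows_def by blast
  next
    case 2
    then obtain j where j: "1 \<le> j" "\<phi> \<in> G1j j" unfolding G1_def by blast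
    then have "index_cut J \<phi> = \<phi> \<or> index_cut J \<phi> = (\<lambda>n. 0)"
      using G1j_graded[OF j(2,1)] cut_id[of \<phi> J] cut_empty[of \<phi> J] by (cases "j \<in> J") auto
    then show ?thesis using 2 unfolding norming_rows_def by auto
  next
    case 3
    then have "index_cut J \<phi> = (\<lambda>n. 0)" by (simp add: index_cut_def fun_eq_iff)
    then show ?thesis by (simp add: norming_rows_def)
  qed
qed

end

section \<open>Evaluating the norm\<close>

text \<open>\<open>act\<close> sums over the support of the functional, which changes under cuts and
  combinations. Summing over the support of the vector makes linearity in the functional immediate;
  \<open>act_eq_pairing\<close> reconciles the two.\<close>

definition pairing :: "(nat \<Rightarrow> real) \<Rightarrow> (nat \<Rightarrow> real) \<Rightarrow> real" where
  "pairing \<phi> x = (\<Sum>n\<in>supp x. \<phi> n * x n)"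

lemma finite_supp: "x \<in> c00 \<Longrightarrow> finite (supp x)"
  by (simp add: c00_def supp_def)

lemma pairing_superset:
  assumes "finite A" "supp x \<subseteq> A"
  shows "pairing \<phi> x = (\<Sum>n\<in>A. \<phi> n * x n)"
  unfolding pairing_def using assms by (intro sum.mono_neutral_left) (auto simp: supp_def)

lemma act_eq_pairing:
  assumes "finite (supp \<phi>)" "finite (supp x)"
  shows "act \<phi> x = pairing \<phi> x"
proof -
  have "act \<phi> x = (\<Sum>n\<in>supp \<phi> \<union> supp x. \<phi> n * x n)"
    unfolding act_def using assms by (intro sum.mono_neutral_left) (auto simp: supp_def)
  also have "\<dots> = pairing \<phi> x"
    by (rule pairing_superset[symmetric]) (use assms in auto)
  finally show ?thesis .
qed

lemma supp_sum_subset: "supp (\<lambda>n. \<Sum>i\<in>S. a i * \<phi> i n) \<subseteq> (\<Union>i\<in>S. supp (\<phi> i))"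
proof
  fix n assume "n \<in> supp (\<lambda>n. \<Sum>i\<in>S. a i * \<phi> i n)"
  then have "(\<Sum>i\<in>S. a i * \<phi> i n) \<noteq> 0" by (simp add: supp_def)
  then obtain i where "i \<in> S" "\<phi> i n \<noteq> 0" by (metis (no_types, lifting) mult_zero_right sum.neutral)
  then show "n \<in> (\<Union>i\<in>S. supp (\<phi> i))" by (auto simp: supp_def)
qed

lemma pairing_sum: "pairing (\<lambda>n. \<Sum>i\<in>S. a i * \<phi> i n) x = (\<Sum>i\<in>S. a i * pairing (\<phi> i) x)"
  unfolding pairing_def sum_distrib_left sum_distrib_right
  by (subst sum.swap) (simp add: mult.assoc)

lemma pairing_add: "pairing (\<lambda>n. s * \<phi> n + t * \<psi> n) x = s * pairing \<phi> x + t * pairing \<psi> x"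
  by (simp add: pairing_def sum.distrib sum_distrib_left algebra_simps)

lemma pairing_sum_right:
  assumes "finite T" "\<And>t. t \<in> T \<Longrightarrow> finite (supp (x t))"
  shows "pairing \<phi> (\<lambda>n. \<Sum>t\<in>T. x t n) = (\<Sum>t\<in>T. pairing \<phi> (x t))"
proof -
  define A where "A = (\<Union>t\<in>T. supp (x t))"
  have A: "finite A" using assms by (simp add: A_def)
  have "supp (\<lambda>n. \<Sum>t\<in>T. x t n) \<subseteq> A"
    unfolding A_def supp_def by (auto dest: sum.not_neutral_contains_not_neutral)
  then have "pairing \<phi> (\<lambda>n. \<Sum>t\<in>T. x t n) = (\<Sum>n\<in>A. \<phi> n * (\<Sum>t\<in>T. x t n))"
    by (rule pairing_superset[OF A])
  also have "\<dots> = (\<Sum>t\<in>T. \<Sum>n\<in>A. \<phi> n * x t n)"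
    unfolding sum_distrib_left by (rule sum.swap)
  also have "\<dots> = (\<Sum>t\<in>T. pairing \<phi> (x t))"
    by (intro sum.cong refl pairing_superset[symmetric] A) (auto simp: A_def)
  finally show ?thesis .
qed

lemma sum_half_powers_le:
  assumes "finite F" "F \<subseteq> {b<..}"
  shows "(\<Sum>j\<in>F. (1/2::real) ^ j) \<le> (1/2) ^ b"
proof -
  have eq: "(\<Sum>j\<in>{b<..b + N}. (1/2::real) ^ j) = (1/2) ^ b - (1/2) ^ (b + N)" for N
  proof (induction N)
    case (Suc N)
    have "{b<..b + Suc N} = insert (b + Suc N) {b<..b + N}" by auto
    then show ?case using Suc by (simp add: power_add)
  qed simp
  have "F \<subseteq> {b<..b + Max F}"
  proof
    fix j assume "j \<in> F"
    then have "j \<le> Max F" "b < j" using assms by auto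
    then show "j \<in> {b<..b + Max F}" by simp
  qed
  then have "(\<Sum>j\<in>F. (1/2::real) ^ j) \<le> (\<Sum>j\<in>{b<..b + Max F}. (1/2) ^ j)"
    by (intro sum_mono2) auto
  also have "\<dots> \<le> (1/2) ^ b" unfolding eq by simp
  finally show ?thesis .
qed

text \<open>At a fixed coordinate the rows with nonzero value have distinct levels, since their
  index sets are disjoint, and the levels of any set of indices beyond \<open>b\<close> add up to at
  most \<open>(1/2) ^ b\<close>.\<close>

lemma sum_graded_le:
  assumes fin: "finite S" and gr: "\<And>i. i \<in> S \<Longrightarrow> graded (\<phi> i)"
    and b: "\<And>i. i \<in> S \<Longrightarrow> idx (\<phi> i) \<subseteq> {b<..}" and disj: "disjoint_family_on (\<lambda>i. idx (\<phi> i)) S"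
  shows "(\<Sum>i\<in>S. \<bar>\<phi> i n\<bar>) \<le> (1/2) ^ b"
proof -
  define S' where "S' = {i\<in>S. \<phi> i n \<noteq> 0}"
  have "\<forall>i\<in>S'. \<exists>j. 1 \<le> j \<and> \<bar>\<phi> i n\<bar> = lev j" using gr unfolding S'_def graded_def by blast
  then have "\<exists>j. \<forall>i\<in>S'. 1 \<le> j i \<and> \<bar>\<phi> i n\<bar> = lev (j i)" by (rule bchoice)
  then obtain j where j: "\<And>i. i \<in> S' \<Longrightarrow> 1 \<le> j i" "\<And>i. i \<in> S' \<Longrightarrow> \<bar>\<phi> i n\<bar> = lev (j i)"
    by blast
  have jidx: "j i \<in> idx (\<phi> i)" if "i \<in> S'" for i using j that by (auto simp: idx_def)
  have inj: "inj_on j S'"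
  proof (rule inj_onI)
    fix i k assume "i \<in> S'" "k \<in> S'" "j i = j k"
    then have "idx (\<phi> i) \<inter> idx (\<phi> k) \<noteq> {}" using jidx by (metis IntI empty_iff)
    then show "i = k" using disj \<open>i \<in> S'\<close> \<open>k \<in> S'\<close> by (auto simp: disjoint_family_on_def S'_def)
  qed
  have "(\<Sum>i\<in>S. \<bar>\<phi> i n\<bar>) = (\<Sum>i\<in>S'. \<bar>\<phi> i n\<bar>)"
    using fin by (intro sum.mono_neutral_right) (auto simp: S'_def)
  also have "\<dots> \<le> (\<Sum>i\<in>S'. (1/2) ^ j i)" using j lev_le by (intro sum_mono) simp
  also have "\<dots> = (\<Sum>k\<in>j ` S'. (1/2) ^ k)" using inj by (simp add: sum.reindex)
  also have "\<dots> \<le> (1/2) ^ b"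
    by (rule sum_half_powers_le) (use fin jidx b in \<open>auto simp: S'_def\<close>)
  finally show ?thesis .
qed

section \<open>Combinations of rows with disjoint index sets, and the norm\<close>

context coding
begin

text \<open>Compared with \<open>Gl2\<close>, coefficients are real, rows may vanish and indices are
  confined to \<open>J\<close>. This gives stability under cutting and normalizing, while
  \<open>l2_sums_le_norm\<close> keeps the values below the norm.\<close>

definition l2_family :: "nat set \<Rightarrow> nat set \<Rightarrow> (nat \<Rightarrow> real) \<Rightarrow> (nat \<Rightarrow> nat \<Rightarrow> real) \<Rightarrow> bool" where
  "l2_family J S a \<phi> \<longleftrightarrow> finite S \<and> (\<forall>i\<in>S. \<phi> i \<in> norming_rows \<and> idx (\<phi> i) \<subseteq> J) \<and>
     (\<Sum>i\<in>S. (a i)\<^sup>2) \<le> 1 \<and> disjoint_family_on (\<lambda>i. idx (\<phi> i)) S"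

definition l2_sums :: "nat set \<Rightarrow> (nat \<Rightarrow> real) set" where
  "l2_sums J = {(\<lambda>n. \<Sum>i\<in>S. a i * \<phi> i n) | S a \<phi>. l2_family J S a \<phi>}"

lemma l2_sums_I: "l2_family J S a \<phi> \<Longrightarrow> (\<lambda>n. \<Sum>i\<in>S. a i * \<phi> i n) \<in> l2_sums J"
  unfolding l2_sums_def by blast

lemma l2_family_coeff_le: "l2_family J S a \<phi> \<Longrightarrow> i \<in> S \<Longrightarrow> \<bar>a i\<bar> \<le> 1"
proof -
  assume *: "l2_family J S a \<phi>" "i \<in> S"
  have "(a i)\<^sup>2 \<le> (\<Sum>i\<in>S. (a i)\<^sup>2)" by (rule member_le_sum) (use * in \<open>auto simp: l2_family_def\<close>)
  then have "(a i)\<^sup>2 \<le> 1" using * by (simp add: l2_family_def)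
  then show ?thesis using abs_square_le_1 by blast
qed

lemma l2_sums_mono: "J \<subseteq> K \<Longrightarrow> l2_sums J \<subseteq> l2_sums K"
  unfolding l2_sums_def l2_family_def by blast

lemma l2_sums_abs_le:
  assumes "\<psi> \<in> l2_sums {b<..}"
  shows "\<bar>\<psi> n\<bar> \<le> (1/2) ^ b"
proof -
  obtain S a \<phi> where *: "l2_family {b<..} S a \<phi>" "\<psi> = (\<lambda>n. \<Sum>i\<in>S. a i * \<phi> i n)"
    using assms unfolding l2_sums_def by blast
  have "\<bar>\<psi> n\<bar> \<le> (\<Sum>i\<in>S. \<bar>a i * \<phi> i n\<bar>)" unfolding *(2) by (rule sum_abs)
  also have "\<dots> \<le> (\<Sum>i\<in>S. \<bar>\<phi> i n\<bar>)"
    unfolding abs_mult using l2_family_coeff_le[OF *(1)] by (intro sum_mono mult_left_le_one_le) auto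
  also have "\<dots> \<le> (1/2) ^ b"
    by (rule sum_graded_le) (use *(1) rows_graded in \<open>auto simp: l2_family_def\<close>)
  finally show ?thesis .
qed

lemma idx_pos: "idx \<phi> \<subseteq> {0<..}"
  by (auto simp: idx_def)

lemma l2_sums_abs_le_1:
  assumes "\<psi> \<in> l2_sums J"
  shows "\<bar>\<psi> n\<bar> \<le> 1"
proof -
  have "\<psi> \<in> l2_sums {0<..}" using assms idx_pos unfolding l2_sums_def l2_family_def by blast
  from l2_sums_abs_le[OF this, of n] show ?thesis by simp
qed

lemma l2_sums_finite_supp:
  assumes "\<psi> \<in> l2_sums J"
  shows "finite (supp \<psi>)"
proof -
  obtain S a \<phi> where *: "l2_family J S a \<phi>" "\<psi> = (\<lambda>n. \<Sum>i\<in>S. a i * \<phi> i n)"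
    using assms unfolding l2_sums_def by blast
  have "supp \<psi> \<subseteq> (\<Union>i\<in>S. supp (\<phi> i))"
    unfolding *(2) by (rule supp_sum_subset)
  moreover have "finite (\<Union>i\<in>S. supp (\<phi> i))"
    using *(1) rows_graded by (auto simp: l2_family_def graded_def)
  ultimately show ?thesis by (rule finite_subset)
qed

text \<open>Each level up to \<open>b\<close> belongs to at most one row, so the size of the support
  of \<open>\<psi>\<close> is bounded in terms of \<open>b\<close> alone. On a sum of many disjoint
  blocks the sup-norm does not grow, hence neither does this contribution.\<close>

lemma l2_sums_pairing_le:
  fixes c :: real
  assumes "\<psi> \<in> l2_sums {..b}" "finite (supp x)" and c: "\<And>n. \<bar>x n\<bar> \<le> c"
  shows "pairing \<psi> x \<le> real (\<Sum>j\<in>{1..b}. n_seq (2 * j - 1)) * c"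
proof -
  obtain S a \<phi> where *: "l2_family {..b} S a \<phi>" "\<psi> = (\<lambda>n. \<Sum>i\<in>S. a i * \<phi> i n)"
    using assms unfolding l2_sums_def by blast
  have fin: "finite S" and gr: "\<And>i. i \<in> S \<Longrightarrow> graded (\<phi> i)"
    and b: "\<And>i. i \<in> S \<Longrightarrow> idx (\<phi> i) \<subseteq> {..b}" and disj: "disjoint_family_on (\<lambda>i. idx (\<phi> i)) S"
    using *(1) rows_graded by (auto simp: l2_family_def)
  have c0: "0 \<le> c" using c[of 0] by linarith
  define A where "A j = {n. \<exists>i\<in>S. \<bar>\<phi> i n\<bar> = lev j}" for j
  have A: "finite (A j) \<and> card (A j) \<le> n_seq (2 * j - 1)" if j: "1 \<le> j" for j
  proof (cases "A j = {}")
    case False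
    then obtain i where i: "i \<in> S" "j \<in> idx (\<phi> i)" using j by (auto simp: A_def idx_def)
    have "A j = {n. \<bar>\<phi> i n\<bar> = lev j}"
    proof (intro equalityI subsetI)
      fix n assume "n \<in> A j"
      then obtain k where k: "k \<in> S" "\<bar>\<phi> k n\<bar> = lev j" by (auto simp: A_def)
      then have "j \<in> idx (\<phi> k)" using j by (auto simp: idx_def)
      then have "k = i" using disj i k by (auto simp: disjoint_family_on_def)
      then show "n \<in> {n. \<bar>\<phi> i n\<bar> = lev j}" using k by simp
    qed (use i in \<open>auto simp: A_def\<close>)
    moreover have "{n. \<bar>\<phi> i n\<bar> = lev j} \<subseteq> supp (\<phi> i)" using lev_pos[OF j] by (auto simp: supp_def)
    ultimately show ?thesis using gr[OF i(1)] j by (auto simp: graded_def intro: finite_subset)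
  qed simp
  have sub: "supp \<psi> \<subseteq> (\<Union>j\<in>{1..b}. A j)"
  proof
    fix n assume "n \<in> supp \<psi>"
    then have "(\<Sum>i\<in>S. a i * \<phi> i n) \<noteq> 0" by (simp add: *(2) supp_def)
    then obtain i where i: "i \<in> S" "\<phi> i n \<noteq> 0"
      by (metis (no_types, lifting) mult_zero_right sum.neutral)
    then obtain j where "1 \<le> j" "\<bar>\<phi> i n\<bar> = lev j" using gr unfolding graded_def by blast
    then have "1 \<le> j" "j \<le> b" "n \<in> A j" using b[OF i(1)] i by (auto simp: A_def idx_def)
    then show "n \<in> (\<Union>j\<in>{1..b}. A j)" by auto
  qed
  have finA: "finite (\<Union>j\<in>{1..b}. A j)" using A by auto
  have "card (supp \<psi>) \<le> card (\<Union>j\<in>{1..b}. A j)" using sub finA by (rule card_mono[rotated])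
  also have "\<dots> \<le> (\<Sum>j\<in>{1..b}. card (A j))" by (rule card_UN_le) simp
  also have "\<dots> \<le> (\<Sum>j\<in>{1..b}. n_seq (2 * j - 1))" by (intro sum_mono) (use A in auto)
  finally have card: "card (supp \<psi>) \<le> (\<Sum>j\<in>{1..b}. n_seq (2 * j - 1))" .
  have "pairing \<psi> x = act \<psi> x"
    using act_eq_pairing[OF l2_sums_finite_supp[OF assms(1)] assms(2)] by simp
  also have "\<dots> \<le> (\<Sum>n\<in>supp \<psi>. c)"
    unfolding act_def
  proof (rule sum_mono)
    fix n
    have "\<psi> n * x n \<le> \<bar>\<psi> n\<bar> * \<bar>x n\<bar>" by (metis abs_ge_self abs_mult)
    also have "\<dots> \<le> 1 * c" using c c0 l2_sums_abs_le_1[OF assms(1)] by (intro mult_mono) auto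
    finally show "\<psi> n * x n \<le> c" by simp
  qed
  also have "\<dots> = card (supp \<psi>) * c" by simp
  also have "\<dots> \<le> real (\<Sum>j\<in>{1..b}. n_seq (2 * j - 1)) * c"
    using card c0 by (intro mult_right_mono of_nat_mono)
  finally show ?thesis .
qed

text \<open>For a fixed vector large indices are invisible: by \<open>l2_sums_abs_le\<close> the
  coordinates of the functionals tend to zero uniformly, against the fixed sum of
  \<open>\<bar>x n\<bar>\<close>.\<close>

lemma l2_sums_tail:
  assumes "x \<in> c00" "0 < \<epsilon>"
  obtains b where "\<And>\<psi> c. b \<le> c \<Longrightarrow> \<psi> \<in> l2_sums {c<..} \<Longrightarrow> pairing \<psi> x \<le> \<epsilon>"
proof -
  define s where "s = 1 + (\<Sum>n\<in>supp x. \<bar>x n\<bar>)"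
  have s: "0 < s" unfolding s_def by (simp add: add_pos_nonneg sum_nonneg)
  obtain b where b: "(1/2::real) ^ b < \<epsilon> / s"
    using real_arch_pow_inv[of "\<epsilon> / s" "1/2"] assms s by auto
  show thesis
  proof (rule that[of b])
    fix \<psi> c assume *: "b \<le> c" "\<psi> \<in> l2_sums {c<..}"
    have "pairing \<psi> x \<le> (\<Sum>n\<in>supp x. (1/2) ^ b * \<bar>x n\<bar>)"
      unfolding pairing_def
    proof (rule sum_mono)
      fix n
      have "\<psi> n * x n \<le> \<bar>\<psi> n\<bar> * \<bar>x n\<bar>" by (metis abs_ge_self abs_mult)
      also have "\<bar>\<psi> n\<bar> \<le> (1/2) ^ c" using l2_sums_abs_le *(2) by blast
      also have "(1/2::real) ^ c \<le> (1/2) ^ b" using *(1) by (intro power_decreasing) auto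
      finally show "\<psi> n * x n \<le> (1/2) ^ b * \<bar>x n\<bar>" by (simp add: mult_right_mono)
    qed
    also have "\<dots> \<le> (1/2) ^ b * s" unfolding sum_distrib_left[symmetric] s_def by simp
    also have "\<dots> \<le> \<epsilon>" using b s by (simp add: field_simps)
    finally show "pairing \<psi> x \<le> \<epsilon>" .
  qed
qed

lemma rows_subset_l2_sums: "\<phi> \<in> norming_rows \<Longrightarrow> idx \<phi> \<subseteq> J \<Longrightarrow> \<phi> \<in> l2_sums J"
  unfolding l2_sums_def l2_family_def
  by (intro CollectI exI[of _ "{0}"] exI[of _ "\<lambda>_. 1"] exI[of _ "\<lambda>_. \<phi>"])
    (auto simp: disjoint_family_on_def)

lemma G_set_cases:
  assumes "\<phi> \<in> G_set L M1 \<sigma> \<xi>"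
  shows "\<phi> \<in> G0 \<or> \<phi> \<in> l2_sums UNIV"
proof -
  have "\<phi> \<in> l2_sums UNIV" if "\<phi> \<in> Gl2 L M1 \<sigma> \<xi>"
  proof -
    obtain d :: nat and a \<phi>' I where *: "\<phi> = (\<lambda>n. \<Sum>i\<in>{1..d}. a i * \<phi>' i n)"
      "(\<Sum>i\<in>{1..d}. (a i)\<^sup>2) \<le> 1" "\<forall>i\<in>{1..d}. (\<phi>' i, I i) \<in> Gsp_ind L M1 \<sigma> \<xi> \<union> G1_ind"
      "\<forall>i\<in>{1..d}. \<forall>k\<in>{1..d}. i \<noteq> k \<longrightarrow> I i \<inter> I k = {}"
      using \<open>\<phi> \<in> Gl2 L M1 \<sigma> \<xi>\<close> unfolding Gl2_def by blast
    have row: "\<phi>' i \<in> norming_rows \<and> I i = idx (\<phi>' i)" if "i \<in> {1..d}" for i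
    proof -
      consider "(\<phi>' i, I i) \<in> Gsp_ind L M1 \<sigma> \<xi>" | "(\<phi>' i, I i) \<in> G1_ind" using *(3) \<open>i \<in> {1..d}\<close> by blast
      then show ?thesis
      proof cases
        case 1
        then have "\<phi>' i \<in> Gsp L M1 \<sigma> \<xi>" unfolding Gsp_def by force
        then show ?thesis using Gsp_ind_idx[OF 1] unfolding norming_rows_def by blast
      next
        case 2
        then obtain j where "1 \<le> j" "\<phi>' i \<in> G1j j" "I i = {j}" unfolding G1_ind_def by blast
        then show ?thesis using G1j_graded(2) unfolding norming_rows_def G1_def by auto
      qed
    qed
    have "l2_family UNIV {1..d} a \<phi>'"
      unfolding l2_family_def disjoint_family_on_def using row *(2,4) by auto
    then show ?thesis unfolding *(1) by (rule l2_sums_I)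
  qed
  then show ?thesis using assms rows_subset_l2_sums[of \<phi> UNIV] by (auto simp: G_set_def norming_rows_def)
qed

lemma bdd_above_act:
  assumes "x \<in> c00"
  shows "bdd_above ((\<lambda>\<phi>. act \<phi> x) ` G_set L M1 \<sigma> \<xi>)"
proof (rule bdd_aboveI2)
  fix \<phi> assume "\<phi> \<in> G_set L M1 \<sigma> \<xi>"
  then consider "\<phi> \<in> G0" | "\<phi> \<in> l2_sums UNIV" using G_set_cases by blast
  then have "finite (supp \<phi>) \<and> (\<forall>n. \<bar>\<phi> n\<bar> \<le> 1)"
  proof cases
    case 1
    then obtain n \<epsilon> where *: "\<phi> = (\<lambda>k. if k = n then \<epsilon> else 0)" "\<epsilon> \<in> {-1, 1::real}" unfolding G0_def by blast
    have "supp \<phi> \<subseteq> {n}" unfolding * supp_def by auto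
    then show ?thesis using * finite_subset by auto
  qed (use l2_sums_finite_supp l2_sums_abs_le_1 in blast)
  then have fin: "finite (supp \<phi>)" and le: "\<And>n. \<bar>\<phi> n\<bar> \<le> 1" by auto
  have "act \<phi> x = pairing \<phi> x" using act_eq_pairing[OF fin finite_supp[OF assms]] .
  also have "\<dots> \<le> (\<Sum>n\<in>supp x. \<bar>x n\<bar>)"
    unfolding pairing_def
  proof (rule sum_mono)
    fix n
    have "\<phi> n * x n \<le> \<bar>\<phi> n\<bar> * \<bar>x n\<bar>" by (metis abs_ge_self abs_mult)
    also have "\<dots> \<le> 1 * \<bar>x n\<bar>" using le by (intro mult_right_mono) auto
    finally show "\<phi> n * x n \<le> \<bar>x n\<bar>" by simp
  qed
  finally show "act \<phi> x \<le> (\<Sum>n\<in>supp x. \<bar>x n\<bar>)" .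
qed

lemma act_le_norm: "x \<in> c00 \<Longrightarrow> \<phi> \<in> G_set L M1 \<sigma> \<xi> \<Longrightarrow> act \<phi> x \<le> N x"
  unfolding G_norm_def using bdd_above_act by (intro cSUP_upper)

lemma abs_le_norm:
  assumes "x \<in> c00"
  shows "\<bar>x n\<bar> \<le> N x"
proof -
  have le: "e * x n \<le> N x" if "1 \<le> n" "e \<in> {-1, 1}" for n e
  proof -
    define \<phi> where "\<phi> k = (if k = n then e else 0)" for k
    have "\<phi> \<in> G0" unfolding G0_def \<phi>_def[abs_def] using that by blast
    then have "act \<phi> x \<le> N x" using act_le_norm[OF assms] by (simp add: G_set_def)
    moreover have "supp \<phi> = {n}" using that by (auto simp: supp_def \<phi>_def)
    ultimately show ?thesis by (simp add: act_def \<phi>_def)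
  qed
  have "\<bar>x n\<bar> \<le> N x" if "1 \<le> n" for n
    using le[OF that, of 1] le[OF that, of "-1"] by auto
  moreover from this[of 1] have "0 \<le> N x" by simp
  ultimately show ?thesis
    using assms by (cases "n = 0") (auto simp: c00_def)
qed

lemma G_norm_le:
  assumes "x \<in> c00" "\<And>n. \<bar>x n\<bar> \<le> c" "\<And>\<psi>. \<psi> \<in> l2_sums UNIV \<Longrightarrow> pairing \<psi> x \<le> c"
  shows "N x \<le> c"
  unfolding G_norm_def
proof (rule cSUP_least)
  show "G_set L M1 \<sigma> \<xi> \<noteq> {}" unfolding G_set_def G0_def by blast
  fix \<phi> assume "\<phi> \<in> G_set L M1 \<sigma> \<xi>"
  then consider "\<phi> \<in> G0" | "\<phi> \<in> l2_sums UNIV" using G_set_cases by blast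
  then show "act \<phi> x \<le> c"
  proof cases
    case 1
    then obtain n \<epsilon> where *: "\<phi> = (\<lambda>k. if k = n then \<epsilon> else 0)" "\<epsilon> \<in> {-1, 1::real}" unfolding G0_def by blast
    have "supp \<phi> = {n}" unfolding *(1) supp_def using *(2) by auto
    then have "act \<phi> x = \<epsilon> * x n" by (simp add: act_def *(1))
    also have "\<dots> \<le> \<bar>x n\<bar>" using *(2) by auto
    finally show ?thesis using assms(2)[of n] by simp
  next
    case 2
    then show ?thesis
      using assms(3) act_eq_pairing[OF l2_sums_finite_supp[OF 2] finite_supp[OF assms(1)]] by simp
  qed
qed

text \<open>Rational combinations of the nonzero rows are members of \<open>Gl2\<close>, and
  \<open>sum_le_of_rational_sums\<close> passes to real coefficients.\<close>

lemma l2_sums_le_norm: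
  assumes "x \<in> c00" "\<psi> \<in> l2_sums J"
  shows "pairing \<psi> x \<le> N x"
proof -
  obtain S a \<phi> where *: "l2_family J S a \<phi>" "\<psi> = (\<lambda>n. \<Sum>i\<in>S. a i * \<phi> i n)"
    using assms unfolding l2_sums_def by blast
  have N0: "0 \<le> N x" using abs_le_norm[OF assms(1), of 0] by linarith
  \<comment> \<open>Zero rows pair to zero; they are set aside because they may fail to lie in
    \<open>Gsp\<close> or \<open>G1\<close>.\<close>
  define T where "T = {i\<in>S. \<phi> i \<noteq> (\<lambda>n. 0)}"
  have finT: "finite T" using *(1) by (simp add: T_def l2_family_def)
  have row: "(\<phi> i, idx (\<phi> i)) \<in> Gsp_ind L M1 \<sigma> \<xi> \<union> G1_ind" if "i \<in> T" for i
  proof -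
    have "\<phi> i \<in> norming_rows" "\<phi> i \<noteq> (\<lambda>n. 0)" using *(1) that by (auto simp: T_def l2_family_def)
    then consider "\<phi> i \<in> Gsp L M1 \<sigma> \<xi>" | "\<phi> i \<in> G1" by (auto simp: norming_rows_def)
    then show ?thesis
    proof cases
      case 1
      then obtain I where "(\<phi> i, I) \<in> Gsp_ind L M1 \<sigma> \<xi>" unfolding Gsp_def by force
      then show ?thesis using Gsp_ind_idx by blast
    next
      case 2
      then obtain j where "1 \<le> j" "\<phi> i \<in> G1j j" unfolding G1_def by auto
      then show ?thesis using G1j_graded(2) unfolding G1_ind_def by auto
    qed
  qed
  have disj: "idx (\<phi> i) \<inter> idx (\<phi> k) = {}" if "i \<in> T" "k \<in> T" "i \<noteq> k" for i k
    using *(1) that unfolding l2_family_def disjoint_family_on_def T_def by blast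
  have "(\<Sum>i\<in>T. a i * pairing (\<phi> i) x) \<le> N x"
  proof (rule sum_le_of_rational_sums[OF finT])
    have "(\<Sum>i\<in>T. (a i)\<^sup>2) \<le> (\<Sum>i\<in>S. (a i)\<^sup>2)"
      using *(1) by (intro sum_mono2) (auto simp: T_def l2_family_def)
    then show "(\<Sum>i\<in>T. (a i)\<^sup>2) \<le> 1" using *(1) by (simp add: l2_family_def)
    fix q :: "nat \<Rightarrow> real" assume q: "\<forall>i\<in>T. q i \<in> \<rat>" "(\<Sum>i\<in>T. (q i)\<^sup>2) \<le> 1"
    show "(\<Sum>i\<in>T. q i * pairing (\<phi> i) x) \<le> N x"
    \<comment> \<open>\<open>Gl2\<close> asks for \<open>1 \<le> d\<close>, so the empty combination
      is separate and rests on \<open>0 \<le> N x\<close>.\<close>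
    proof (cases "T = {}")
      case False
      obtain f where f: "bij_betw f {1..card T} T" using ex_bij_betw_nat_finite_1[OF finT] by blast
      have mem: "f k \<in> T" if "k \<in> {1..card T}" for k using f that by (rule bij_betwE[rule_format])
      define \<psi>' where "\<psi>' n = (\<Sum>k\<in>{1..card T}. q (f k) * \<phi> (f k) n)" for n
      have \<psi>': "\<psi>' = (\<lambda>n. \<Sum>i\<in>T. q i * \<phi> i n)"
      proof
        show "\<psi>' n = (\<Sum>i\<in>T. q i * \<phi> i n)" for n
          unfolding \<psi>'_def by (rule sum.reindex_bij_betw[OF f, of "\<lambda>i. q i * \<phi> i n"])
      qed
      have "\<psi>' \<in> Gl2 L M1 \<sigma> \<xi>"
        unfolding Gl2_def \<psi>'_def[abs_def]
      proof (intro CollectI exI conjI ballI impI refl)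
        show "1 \<le> card T" using False finT by (simp add: Suc_le_eq card_gt_0_iff)
        show "q (f k) \<in> \<rat>" if "k \<in> {1..card T}" for k using q(1) mem[OF that] by blast
        show "(\<Sum>k\<in>{1..card T}. (q (f k))\<^sup>2) \<le> 1"
          using q(2) sum.reindex_bij_betw[OF f, of "\<lambda>i. (q i)\<^sup>2"] by simp
        show "(\<phi> (f k), idx (\<phi> (f k))) \<in> Gsp_ind L M1 \<sigma> \<xi> \<union> G1_ind" if "k \<in> {1..card T}" for k
          by (rule row[OF mem[OF that]])
        fix i k assume ik: "i \<in> {1..card T}" "k \<in> {1..card T}" "i \<noteq> k"
        then have "f i \<noteq> f k" using bij_betw_imp_inj_on[OF f] by (meson inj_onD)
        then show "idx (\<phi> (f i)) \<inter> idx (\<phi> (f k)) = {}"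
          using mem ik by (intro disj)
      qed simp
      then have G: "\<psi>' \<in> G_set L M1 \<sigma> \<xi>" by (simp add: G_set_def)
      have "supp \<psi>' \<subseteq> (\<Union>i\<in>T. supp (\<phi> i))"
        unfolding \<psi>' by (rule supp_sum_subset)
      moreover have "finite (\<Union>i\<in>T. supp (\<phi> i))"
        using finT *(1) rows_graded by (auto simp: l2_family_def graded_def T_def)
      ultimately have "finite (supp \<psi>')" by (rule finite_subset)
      then have "act \<psi>' x = pairing \<psi>' x" using finite_supp[OF assms(1)] by (rule act_eq_pairing)
      also have "\<dots> = (\<Sum>i\<in>T. q i * pairing (\<phi> i) x)"
        unfolding \<psi>' by (rule pairing_sum)
      finally show ?thesis using act_le_norm[OF assms(1) G] by simp
    qed (simp add: N0)
  qed
  also have "(\<Sum>i\<in>T. a i * pairing (\<phi> i) x) = (\<Sum>i\<in>S. a i * pairing (\<phi> i) x)"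
    using *(1) by (intro sum.mono_neutral_left) (auto simp: T_def l2_family_def pairing_def)
  finally show ?thesis unfolding *(2) pairing_sum .
qed

text \<open>Duality in l2: the norm is tested with the coefficients \<open>v i / sqrt V\<close>.
  This is what puts the columns of the matrix of values into the unit ball.\<close>

lemma rows_sum_squares_le:
  fixes S :: "nat set"
  assumes "finite S" "\<And>i. i \<in> S \<Longrightarrow> \<phi> i \<in> norming_rows" "disjoint_family_on (\<lambda>i. idx (\<phi> i)) S" "x \<in> c00"
  shows "(\<Sum>i\<in>S. (pairing (\<phi> i) x)\<^sup>2) \<le> (N x)\<^sup>2"
proof -
  define v where "v i = pairing (\<phi> i) x" for i
  define V where "V = (\<Sum>i\<in>S. (v i)\<^sup>2)"
  have V: "0 \<le> V" by (simp add: V_def sum_nonneg)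
  have "sqrt V \<le> N x"
  proof (cases "V = 0")
    case True
    then show ?thesis using abs_le_norm[OF assms(4), of 0] by simp
  next
    case False
    have "(\<Sum>i\<in>S. (v i / sqrt V)\<^sup>2) = V / V"
      using V by (simp add: power_divide sum_divide_distrib[symmetric] V_def)
    then have "l2_family UNIV S (\<lambda>i. v i / sqrt V) \<phi>"
      unfolding l2_family_def using assms False by simp
    then have "(\<lambda>n. \<Sum>i\<in>S. v i / sqrt V * \<phi> i n) \<in> l2_sums UNIV" by (rule l2_sums_I)
    from l2_sums_le_norm[OF assms(4) this] have "(\<Sum>i\<in>S. v i / sqrt V * v i) \<le> N x"
      unfolding pairing_sum v_def .
    moreover have "(\<Sum>i\<in>S. v i / sqrt V * v i) = V / sqrt V"
      by (simp add: V_def sum_divide_distrib power2_eq_square)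
    ultimately show ?thesis using V by (simp add: real_div_sqrt)
  qed
  then have "(sqrt V)\<^sup>2 \<le> (N x)\<^sup>2" using V by (intro power_mono) auto
  then show ?thesis using V by (simp add: V_def v_def)
qed

lemma l2_family_cut:
  assumes "l2_family K S a \<phi>" and J: "\<And>a b c. a \<in> J \<Longrightarrow> c \<in> J \<Longrightarrow> a \<le> b \<Longrightarrow> b \<le> c \<Longrightarrow> b \<in> J"
  shows "l2_family (K \<inter> J) S a (\<lambda>i. index_cut J (\<phi> i))"
proof -
  have "idx (index_cut J (\<phi> i)) \<subseteq> idx (\<phi> i) \<inter> J" for i by (rule idx_cut)
  moreover have "index_cut J (\<phi> i) \<in> norming_rows" if "i \<in> S" for i
  proof (rule rows_cut)
    show "\<phi> i \<in> norming_rows" using assms(1) that by (auto simp: l2_family_def)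
  qed (rule J)
  ultimately show ?thesis
    using assms(1) unfolding l2_family_def disjoint_family_on_def by blast
qed

text \<open>Disjoint ranges \<open>J\<close> and \<open>J'\<close> keep all rows index-disjoint, so
  two functionals combine with l2 weights rather than convex ones. This is the source of lower
  l2-estimates.\<close>

lemma l2_sums_add:
  assumes "\<psi> \<in> l2_sums J" "\<psi>' \<in> l2_sums J'" "J \<inter> J' = {}" "s\<^sup>2 + t\<^sup>2 \<le> 1"
  shows "(\<lambda>n. s * \<psi> n + t * \<psi>' n) \<in> l2_sums (J \<union> J')"
proof -
  obtain S a \<phi> where 1: "l2_family J S a \<phi>" "\<psi> = (\<lambda>n. \<Sum>i\<in>S. a i * \<phi> i n)"
    using assms unfolding l2_sums_def by blast
  obtain S' a' \<phi>' where 2: "l2_family J' S' a' \<phi>'" "\<psi>' = (\<lambda>n. \<Sum>i\<in>S'. a' i * \<phi>' i n)"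
    using assms unfolding l2_sums_def by blast
  \<comment> \<open>Even positions carry the first family and odd positions the second, so that the
    merged family is again indexed by naturals.\<close>
  define c where "c k = (if even k then s * a (k div 2) else t * a' (k div 2))" for k
  define \<phi>'' where "\<phi>'' k = (if even k then \<phi> (k div 2) else \<phi>' (k div 2))" for k
  define A where "A = (\<lambda>i. 2 * i) ` S"
  define B where "B = (\<lambda>i. Suc (2 * i)) ` S'"
  have fin: "finite A" "finite B" "A \<inter> B = {}"
    using 1 2 by (auto simp: A_def B_def l2_family_def) presburger
  have sum: "(\<Sum>k\<in>A \<union> B. g k) = (\<Sum>i\<in>S. g (2 * i)) + (\<Sum>i\<in>S'. g (Suc (2 * i)))" for g :: "nat \<Rightarrow> real"
    using sum.union_disjoint[OF fin] by (simp add: A_def B_def sum.reindex inj_on_def)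
  have "s\<^sup>2 * (\<Sum>i\<in>S. (a i)\<^sup>2) + t\<^sup>2 * (\<Sum>i\<in>S'. (a' i)\<^sup>2) \<le> s\<^sup>2 * 1 + t\<^sup>2 * 1"
    using 1 2 by (intro add_mono mult_left_mono) (auto simp: l2_family_def)
  then have "(\<Sum>k\<in>A \<union> B. (c k)\<^sup>2) \<le> 1"
    using assms(4) by (simp add: sum c_def power_mult_distrib sum_distrib_left)
  moreover have "\<phi>'' k \<in> norming_rows \<and> idx (\<phi>'' k) \<subseteq> J \<union> J'" if "k \<in> A \<union> B" for k
    using that 1 2 by (auto simp: A_def B_def \<phi>''_def l2_family_def)
  moreover have "idx (\<phi>'' k) \<inter> idx (\<phi>'' l) = {}" if "k \<in> A \<union> B" "l \<in> A \<union> B" "k \<noteq> l" for k l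
  proof -
    have "idx (\<phi> i) \<subseteq> J" if "i \<in> S" for i using 1(1) that by (auto simp: l2_family_def)
    moreover have "idx (\<phi>' i) \<subseteq> J'" if "i \<in> S'" for i using 2(1) that by (auto simp: l2_family_def)
    moreover have "idx (\<phi> i) \<inter> idx (\<phi> k) = {}" if "i \<in> S" "k \<in> S" "i \<noteq> k" for i k
      using 1(1) that by (auto simp: l2_family_def disjoint_family_on_def)
    moreover have "idx (\<phi>' i) \<inter> idx (\<phi>' k) = {}" if "i \<in> S'" "k \<in> S'" "i \<noteq> k" for i k
      using 2(1) that by (auto simp: l2_family_def disjoint_family_on_def)
    ultimately show ?thesis
      using that assms(3) unfolding A_def B_def \<phi>''_def
      by (elim UnE imageE) (simp_all, blast+)
  qed
  ultimately have "l2_family (J \<union> J') (A \<union> B) c \<phi>''"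
    using fin by (auto simp: l2_family_def disjoint_family_on_def)
  moreover have "(\<lambda>n. s * \<psi> n + t * \<psi>' n) = (\<lambda>n. \<Sum>k\<in>A \<union> B. c k * \<phi>'' k n)"
    by (simp add: sum c_def \<phi>''_def 1(2) 2(2) sum_distrib_left mult.assoc)
  ultimately show ?thesis using l2_sums_I by simp
qed

section \<open>Rapidly increasing subsequences\<close>

lemma zero_in_l2_sums: "(\<lambda>n. 0) \<in> l2_sums J"
proof -
  have "l2_family J {} (\<lambda>_. 0) (\<lambda>_ _. 0)" by (simp add: l2_family_def disjoint_family_on_def)
  from l2_sums_I[OF this] show ?thesis by simp
qed

text \<open>
  Otherwise \<open>K\<close> successive blocks of indices each contribute more than \<open>\<epsilon>\<close> to some \<open>y l\<close>, and an
  \<open>\<ell>\<^sub>2\<close>-combination gives norm at least \<open>\<epsilon> \<surd>K\<close>.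
\<close>

lemma ex_index_threshold:
  fixes y :: "nat \<Rightarrow> nat \<Rightarrow> real"
  assumes y: "\<And>k. y k \<in> c00" "\<And>k. N (y k) \<le> 1" and \<epsilon>: "0 < \<epsilon>"
  shows "\<exists>j\<^sub>0 \<Lambda>. infinite \<Lambda> \<and> (\<forall>b. finite {l\<in>\<Lambda>. \<exists>\<psi>\<in>l2_sums {j\<^sub>0<..b}. \<epsilon> < pairing \<psi> (y l)})"
proof (rule ccontr)
  assume neg: "\<not> ?thesis"
  have "\<exists>b \<Lambda>. infinite \<Lambda> \<and> (\<forall>l\<in>\<Lambda>. \<exists>\<psi>\<in>l2_sums {..b}. \<epsilon> * sqrt K \<le> pairing \<psi> (y l))" for K :: nat
  proof (induction K)
    case 0
    have "\<exists>\<psi>\<in>l2_sums {..0}. \<epsilon> * sqrt (real 0) \<le> pairing \<psi> (y l)" for l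
      by (rule bexI[OF _ zero_in_l2_sums]) (simp add: pairing_def)
    then show ?case by (intro exI[of _ 0] exI[of _ UNIV]) simp
  next
    case (Suc K)
    then obtain b \<Lambda> where b: "infinite \<Lambda>" "\<forall>l\<in>\<Lambda>. \<exists>\<psi>\<in>l2_sums {..b}. \<epsilon> * sqrt K \<le> pairing \<psi> (y l)" by blast
    \<comment> \<open>Failure of the claim with \<open>b\<close> as threshold yields infinitely many
      \<open>l\<close> to which a fresh range of indices contributes more than
      \<open>\<epsilon>\<close>.\<close>
    obtain b' where b': "infinite {l\<in>\<Lambda>. \<exists>\<psi>\<in>l2_sums {b<..b'}. \<epsilon> < pairing \<psi> (y l)}"
      using neg b(1) by blast
    have "\<exists>\<psi>\<in>l2_sums {..b + b'}. \<epsilon> * sqrt (Suc K) \<le> pairing \<psi> (y l)"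
      if l: "l \<in> {l\<in>\<Lambda>. \<exists>\<psi>\<in>l2_sums {b<..b'}. \<epsilon> < pairing \<psi> (y l)}" for l
    proof -
      obtain \<psi> where \<psi>: "\<psi> \<in> l2_sums {..b}" "\<epsilon> * sqrt K \<le> pairing \<psi> (y l)" using b(2) l by blast
      obtain \<psi>' where \<psi>': "\<psi>' \<in> l2_sums {b<..b'}" "\<epsilon> < pairing \<psi>' (y l)" using l by blast
      \<comment> \<open>The weights of the equality case of Cauchy-Schwarz, which turn
        \<open>\<epsilon> * sqrt K\<close> and \<open>\<epsilon>\<close> into
        \<open>\<epsilon> * sqrt (Suc K)\<close>.\<close>
      define s where "s = sqrt K / sqrt (Suc K)"
      define t where "t = 1 / sqrt (Suc K)"
      have st: "s\<^sup>2 + t\<^sup>2 \<le> 1"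
        by (simp add: s_def t_def power_divide add_divide_distrib[symmetric])
      have "(\<lambda>n. s * \<psi> n + t * \<psi>' n) \<in> l2_sums ({..b} \<union> {b<..b'})"
        by (rule l2_sums_add[OF \<psi>(1) \<psi>'(1) _ st]) auto
      moreover have "{..b} \<union> {b<..b'} \<subseteq> {..b + b'}" by auto
      ultimately have mem: "(\<lambda>n. s * \<psi> n + t * \<psi>' n) \<in> l2_sums {..b + b'}" using l2_sums_mono by blast
      have "\<epsilon> * sqrt (Suc K) = \<epsilon> * (Suc K / sqrt (Suc K))" by (simp add: real_div_sqrt)
      also have "\<dots> = s * (\<epsilon> * sqrt K) + t * \<epsilon>"
        unfolding s_def t_def by (simp add: add_divide_distrib distrib_left algebra_simps)
      also have "\<dots> \<le> s * pairing \<psi> (y l) + t * pairing \<psi>' (y l)"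
        using \<psi>(2) \<psi>'(2) by (intro add_mono mult_left_mono) (auto simp: s_def t_def)
      also have "\<dots> = pairing (\<lambda>n. s * \<psi> n + t * \<psi>' n) (y l)" by (simp add: pairing_add)
      finally show ?thesis using mem by blast
    qed
    then show ?case using b' by blast
  qed
  note * = this
  obtain K :: nat where K: "(1 / \<epsilon>)\<^sup>2 < K" using reals_Archimedean2 by blast
  obtain b \<Lambda> where b: "infinite \<Lambda>" "\<forall>l\<in>\<Lambda>. \<exists>\<psi>\<in>l2_sums {..b}. \<epsilon> * sqrt K \<le> pairing \<psi> (y l)"
    using *[of K] by blast
  obtain l where "l \<in> \<Lambda>" using b(1) by (metis all_not_in_conv finite.emptyI)
  then obtain \<psi> where \<psi>: "\<psi> \<in> l2_sums {..b}" "\<epsilon> * sqrt K \<le> pairing \<psi> (y l)" using b(2) by blast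
  have "pairing \<psi> (y l) \<le> 1" using l2_sums_le_norm[OF y(1) \<psi>(1)] y(2) by (rule order_trans)
  then have "\<epsilon> * sqrt K \<le> 1" using \<psi>(2) by linarith
  moreover have "1 / \<epsilon> < sqrt K" using K \<epsilon> by (intro real_less_rsqrt)
  then have "1 < \<epsilon> * sqrt K" using \<epsilon> by (simp add: field_simps)
  ultimately show False by simp
qed

text \<open>Two choices alternate: a vector outside the finite set still visible between
  \<open>j\<^sub>0\<close> and the current index bound, then a bound past which this vector is
  invisible. Apart from indices up to \<open>j\<^sub>0\<close>, vector \<open>k\<close> is thus seen
  only in the window from \<open>jj k\<close> to \<open>jj (Suc k)\<close>, up to
  \<open>\<epsilon>\<close>.\<close>

lemma ex_rapid_subsequence:
  fixes y :: "nat \<Rightarrow> nat \<Rightarrow> real"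
  assumes y: "\<And>k. y k \<in> c00" "\<And>k. N (y k) \<le> 1" and \<epsilon>: "0 < \<epsilon>"
  obtains l jj :: "nat \<Rightarrow> nat" and j\<^sub>0 where "strict_mono l" "strict_mono jj" "j\<^sub>0 \<le> jj 0"
    "\<forall>k. \<forall>\<psi>\<in>l2_sums {j\<^sub>0<..jj k}. pairing \<psi> (y (l k)) \<le> \<epsilon>"
    "\<forall>k. \<forall>\<psi>\<in>l2_sums {jj (Suc k)<..}. pairing \<psi> (y (l k)) \<le> \<epsilon>"
proof -
  obtain j\<^sub>0 \<Lambda> where \<Lambda>: "infinite \<Lambda>" "\<forall>b. finite {l\<in>\<Lambda>. \<exists>\<psi>\<in>l2_sums {j\<^sub>0<..b}. \<epsilon> < pairing \<psi> (y l)}"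
    using ex_index_threshold[of y \<epsilon>, OF y \<epsilon>] by blast
  define P where "P p \<longleftrightarrow> j\<^sub>0 \<le> snd p \<and> (\<forall>\<psi>\<in>l2_sums {snd p<..}. pairing \<psi> (y (fst p)) \<le> \<epsilon>)" for p :: "nat \<times> nat"
  define Q where "Q p q \<longleftrightarrow> fst p < fst q \<and> snd p < snd q \<and> (\<forall>\<psi>\<in>l2_sums {j\<^sub>0<..snd p}. pairing \<psi> (y (fst q)) \<le> \<epsilon>)"
    for p q :: "nat \<times> nat"
  have tail: "\<exists>j. c \<le> j \<and> P (l, j)" if "j\<^sub>0 \<le> c" for l c
  proof -
    obtain b where b: "\<And>\<psi> c. b \<le> c \<Longrightarrow> \<psi> \<in> l2_sums {c<..} \<Longrightarrow> pairing \<psi> (y l) \<le> \<epsilon>"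
      using l2_sums_tail[OF y(1) \<epsilon>] by blast
    have "P (l, max b c)" unfolding P_def using b[of "max b c"] that by auto
    then show ?thesis by (intro exI[of _ "max b c"]) auto
  qed
  have "\<exists>p. P p" using tail[of j\<^sub>0] by blast
  moreover have "\<exists>q. P q \<and> Q p q" if "P p" for p
  proof -
    define D where "D = {l\<in>\<Lambda>. \<exists>\<psi>\<in>l2_sums {j\<^sub>0<..snd p}. \<epsilon> < pairing \<psi> (y l)}"
    have "finite D" using \<Lambda>(2) unfolding D_def by blast
    then have "infinite (\<Lambda> - D - {..fst p})" using \<Lambda>(1) by (intro Diff_infinite_finite) auto
    then have "\<Lambda> - D - {..fst p} \<noteq> {}" by (rule infinite_imp_nonempty)
    then obtain l where "l \<in> \<Lambda> - D - {..fst p}" by blast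
    then have l: "l \<in> \<Lambda>" "l \<notin> D" "fst p < l" by auto
    have "j\<^sub>0 \<le> Suc (snd p)" using that by (simp add: P_def)
    then obtain j where j: "Suc (snd p) \<le> j" "P (l, j)" using tail by blast
    have "Q p (l, j)" unfolding Q_def using l j(1) by (auto simp: D_def not_less)
    then show ?thesis using j by blast
  qed
  ultimately obtain f where f: "\<And>k. P (f k)" "\<And>k. Q (f k) (f (Suc k))"
    using dependent_nat_choice[of "\<lambda>_. P" "\<lambda>_. Q"] by blast
  show thesis
  \<comment> \<open>Stage \<open>k\<close> supplies the lower end of the window, stage
    \<open>Suc k\<close> both the vector and the upper end.\<close>
  proof (rule that[of "\<lambda>k. fst (f (Suc k))" "\<lambda>k. snd (f k)" j\<^sub>0])
    show "strict_mono (\<lambda>k. fst (f (Suc k)))" "strict_mono (\<lambda>k. snd (f k))"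
      using f(2) by (auto simp: strict_mono_Suc_iff Q_def)
    show "j\<^sub>0 \<le> snd (f 0)" using f(1) by (simp add: P_def)
    show "\<forall>k. \<forall>\<psi>\<in>l2_sums {j\<^sub>0<..snd (f k)}. pairing \<psi> (y (fst (f (Suc k)))) \<le> \<epsilon>"
      using f(2) by (simp add: Q_def)
    show "\<forall>k. \<forall>\<psi>\<in>l2_sums {snd (f (Suc k))<..}. pairing \<psi> (y (fst (f (Suc k)))) \<le> \<epsilon>"
      using f(1) by (simp add: P_def)
  qed
qed

section \<open>The tree argument\<close>

lemma Gsp_special:
  assumes "\<phi> \<in> Gsp L M1 \<sigma> \<xi>"
  obtains fs where "fs \<in> special_seqs L M1 \<sigma> \<xi>"
    "\<forall>n. \<phi> n \<noteq> 0 \<longrightarrow> (\<exists>i<length fs. n \<in> supp (fs ! i) \<and> \<bar>\<phi> n\<bar> = lev (ind (fs ! i)))"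
proof -
  obtain I where I: "(\<phi>, I) \<in> Gsp_ind L M1 \<sigma> \<xi>" using assms by (auto simp: Gsp_def)
  obtain E fs \<epsilon> where rep: "nat_interval E" "fs \<in> special_seqs L M1 \<sigma> \<xi>" "fs \<in> U_seqs"
    "\<forall>i<length fs. \<epsilon> i \<in> {-1, 1}"
    "\<phi> = restr E (\<lambda>n. \<Sum>i<length fs. \<epsilon> i * (fs ! i) n)"
    "I = {ind (fs ! i) | i. i < length fs \<and> restr E (fs ! i) \<noteq> (\<lambda>n. 0)}"
    "\<forall>n. \<phi> n \<noteq> 0 \<longrightarrow> (\<exists>i<length fs. n \<in> supp (fs ! i) \<and> n \<in> E)"
    "\<forall>i n. i < length fs \<longrightarrow> n \<in> supp (fs ! i) \<longrightarrow> n \<in> E \<longrightarrow> \<bar>\<phi> n\<bar> = lev (ind (fs ! i))"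
    by (rule GspE[OF I])
  show thesis by (rule that[OF rep(2)]) (use rep(7,8) in blast)
qed

lemma pairing_cut_nonzeroD:
  assumes "pairing (index_cut J \<phi>) x \<noteq> 0"
  obtains n j where "n \<in> supp x" "\<phi> n \<noteq> 0" "j \<in> J" "1 \<le> j" "\<bar>\<phi> n\<bar> = lev j" "j \<in> idx (index_cut J \<phi>)"
proof -
  obtain n where n: "n \<in> supp x" "index_cut J \<phi> n \<noteq> 0"
    using assms unfolding pairing_def by (metis (no_types, lifting) mult_zero_left sum.neutral)
  then obtain j where j: "j \<in> J" "1 \<le> j" "\<bar>\<phi> n\<bar> = lev j" "index_cut J \<phi> n = \<phi> n"
    unfolding index_cut_def by (metis (no_types, lifting))
  then have "j \<in> idx (index_cut J \<phi>)" unfolding idx_def by (auto intro!: exI[of _ n])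
  then show thesis using that[of n j] n j by simp
qed

text \<open>Special functionals through a common index share an initial segment of their sequences,
  but possibly neither signs nor interval. This trace of acting on a block depends on the sequence
  alone, so it can be carried over.\<close>

definition hits :: "(nat \<Rightarrow> real) list \<Rightarrow> nat set \<Rightarrow> nat set \<Rightarrow> bool" where
  "hits fs J A \<longleftrightarrow> (\<exists>i<length fs. ind (fs ! i) \<in> J \<and> supp (fs ! i) \<inter> A \<noteq> {})"

text \<open>Nonzero values over disjoint index ranges give \<open>\<phi>\<close> two indices, which
  excludes \<open>G1\<close> and zero. So a special sequence lies behind
  \<open>\<phi>\<close>.\<close>

lemma rows_pair_special:
  assumes "\<phi> \<in> norming_rows" "pairing (index_cut J \<phi>) x \<noteq> 0" "pairing (index_cut K \<phi>) x' \<noteq> 0" "J \<inter> K = {}"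
  obtains fs where "fs \<in> special_seqs L M1 \<sigma> \<xi>" "hits fs J (supp x)"
    "\<forall>j\<in>idx \<phi>. \<exists>i<length fs. ind (fs ! i) = j"
proof -
  obtain n j where n: "n \<in> supp x" "\<phi> n \<noteq> 0" "j \<in> J" "1 \<le> j" "\<bar>\<phi> n\<bar> = lev j"
    "j \<in> idx (index_cut J \<phi>)" by (rule pairing_cut_nonzeroD[OF assms(2)])
  obtain n' k where "n' \<in> supp x'" "\<phi> n' \<noteq> 0" "k \<in> K" "1 \<le> k" "\<bar>\<phi> n'\<bar> = lev k"
    "k \<in> idx (index_cut K \<phi>)" by (rule pairing_cut_nonzeroD[OF assms(3)])
  then have k: "k \<in> K" "k \<in> idx \<phi>" using idx_cut by blast+
  have "j \<in> idx \<phi>" using n by (auto simp: idx_def)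
  moreover have "j \<noteq> k" using n k assms(4) by blast
  ultimately have "\<phi> \<notin> G1" using k(2) G1j_graded(2) unfolding G1_def by fastforce
  then have "\<phi> \<in> Gsp L M1 \<sigma> \<xi>" using assms(1) n(2) by (auto simp: norming_rows_def)
  then obtain fs where fs: "fs \<in> special_seqs L M1 \<sigma> \<xi>"
    "\<forall>n. \<phi> n \<noteq> 0 \<longrightarrow> (\<exists>i<length fs. n \<in> supp (fs ! i) \<and> \<bar>\<phi> n\<bar> = lev (ind (fs ! i)))"
    by (rule Gsp_special)
  have U: "fs \<in> U_seqs" using fs(1) by (simp add: special_seqs_def)
  have lv: "\<exists>i<length fs. n \<in> supp (fs ! i) \<and> ind (fs ! i) = j" if "1 \<le> j" "\<bar>\<phi> n\<bar> = lev j" for j n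
  proof -
    have "\<phi> n \<noteq> 0" using lev_pos[OF that(1)] that(2) by auto
    then obtain i where i: "i < length fs" "n \<in> supp (fs ! i)" "\<bar>\<phi> n\<bar> = lev (ind (fs ! i))"
      using fs(2) by blast
    then have "ind (fs ! i) = j" using U_seqsD(1)[OF U i(1)] that lev_inject by metis
    then show ?thesis using i by blast
  qed
  show thesis
  proof (rule that[OF fs(1)])
    show "hits fs J (supp x)" unfolding hits_def using lv[OF n(4,5)] n by blast
    show "\<forall>j\<in>idx \<phi>. \<exists>i<length fs. ind (fs ! i) = j" using lv unfolding idx_def by blast
  qed
qed

text \<open>The hit occurs at an index below the shared one, hence before position \<open>i\<close>,
  within the common initial segment.\<close>

lemma special_hits_transfer:
  assumes fs: "fs \<in> special_seqs L M1 \<sigma> \<xi>" and gs: "gs \<in> special_seqs L M1 \<sigma> \<xi>"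
    and share: "i < length fs" "k < length gs" "ind (fs ! i) = ind (gs ! k)"
    and hit: "hits fs J A" and J: "\<forall>j\<in>J. j < ind (fs ! i)"
  shows "hits gs J A"
proof -
  have U: "fs \<in> U_seqs" using fs by (simp add: special_seqs_def)
  have eq: "take i fs = take k gs" by (rule special_seqs_share[OF fs gs share])
  obtain p where p: "p < length fs" "ind (fs ! p) \<in> J" "supp (fs ! p) \<inter> A \<noteq> {}"
    using hit unfolding hits_def by blast
  have "ind (fs ! p) < ind (fs ! i)" using J p by blast
  then have "p < i" using U_seqsD(2)[OF U, of i p] p(1) by (metis linorder_neqE_nat order_less_asym)
  moreover from this have "p < k" using eq share
    by (metis length_take min.absorb2 order_less_imp_le)
  ultimately have "fs ! p = gs ! p" using eq by (metis nth_take)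
  then show ?thesis unfolding hits_def using p \<open>p < k\<close> share(2) by (metis order_less_trans)
qed

text \<open>
  If all pairs \<open>l < l'\<close> were bad, then by Ramsey's theorem either the functionals witnessing this
  for a common \<open>l'\<close> have disjoint indices at \<open>l'\<close>, and too many of them norm \<open>z l'\<close>, or they share an
  index there. In the latter case the coding forces a common initial segment, so a single special
  sequence meets arbitrarily many of the blocks, against \<open>schreier_misses_block\<close>.
\<close>

lemma ex_separated_subsequence:
  fixes z :: "nat \<Rightarrow> nat \<Rightarrow> real"
  assumes z: "\<And>k. z k \<in> c00" "\<And>k. N (z k) \<le> 1"
    and block: "\<forall>k k' a b. k < k' \<longrightarrow> a \<in> supp (z k) \<longrightarrow> b \<in> supp (z k') \<longrightarrow> a < b"
    and jj: "strict_mono jj" and \<Lambda>: "infinite \<Lambda>" and \<delta>: "0 < \<delta>"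
  defines "J \<equiv> \<lambda>k. {jj k<..jj (Suc k)}"
  shows "\<exists>\<Lambda>'. \<Lambda>' \<subseteq> \<Lambda> \<and> infinite \<Lambda>' \<and> (\<forall>l\<in>\<Lambda>'. \<forall>l'\<in>\<Lambda>'. l < l' \<longrightarrow> (\<forall>\<phi>\<in>norming_rows.
    pairing (index_cut (J l) \<phi>) (z l) \<noteq> 0 \<longrightarrow> \<bar>pairing (index_cut (J l') \<phi>) (z l')\<bar> < \<delta>))"
proof -
  define bad where "bad l l' \<longleftrightarrow> (\<exists>\<phi>\<in>norming_rows. pairing (index_cut (J l) \<phi>) (z l) \<noteq> 0 \<and>
    \<delta> \<le> \<bar>pairing (index_cut (J l') \<phi>) (z l')\<bar>)" for l l'
  have jle: "jj (Suc l) \<le> jj l'" if "l < l'" for l l'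
    using jj that by (simp add: strict_mono_less_eq Suc_le_eq)
  have Jless: "j < j'" if "l < l'" "j \<in> J l" "j' \<in> J l'" for l l' j j'
    using jle[OF that(1)] that(2,3) by (auto simp: J_def)
  obtain Y where Y: "Y \<subseteq> \<Lambda>" "infinite Y"
    "(\<forall>l\<in>Y. \<forall>l'\<in>Y. l < l' \<longrightarrow> bad l l') \<or> (\<forall>l\<in>Y. \<forall>l'\<in>Y. l < l' \<longrightarrow> \<not> bad l l')"
    by (rule ramsey_pairs[OF \<Lambda>])
  have "\<not> (\<forall>l\<in>Y. \<forall>l'\<in>Y. l < l' \<longrightarrow> bad l l')"
  proof
    assume all: "\<forall>l\<in>Y. \<forall>l'\<in>Y. l < l' \<longrightarrow> bad l l'"
    define R where "R l l' \<phi> fs \<longleftrightarrow> \<phi> \<in> norming_rows \<and> \<delta> \<le> \<bar>pairing (index_cut (J l') \<phi>) (z l')\<bar> \<and>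
      fs \<in> special_seqs L M1 \<sigma> \<xi> \<and> hits fs (J l) (supp (z l)) \<and>
      (\<forall>j\<in>idx \<phi>. \<exists>i<length fs. ind (fs ! i) = j)" for l l' \<phi> fs
    have "\<exists>\<phi> fs. l \<in> Y \<longrightarrow> l' \<in> Y \<longrightarrow> l < l' \<longrightarrow> R l l' \<phi> fs" for l l'
    proof (cases "l \<in> Y \<and> l' \<in> Y \<and> l < l'")
      case True
      then obtain \<phi> where \<phi>: "\<phi> \<in> norming_rows" "pairing (index_cut (J l) \<phi>) (z l) \<noteq> 0"
        "\<delta> \<le> \<bar>pairing (index_cut (J l') \<phi>) (z l')\<bar>" using all unfolding bad_def by blast
      have "pairing (index_cut (J l') \<phi>) (z l') \<noteq> 0" using \<phi>(3) \<delta> by auto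
      moreover have "J l \<inter> J l' = {}" using Jless True by blast
      ultimately obtain fs where "fs \<in> special_seqs L M1 \<sigma> \<xi>" "hits fs (J l) (supp (z l))"
        "\<forall>j\<in>idx \<phi>. \<exists>i<length fs. ind (fs ! i) = j"
        by (rule rows_pair_special[OF \<phi>(1,2)])
      then have "R l l' \<phi> fs" using \<phi> by (simp add: R_def)
      then show ?thesis by blast
    qed blast
    then obtain \<Phi> F where R0: "\<And>l l'. l \<in> Y \<longrightarrow> l' \<in> Y \<longrightarrow> l < l' \<longrightarrow> R l l' (\<Phi> l l') (F l l')"
      by metis
    have R: "\<Phi> l l' \<in> norming_rows" "\<delta> \<le> \<bar>pairing (index_cut (J l') (\<Phi> l l')) (z l')\<bar>"
      "F l l' \<in> special_seqs L M1 \<sigma> \<xi>" "hits (F l l') (J l) (supp (z l))"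
      "\<forall>j\<in>idx (\<Phi> l l'). \<exists>i<length (F l l'). ind (F l l' ! i) = j"
      if "l \<in> Y" "l' \<in> Y" "l < l'" for l l'
      using R0[of l l'] that unfolding R_def by blast+
    obtain Y' where Y': "Y' \<subseteq> Y" "infinite Y'"
      "(\<forall>x\<in>Y'. \<forall>y\<in>Y'. \<forall>w\<in>Y'. x < y \<longrightarrow> y < w \<longrightarrow> idx (\<Phi> x w) \<inter> idx (\<Phi> y w) \<inter> J w \<noteq> {}) \<or>
       (\<forall>x\<in>Y'. \<forall>y\<in>Y'. \<forall>w\<in>Y'. x < y \<longrightarrow> y < w \<longrightarrow> \<not> idx (\<Phi> x w) \<inter> idx (\<Phi> y w) \<inter> J w \<noteq> {})"
      by (rule ramsey_triples[OF Y(2)])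
    from Y'(3) show False
    proof
      assume disj: "\<forall>x\<in>Y'. \<forall>y\<in>Y'. \<forall>w\<in>Y'. x < y \<longrightarrow> y < w \<longrightarrow> \<not> idx (\<Phi> x w) \<inter> idx (\<Phi> y w) \<inter> J w \<noteq> {}"
      \<comment> \<open>More than \<open>1 / \<delta>\<^sup>2\<close> index-disjoint rows, each at
        least \<open>\<delta>\<close> in modulus on \<open>z w\<close>, violate the square-sum
        bound.\<close>
      obtain m :: nat where m: "1 / \<delta>\<^sup>2 < m" using reals_Archimedean2 by blast
      obtain S where S: "S \<subseteq> Y'" "finite S" "card S = m" using infinite_arbitrarily_large[OF Y'(2)] by blast
      obtain w where w: "w \<in> Y'" "\<forall>i\<in>S. i < w"
      proof -
        obtain M where M: "\<forall>i\<in>S. i \<le> M" using S(2) finite_nat_set_iff_bounded_le by blast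
        obtain w where "w \<in> Y'" "M < w" using Y'(2) by (meson infinite_nat_iff_unbounded)
        then show thesis using that[of w] M by (metis le_less_trans)
      qed
      define \<phi> where "\<phi> i = index_cut (J w) (\<Phi> i w)" for i
      have mem: "i \<in> Y" "w \<in> Y" "i < w" if "i \<in> S" for i using that S(1) w Y'(1) by auto
      have norming_rows: "\<phi> i \<in> norming_rows" if "i \<in> S" for i
        unfolding \<phi>_def by (rule rows_cut[OF R(1)[OF mem[OF that]]]) (auto simp: J_def)
      have "idx (\<phi> i) \<inter> idx (\<phi> k) = {}" if "i \<in> S" "k \<in> S" "i < k" for i k
      proof -
        have "idx (\<Phi> i w) \<inter> idx (\<Phi> k w) \<inter> J w = {}"
          using disj S(1) w that by (metis subsetD)
        then show ?thesis unfolding \<phi>_def using idx_cut by fast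
      qed
      then have "disjoint_family_on (\<lambda>i. idx (\<phi> i)) S"
        unfolding disjoint_family_on_def by (metis Int_commute linorder_neqE_nat)
      from rows_sum_squares_le[OF S(2) norming_rows this z(1)]
      have "(\<Sum>i\<in>S. (pairing (\<phi> i) (z w))\<^sup>2) \<le> (N (z w))\<^sup>2" .
      also have "\<dots> \<le> 1"
        using z(2)[of w] abs_le_norm[OF z(1), of w 0] by (simp add: power_le_one)
      finally have le: "(\<Sum>i\<in>S. (pairing (\<phi> i) (z w))\<^sup>2) \<le> 1" .
      have "(\<Sum>i\<in>S. \<delta>\<^sup>2) \<le> (\<Sum>i\<in>S. (pairing (\<phi> i) (z w))\<^sup>2)"
      proof (rule sum_mono)
        fix i assume "i \<in> S"
        from R(2)[OF mem[OF this]] have "\<delta> \<le> \<bar>pairing (\<phi> i) (z w)\<bar>" by (simp add: \<phi>_def)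
        then show "\<delta>\<^sup>2 \<le> (pairing (\<phi> i) (z w))\<^sup>2" using \<delta> by (simp add: abs_le_square_iff[symmetric])
      qed
      then have "m * \<delta>\<^sup>2 \<le> 1" using le S(3) by simp
      then show False using m \<delta> by (simp add: field_simps)
    next
      assume share: "\<forall>x\<in>Y'. \<forall>y\<in>Y'. \<forall>w\<in>Y'. x < y \<longrightarrow> y < w \<longrightarrow> idx (\<Phi> x w) \<inter> idx (\<Phi> y w) \<inter> J w \<noteq> {}"
      define e where "e = enumerate Y'"
      have e: "e k \<in> Y'" "k < k' \<Longrightarrow> e k < e k'" for k k'
        using enumerate_in_set[OF Y'(2)] enumerate_mono[OF _ Y'(2)] by (auto simp: e_def)
      \<comment> \<open>The hull of two consecutive blocks. The Schreier condition governs minima of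
        supports, and a member meeting a block may begin long before it. But a member meeting the
        second block, preceded by one meeting the first, begins after a point of the first, so its
        minimum falls into the hull.\<close>
      define T where "T r = {n. \<exists>a\<in>supp (z (e (2 * r))). \<exists>b\<in>supp (z (e (Suc (2 * r)))). a \<le> n \<and> n \<le> b}" for r
      have finT: "finite (T r)" for r
      proof -
        have "T r \<subseteq> (\<Union>b\<in>supp (z (e (Suc (2 * r)))). {..b})" unfolding T_def by auto
        then show ?thesis by (rule finite_subset) (simp add: finite_supp z(1))
      qed
      have succT: "a < b" if rs: "r < s" and ab: "a \<in> T r" "b \<in> T s" for r s a b
      proof -
        obtain a' where a': "a' \<in> supp (z (e (Suc (2 * r))))" "a \<le> a'" using ab unfolding T_def by blast
        obtain b' where b': "b' \<in> supp (z (e (2 * s)))" "b' \<le> b" using ab unfolding T_def by blast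
        have "e (Suc (2 * r)) < e (2 * s)" by (rule e(2)) (use rs in simp)
        then have "a' < b'" using block a'(1) b'(1) by blast
        then show ?thesis using a' b' by simp
      qed
      have "\<exists>K. \<forall>A. schreier L \<xi> A \<longrightarrow> (\<exists>r\<in>{0..0+K}. A \<inter> T r = {})"
        by (rule schreier_misses_block[OF fundamental finT]) (rule succT)
      then obtain K where K: "\<forall>A. schreier L \<xi> A \<longrightarrow> (\<exists>r\<in>{0..0+K}. A \<inter> T r = {})" by blast
      \<comment> \<open>Beyond the \<open>2 * K + 2\<close> blocks that make up the hulls
        \<open>T 0\<close> to \<open>T K\<close>.\<close>
      define w where "w = e (2 * K + 2)"
      define gs where "gs = F (e 0) w"
      have w: "w \<in> Y'" "w \<in> Y" using e(1) Y'(1) unfolding w_def by blast+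
      have e0: "e 0 \<in> Y" "e 0 < w" using e Y'(1) unfolding w_def by auto
      have gs: "gs \<in> special_seqs L M1 \<sigma> \<xi>" unfolding gs_def by (rule R(3)[OF e0(1) w(2) e0(2)])
      have U: "gs \<in> U_seqs" using gs by (simp add: special_seqs_def)
      \<comment> \<open>For \<open>k > 0\<close> the sequence \<open>F (e k) w\<close> shares an
        index in \<open>J w\<close> with \<open>gs\<close>, so its hit of block \<open>e k\<close>,
        at smaller indices, passes on to \<open>gs\<close>.\<close>
      have hit: "hits gs (J (e k)) (supp (z (e k)))" if k: "k < 2 * K + 2" for k
      proof (cases "k = 0")
        case True
        then show ?thesis unfolding gs_def using R(4)[OF e0(1) w(2) e0(2)] by simp
      next
        case False
        have ek: "e k \<in> Y" "e k < w" "e 0 < e k" "e k \<in> Y'" "e 0 \<in> Y'"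
          using e Y'(1) k False unfolding w_def by auto
        obtain j where j: "j \<in> idx (\<Phi> (e 0) w)" "j \<in> idx (\<Phi> (e k) w)" "j \<in> J w"
          using share ek w(1) by blast
        obtain i where i: "i < length (F (e k) w)" "ind (F (e k) w ! i) = j"
          using R(5)[OF ek(1) w(2) ek(2)] j by blast
        obtain i' where i': "i' < length gs" "ind (gs ! i') = j"
          using R(5)[OF e0(1) w(2) e0(2)] j unfolding gs_def by blast
        show ?thesis
        proof (rule special_hits_transfer[OF R(3)[OF ek(1) w(2) ek(2)] gs i(1) i'(1)])
          show "hits (F (e k) w) (J (e k)) (supp (z (e k)))" by (rule R(4)[OF ek(1) w(2) ek(2)])
          show "\<forall>j\<in>J (e k). j < ind (F (e k) w ! i)" using Jless[OF ek(2)] j(3) i(2) by blast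
        qed (use i i' in simp)
      qed
      have "((\<lambda>f. Min (supp f)) ` set gs) \<inter> T r \<noteq> {}" if r: "r \<le> K" for r
      proof -
        obtain i where i: "i < length gs" "ind (gs ! i) \<in> J (e (2 * r))" "supp (gs ! i) \<inter> supp (z (e (2 * r))) \<noteq> {}"
          using hit[of "2 * r"] r unfolding hits_def by auto
        obtain k where k: "k < length gs" "ind (gs ! k) \<in> J (e (Suc (2 * r)))"
          "supp (gs ! k) \<inter> supp (z (e (Suc (2 * r)))) \<noteq> {}"
          using hit[of "Suc (2 * r)"] r unfolding hits_def by auto
        obtain a b where ab: "a \<in> supp (gs ! i)" "a \<in> supp (z (e (2 * r)))" "b \<in> supp (gs ! k)"
          "b \<in> supp (z (e (Suc (2 * r))))" using i k by blast
        have "e (2 * r) < e (Suc (2 * r))" by (rule e(2)) simp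
        then have "ind (gs ! i) < ind (gs ! k)" using Jless i k by blast
        then have "i < k" using U_seqsD(2)[OF U, of k i] i(1) by (metis linorder_neqE_nat order_less_asym)
        then have "a < Min (supp (gs ! k))" using U_seqsD(3)[OF U _ k(1) ab(1,3)] by blast
        moreover have "finite (supp (gs ! k))" using U_seqsD(1)[OF U k(1)] G1jD(1) by blast
        then have "Min (supp (gs ! k)) \<le> b" using ab by simp
        ultimately have "Min (supp (gs ! k)) \<in> T r" unfolding T_def using ab by (auto intro: less_imp_le)
        then show ?thesis using k(1) by (metis (no_types, lifting) IntI emptyE imageI nth_mem)
      qed
      moreover have "schreier L \<xi> ((\<lambda>f. Min (supp f)) ` set gs)" using gs by (simp add: special_seqs_def)
      ultimately show False using K by (metis add_0 atLeastAtMost_iff)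
    qed
  qed
  then have "\<forall>l\<in>Y. \<forall>l'\<in>Y. l < l' \<longrightarrow> \<not> bad l l'" using Y(3) by blast
  then show ?thesis using Y(1,2) unfolding bad_def by (metis not_le)
qed

end

section \<open>Averages of block sequences\<close>

text \<open>Pigeonhole; it bounds the number of rows active on a block by the upper end of its index
  window.\<close>

lemma card_le_of_disjoint_indices:
  fixes A :: "'i \<Rightarrow> nat set"
  assumes disj: "disjoint_family_on A S" and "\<And>i. i \<in> S \<Longrightarrow> A i \<inter> {1..M} \<noteq> {}"
  shows "card S \<le> M"
proof -
  have "\<forall>i\<in>S. \<exists>j. j \<in> A i \<inter> {1..M}" using assms(2) by blast
  then obtain j where j: "\<forall>i\<in>S. j i \<in> A i \<inter> {1..M}" by (rule bchoice[THEN exE])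
  have "inj_on j S"
  proof (rule inj_onI)
    fix i k assume "i \<in> S" "k \<in> S" "j i = j k"
    then have "A i \<inter> A k \<noteq> {}" using j by (metis IntD1 IntI empty_iff)
    then show "i = k" using disj \<open>i \<in> S\<close> \<open>k \<in> S\<close> by (auto simp: disjoint_family_on_def)
  qed
  then have "card S \<le> card {1..M}" by (rule card_inj_on_le) (use j in auto)
  then show ?thesis by simp
qed

lemma c00_add: "x \<in> c00 \<Longrightarrow> y \<in> c00 \<Longrightarrow> (\<lambda>n. x n + y n) \<in> c00"
  unfolding c00_def by (auto intro: finite_subset[of _ "{n. x n \<noteq> 0} \<union> {n. y n \<noteq> 0}"])

lemma c00_scale: "x \<in> c00 \<Longrightarrow> (\<lambda>n. c * x n) \<in> c00"
  unfolding c00_def by (auto intro: finite_subset[of _ "{n. x n \<noteq> 0}"])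

lemma c00_diff: "x \<in> c00 \<Longrightarrow> y \<in> c00 \<Longrightarrow> (\<lambda>n. x n - y n) \<in> c00"
  using c00_add[of x "\<lambda>n. (-1) * y n"] c00_scale[of y "-1"] by simp

lemma c00_sum: "finite K \<Longrightarrow> (\<And>k. k \<in> K \<Longrightarrow> x k \<in> c00) \<Longrightarrow> (\<lambda>n. \<Sum>k\<in>K. x k n) \<in> c00"
proof (induction K rule: finite_induct)
  case (insert k K)
  then have "(\<lambda>n. x k n + (\<Sum>k\<in>K. x k n)) \<in> c00" by (intro c00_add) auto
  then show ?case using insert by simp
qed (simp add: c00_def)

lemma c00_restr: "x \<in> c00 \<Longrightarrow> restr A x \<in> c00"
  unfolding c00_def restr_def by (auto intro: finite_subset[of _ "{n. x n \<noteq> 0}"])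

section \<open>Small averages, and blocks from differences\<close>

context coding
begin

lemma norm_le_sum_abs:
  assumes "x \<in> c00" "finite A" "supp x \<subseteq> A"
  shows "N x \<le> (\<Sum>n\<in>A. \<bar>x n\<bar>)"
proof (rule G_norm_le[OF assms(1)])
  fix n
  show "\<bar>x n\<bar> \<le> (\<Sum>n\<in>A. \<bar>x n\<bar>)"
  proof (cases "n \<in> A")
    case True
    then show ?thesis using assms(2) by (intro member_le_sum) auto
  next
    case False
    then have "x n = 0" using assms(3) by (auto simp: supp_def)
    then show ?thesis by (simp add: sum_nonneg)
  qed
next
  fix \<psi> assume \<psi>: "\<psi> \<in> l2_sums UNIV"
  show "pairing \<psi> x \<le> (\<Sum>n\<in>A. \<bar>x n\<bar>)"
    unfolding pairing_superset[OF assms(2,3)]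
  proof (rule sum_mono)
    fix n
    have "\<psi> n * x n \<le> \<bar>\<psi> n\<bar> * \<bar>x n\<bar>" by (metis abs_ge_self abs_mult)
    also have "\<dots> \<le> 1 * \<bar>x n\<bar>" using l2_sums_abs_le_1[OF \<psi>] by (intro mult_right_mono) auto
    finally show "\<psi> n * x n \<le> \<bar>x n\<bar>" by simp
  qed
qed

text \<open>A diagonal argument over \<open>ex_separated_subsequence\<close>. The threshold has to
  be fixed before the infinite set containing the pair is chosen, so it comes from a third, earlier
  term \<open>\<kappa> s\<close>. This is the origin of the shape of hypothesis \<open>one\<close>
  in \<open>matrix_sum_le\<close>.\<close>

lemma ex_thinned_subsequence:
  fixes z :: "nat \<Rightarrow> nat \<Rightarrow> real"
  assumes z: "\<And>k. z k \<in> c00" "\<And>k. N (z k) \<le> 1"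
    and block: "\<forall>k k' a b. k < k' \<longrightarrow> a \<in> supp (z k) \<longrightarrow> b \<in> supp (z k') \<longrightarrow> a < b"
    and jj: "strict_mono jj" and \<eta>: "\<And>k. 0 < \<eta> k"
  obtains \<kappa> :: "nat \<Rightarrow> nat" where "strict_mono \<kappa>" "m \<le> \<kappa> 0"
    "\<forall>s t t'. s < t \<longrightarrow> t < t' \<longrightarrow> (\<forall>\<phi>\<in>norming_rows.
      pairing (index_cut {jj (\<kappa> t)<..jj (Suc (\<kappa> t))} \<phi>) (z (\<kappa> t)) \<noteq> 0 \<longrightarrow>
      \<bar>pairing (index_cut {jj (\<kappa> t')<..jj (Suc (\<kappa> t'))} \<phi>) (z (\<kappa> t'))\<bar> < \<eta> (\<kappa> s))"
proof -
  define sep where "sep \<delta> A \<longleftrightarrow> (\<forall>l\<in>A. \<forall>l'\<in>A. l < l' \<longrightarrow> (\<forall>\<phi>\<in>norming_rows.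
    pairing (index_cut {jj l<..jj (Suc l)} \<phi>) (z l) \<noteq> 0 \<longrightarrow>
    \<bar>pairing (index_cut {jj l'<..jj (Suc l')} \<phi>) (z l')\<bar> < \<delta>))" for \<delta> and A :: "nat set"
  define P where "P A \<longleftrightarrow> infinite A \<and> A \<subseteq> {m..}" for A :: "nat set"
  \<comment> \<open>The least element of \<open>A\<close> is set aside as the next term of
    \<open>\<kappa>\<close> and prescribes the threshold for everything later.\<close>
  define Q where "Q A B \<longleftrightarrow> B \<subseteq> A - {..Inf A} \<and> sep (\<eta> (Inf A)) B" for A B :: "nat set"
  have "P {m..}" by (simp add: P_def infinite_Ici)
  moreover have "\<exists>B. P B \<and> Q A B" if "P A" for A
  proof -
    have "infinite (A - {..Inf A})" using that unfolding P_def by (intro Diff_infinite_finite) auto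
    then have "\<exists>B. B \<subseteq> A - {..Inf A} \<and> infinite B \<and> sep (\<eta> (Inf A)) B"
      unfolding sep_def by (rule ex_separated_subsequence[OF z block jj _ \<eta>])
    then show ?thesis using that unfolding P_def Q_def by blast
  qed
  ultimately obtain A where A: "\<And>k. P (A k)" "\<And>k. Q (A k) (A (Suc k))"
    using dependent_nat_choice[of "\<lambda>_. P" "\<lambda>_. Q"] by blast
  define \<kappa> where "\<kappa> k = Inf (A k)" for k
  have mem: "\<kappa> k \<in> A k" for k
    unfolding \<kappa>_def using A(1)[of k] by (intro Inf_nat_def1) (auto simp: P_def)
  have dec: "A t \<subseteq> A s" if "s \<le> t" for s t
    using that by (rule lift_Suc_antimono_le[rotated]) (use A(2) in \<open>auto simp: Q_def\<close>)
  have "strict_mono \<kappa>"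
    unfolding strict_mono_Suc_iff
  proof
    fix k
    have "\<kappa> (Suc k) \<in> A k - {..Inf (A k)}" using mem[of "Suc k"] A(2)[of k] by (auto simp: Q_def)
    then show "\<kappa> k < \<kappa> (Suc k)" by (simp add: \<kappa>_def)
  qed
  moreover have "m \<le> \<kappa> 0" using mem[of 0] A(1)[of 0] by (auto simp: P_def)
  moreover have "\<forall>\<phi>\<in>norming_rows. pairing (index_cut {jj (\<kappa> t)<..jj (Suc (\<kappa> t))} \<phi>) (z (\<kappa> t)) \<noteq> 0 \<longrightarrow>
      \<bar>pairing (index_cut {jj (\<kappa> t')<..jj (Suc (\<kappa> t'))} \<phi>) (z (\<kappa> t'))\<bar> < \<eta> (\<kappa> s)"
    if "s < t" "t < t'" for s t t'
  proof -
    have "\<kappa> t \<in> A (Suc s)" "\<kappa> t' \<in> A (Suc s)"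
      using mem dec[of "Suc s" t] dec[of "Suc s" t'] that by (auto simp: Suc_le_eq)
    moreover have "\<kappa> t < \<kappa> t'" using \<open>strict_mono \<kappa>\<close> that(2) by (simp add: strict_mono_less)
    moreover have "sep (\<eta> (\<kappa> s)) (A (Suc s))" using A(2)[of s] by (simp add: Q_def \<kappa>_def)
    ultimately show ?thesis unfolding sep_def by blast
  qed
  ultimately show thesis using that by blast
qed

text \<open>On each block \<open>\<psi>\<close> is split at \<open>j\<^sub>0\<close> and at the ends
  of the index window of that block. The three ranges outside the window are cheap; inside it the
  values of the rows form the matrix of \<open>matrix_sum_le\<close>.\<close>

lemma ex_small_average:
  fixes y :: "nat \<Rightarrow> nat \<Rightarrow> real" and \<epsilon> :: real
  assumes y: "\<And>k. y k \<in> c00" "\<And>k. N (y k) \<le> 1"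
    and block: "\<forall>k k' a b. k < k' \<longrightarrow> a \<in> supp (y k) \<longrightarrow> b \<in> supp (y k') \<longrightarrow> a < b"
    and \<epsilon>: "0 < \<epsilon>"
  obtains K where "finite K" "K \<noteq> {}" "K \<subseteq> {2 * card K..}" "N (\<lambda>n. \<Sum>k\<in>K. y k n) \<le> \<epsilon> * card K"
proof -
  \<comment> \<open>Five errors of size \<open>e * n\<close>: small indices, the ranges below and
    above the window, and two from the matrix, \<open>2 * sqrt n\<close> and
    \<open>n * e\<close>.\<close>
  define e where "e = \<epsilon> / 5"
  have e: "0 < e" using \<epsilon> by (simp add: e_def)
  obtain l jj :: "nat \<Rightarrow> nat" and j\<^sub>0 where l: "strict_mono l" and jj: "strict_mono jj" "j\<^sub>0 \<le> jj 0"
    and below: "\<forall>k. \<forall>\<psi>\<in>l2_sums {j\<^sub>0<..jj k}. pairing \<psi> (y (l k)) \<le> e"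
    and above: "\<forall>k. \<forall>\<psi>\<in>l2_sums {jj (Suc k)<..}. pairing \<psi> (y (l k)) \<le> e"
    by (rule ex_rapid_subsequence[OF y e])
  define z where "z k = y (l k)" for k
  have z: "\<And>k. z k \<in> c00" "\<And>k. N (z k) \<le> 1" using y by (simp_all add: z_def)
  have zblock: "\<forall>k k' a b. k < k' \<longrightarrow> a \<in> supp (z k) \<longrightarrow> b \<in> supp (z k') \<longrightarrow> a < b"
    unfolding z_def using block strict_monoD[OF l] by blast
  define K\<^sub>0 where "K\<^sub>0 = real (\<Sum>j\<in>{1..j\<^sub>0}. n_seq (2 * j - 1))"
  \<comment> \<open>The three bounds absorb the small indices, the coordinate functionals, whose
    values on the sum are at most 1, and the term \<open>2 * sqrt n\<close>.\<close>
  obtain n :: nat where n: "max (max (K\<^sub>0 / e) (1 / e)) (4 / e\<^sup>2) < n" using reals_Archimedean2 by blast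
  have "0 < 4 / e\<^sup>2" using e by simp
  then have "0 < real n" using n by linarith
  then have n0: "0 < n" by simp
  have nK: "K\<^sub>0 \<le> e * n" "1 \<le> e * n" "2 * sqrt n \<le> e * n"
  proof -
    show "K\<^sub>0 \<le> e * n" "1 \<le> e * n" using n e by (simp_all add: field_simps)
    have "4 \<le> e\<^sup>2 * n" using n e by (simp add: field_simps)
    then have "sqrt 4 \<le> sqrt (e\<^sup>2 * n)" by (rule real_sqrt_le_mono)
    then have "2 \<le> e * sqrt n" using e by (simp add: real_sqrt_mult)
    then have "2 * sqrt n \<le> e * sqrt n * sqrt n" by (intro mult_right_mono) auto
    then show "2 * sqrt n \<le> e * n" by (simp add: mult.assoc)
  qed
  \<comment> \<open>At most \<open>jj (Suc k)\<close> rows are nonzero on block \<open>k\<close>, as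
    their cuts have disjoint index sets meeting \<open>{1..jj (Suc k)}\<close>; that many thresholds
    add up to \<open>e / n\<close>.\<close>
  define \<eta> where "\<eta> k = e / (n * jj (Suc k))" for k
  have jjpos: "0 < jj (Suc k)" for k
    using jj(1) by (metis gr_zeroI less_zeroE strict_mono_Suc_iff)
  have \<eta>: "0 < \<eta> k" for k unfolding \<eta>_def using e n0 jjpos by simp
  \<comment> \<open>\<open>2 * n \<le> \<kappa> 0\<close> makes room for a Schreier set of
    \<open>2 * n\<close> indices, two for each block.\<close>
  obtain \<kappa> :: "nat \<Rightarrow> nat" where \<kappa>: "strict_mono \<kappa>" "2 * n \<le> \<kappa> 0"
    and sep: "\<forall>s t t'. s < t \<longrightarrow> t < t' \<longrightarrow> (\<forall>\<phi>\<in>norming_rows.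
      pairing (index_cut {jj (\<kappa> t)<..jj (Suc (\<kappa> t))} \<phi>) (z (\<kappa> t)) \<noteq> 0 \<longrightarrow>
      \<bar>pairing (index_cut {jj (\<kappa> t')<..jj (Suc (\<kappa> t'))} \<phi>) (z (\<kappa> t'))\<bar> < \<eta> (\<kappa> s))"
    by (rule ex_thinned_subsequence[OF z zblock jj(1) \<eta>])
  define x where "x m = (\<Sum>t<n. z (\<kappa> t) m)" for m
  have x: "x \<in> c00" unfolding x_def[abs_def] by (rule c00_sum) (use z in auto)
  have xle: "\<bar>x m\<bar> \<le> 1" for m
  proof (cases "\<exists>t<n. z (\<kappa> t) m \<noteq> 0")
    case True
    then obtain t where t: "t < n" "z (\<kappa> t) m \<noteq> 0" by blast
    have "z (\<kappa> t') m = 0" if "t' \<noteq> t" for t'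
    proof (rule ccontr)
      assume "z (\<kappa> t') m \<noteq> 0"
      then show False
        using zblock[rule_format, of "\<kappa> t" "\<kappa> t'" m m] zblock[rule_format, of "\<kappa> t'" "\<kappa> t" m m] t that strict_mono_less[OF \<kappa>(1)]
        by (cases t t' rule: linorder_cases) (auto simp: supp_def)
    qed
    then have "x m = (\<Sum>t\<in>{t}. z (\<kappa> t) m)"
      unfolding x_def using t by (intro sum.mono_neutral_right) auto
    then show ?thesis using abs_le_norm[OF z(1), of "\<kappa> t" m] z(2)[of "\<kappa> t"] by simp
  next
    case False
    then have "x m = 0" by (simp add: x_def)
    then show ?thesis by simp
  qed
  have main: "pairing \<psi> x \<le> \<epsilon> * n" if \<psi>l2_sums: "\<psi> \<in> l2_sums UNIV" for \<psi>
  proof -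
    obtain S a \<phi> where *: "l2_family UNIV S a \<phi>" "\<psi> = (\<lambda>n. \<Sum>i\<in>S. a i * \<phi> i n)"
      using \<psi>l2_sums unfolding l2_sums_def by blast
    have fin: "finite S" and row: "\<And>i. i \<in> S \<Longrightarrow> \<phi> i \<in> norming_rows"
      and a: "(\<Sum>i\<in>S. (a i)\<^sup>2) \<le> 1" and disj: "disjoint_family_on (\<lambda>i. idx (\<phi> i)) S"
      using *(1) by (auto simp: l2_family_def)
    define c where "c J m = (\<Sum>i\<in>S. a i * index_cut J (\<phi> i) m)" for J m
    have cH: "c J \<in> l2_sums J" if "\<And>a b c. a \<in> J \<Longrightarrow> c \<in> J \<Longrightarrow> a \<le> b \<Longrightarrow> b \<le> c \<Longrightarrow> b \<in> J" for J
      using l2_sums_I[OF l2_family_cut[OF *(1) that]] unfolding c_def[abs_def] by simp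
    have cUn: "pairing (c (J \<union> J')) u = pairing (c J) u + pairing (c J') u" if "J \<inter> J' = {}" for J J' u
    proof -
      have "c (J \<union> J') = (\<lambda>m. 1 * c J m + 1 * c J' m)"
        by (simp add: c_def cut_Un[OF that] distrib_left sum.distrib fun_eq_iff)
      then show ?thesis using pairing_add[of 1 "c J" 1 "c J'" u] by simp
    qed
    have "c UNIV = \<psi>"
      unfolding c_def[abs_def] *(2) using row rows_graded cut_UNIV by simp
    define J where "J t = {jj (\<kappa> t)<..jj (Suc (\<kappa> t))}" for t
    \<comment> \<open>Thinning leaves gaps between the chosen windows, but the four ranges for a
      single \<open>t\<close> still exhaust all indices.\<close>
    have split: "pairing \<psi> u = pairing (c {..j\<^sub>0}) u + pairing (c {j\<^sub>0<..jj (\<kappa> t)}) u +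
        pairing (c (J t)) u + pairing (c {jj (Suc (\<kappa> t))<..}) u" for t u
    proof -
      have le: "j\<^sub>0 \<le> jj (\<kappa> t)" using jj by (meson le0 order_trans strict_mono_less_eq)
      have le': "jj (\<kappa> t) \<le> jj (Suc (\<kappa> t))" using jj(1) by (simp add: strict_mono_less_eq)
      have "UNIV = {..j\<^sub>0} \<union> ({j\<^sub>0<..jj (\<kappa> t)} \<union> (J t \<union> {jj (Suc (\<kappa> t))<..}))"
        using le le' by (auto simp: J_def)
      then have "pairing \<psi> u = pairing (c ({..j\<^sub>0} \<union> ({j\<^sub>0<..jj (\<kappa> t)} \<union> (J t \<union> {jj (Suc (\<kappa> t))<..})))) u"
        using \<open>c UNIV = \<psi>\<close> by simp
      also have "\<dots> = pairing (c {..j\<^sub>0}) u + (pairing (c {j\<^sub>0<..jj (\<kappa> t)}) u +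
        (pairing (c (J t)) u + pairing (c {jj (Suc (\<kappa> t))<..}) u))"
        using le le' by (subst cUn, force simp: J_def)+ simp
      finally show ?thesis by simp
    qed
    have fz: "finite (supp (z k))" for k using finite_supp z(1) by blast
    have px: "pairing \<psi>' x = (\<Sum>t<n. pairing \<psi>' (z (\<kappa> t)))" for \<psi>'
      unfolding x_def[abs_def] by (rule pairing_sum_right) (use fz in auto)
    have "c {..j\<^sub>0} \<in> l2_sums {..j\<^sub>0}" by (rule cH) auto
    then have "pairing (c {..j\<^sub>0}) x \<le> K\<^sub>0 * 1"
      unfolding K\<^sub>0_def by (rule l2_sums_pairing_le) (use finite_supp[OF x] xle in auto)
    then have 1: "(\<Sum>t<n. pairing (c {..j\<^sub>0}) (z (\<kappa> t))) \<le> K\<^sub>0" unfolding px by simp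
    have 2: "(\<Sum>t<n. pairing (c {j\<^sub>0<..jj (\<kappa> t)}) (z (\<kappa> t))) \<le> (\<Sum>t<n. e)"
    proof (rule sum_mono)
      fix t
      have "c {j\<^sub>0<..jj (\<kappa> t)} \<in> l2_sums {j\<^sub>0<..jj (\<kappa> t)}" by (rule cH) auto
      then show "pairing (c {j\<^sub>0<..jj (\<kappa> t)}) (z (\<kappa> t)) \<le> e" using below by (simp add: z_def)
    qed
    have 4: "(\<Sum>t<n. pairing (c {jj (Suc (\<kappa> t))<..}) (z (\<kappa> t))) \<le> (\<Sum>t<n. e)"
    proof (rule sum_mono)
      fix t
      have "c {jj (Suc (\<kappa> t))<..} \<in> l2_sums {jj (Suc (\<kappa> t))<..}" by (rule cH) auto
      then show "pairing (c {jj (Suc (\<kappa> t))<..}) (z (\<kappa> t)) \<le> e" using above by (simp add: z_def)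
    qed
    define b where "b i t = pairing (index_cut (J t) (\<phi> i)) (z (\<kappa> t))" for i t
    have cutrow: "index_cut (J t) (\<phi> i) \<in> norming_rows" if "i \<in> S" for i t
      by (rule rows_cut[OF row[OF that]]) (auto simp: J_def)
    have cutdisj: "disjoint_family_on (\<lambda>i. idx (index_cut (J t) (\<phi> i))) S" for t
      using disj idx_cut unfolding disjoint_family_on_def by fast
    have "(\<Sum>t<n. \<Sum>i\<in>S. a i * b i t) \<le> 2 * sqrt n + n * e"
    proof (rule matrix_sum_le[where \<eta> = "\<lambda>s. \<eta> (\<kappa> s)", OF fin a])
      fix t
      have "(\<Sum>i\<in>S. (b i t)\<^sup>2) \<le> (N (z (\<kappa> t)))\<^sup>2"
        unfolding b_def by (rule rows_sum_squares_le[OF fin cutrow cutdisj z(1)])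
      also have "\<dots> \<le> 1"
        using z(2)[of "\<kappa> t"] abs_le_norm[OF z(1), of "\<kappa> t" 0] by (simp add: power_le_one)
      finally show "(\<Sum>i\<in>S. (b i t)\<^sup>2) \<le> 1" .
    next
      fix s
      have "card {i\<in>S. b i s \<noteq> 0} \<le> jj (Suc (\<kappa> s))"
      proof (rule card_le_of_disjoint_indices[where A = "\<lambda>i. idx (index_cut (J s) (\<phi> i))"])
        show "disjoint_family_on (\<lambda>i. idx (index_cut (J s) (\<phi> i))) {i\<in>S. b i s \<noteq> 0}"
          using cutdisj[of s] unfolding disjoint_family_on_def by blast
        fix i assume "i \<in> {i\<in>S. b i s \<noteq> 0}"
        then have "pairing (index_cut (J s) (\<phi> i)) (z (\<kappa> s)) \<noteq> 0" by (simp add: b_def)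
        then obtain m j where "m \<in> supp (z (\<kappa> s))" "\<phi> i m \<noteq> 0" "j \<in> J s" "1 \<le> j" "\<bar>\<phi> i m\<bar> = lev j"
          "j \<in> idx (index_cut (J s) (\<phi> i))" by (rule pairing_cut_nonzeroD)
        then show "idx (index_cut (J s) (\<phi> i)) \<inter> {1..jj (Suc (\<kappa> s))} \<noteq> {}" by (auto simp: J_def)
      qed
      then have "card {i\<in>S. b i s \<noteq> 0} * \<eta> (\<kappa> s) \<le> jj (Suc (\<kappa> s)) * \<eta> (\<kappa> s)"
        using \<eta>[of "\<kappa> s"] by (intro mult_right_mono) auto
      also have "\<dots> = e / n" using jjpos[of "\<kappa> s"] by (simp add: \<eta>_def)
      finally show "card {i\<in>S. b i s \<noteq> 0} * \<eta> (\<kappa> s) \<le> e / n" .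
    next
      fix i s t t' assume "i \<in> S" "s < t" "t < t'" "b i t \<noteq> 0"
      then show "\<bar>b i t'\<bar> < \<eta> (\<kappa> s)" using sep row unfolding b_def J_def by blast
    qed (rule \<eta>)
    moreover have "pairing (c (J t)) (z (\<kappa> t)) = (\<Sum>i\<in>S. a i * b i t)" for t
      unfolding c_def[abs_def] b_def by (rule pairing_sum)
    ultimately have 3: "(\<Sum>t<n. pairing (c (J t)) (z (\<kappa> t))) \<le> 2 * sqrt n + n * e" by simp
    have "pairing \<psi> x = (\<Sum>t<n. pairing (c {..j\<^sub>0}) (z (\<kappa> t)) + pairing (c {j\<^sub>0<..jj (\<kappa> t)}) (z (\<kappa> t)) +
        pairing (c (J t)) (z (\<kappa> t)) + pairing (c {jj (Suc (\<kappa> t))<..}) (z (\<kappa> t)))"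
      unfolding px by (rule sum.cong[OF refl]) (rule split)
    also have "\<dots> \<le> K\<^sub>0 + n * e + (2 * sqrt n + n * e) + n * e"
      using 1 2 3 4 unfolding sum.distrib sum_constant card_lessThan by linarith
    also have "\<dots> \<le> 5 * (e * n)" using nK by (simp add: mult.commute)
    finally show ?thesis by (simp add: e_def)
  qed
  define K where "K = (\<lambda>t. l (\<kappa> t)) ` {..<n}"
  have inj: "inj_on (\<lambda>t. l (\<kappa> t)) {..<n}"
    using l \<kappa>(1) by (auto simp: inj_on_def strict_mono_eq)
  have card: "card K = n" unfolding K_def by (simp add: card_image[OF inj])
  have "N x \<le> \<epsilon> * n"
  proof (rule G_norm_le[OF x])
    fix m
    have "1 \<le> \<epsilon> * n" using nK(2) e by (simp add: e_def)
    then show "\<bar>x m\<bar> \<le> \<epsilon> * n" using xle[of m] by linarith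
  qed (rule main)
  moreover have "x = (\<lambda>m. \<Sum>k\<in>K. y k m)"
    unfolding K_def by (simp add: sum.reindex[OF inj] x_def z_def fun_eq_iff)
  moreover have "K \<subseteq> {2 * card K..}"
  proof
    fix k assume "k \<in> K"
    then obtain t where "k = l (\<kappa> t)" by (auto simp: K_def)
    moreover have "\<kappa> t \<le> l (\<kappa> t)" using l by (rule strict_mono_imp_increasing)
    moreover have "\<kappa> 0 \<le> \<kappa> t" using \<kappa>(1) by (simp add: strict_mono_less_eq)
    ultimately show "k \<in> {2 * card K..}" using \<kappa>(2) card by simp
  qed
  ultimately show thesis using that[of K] n0 card by (auto simp: K_def)
qed

text \<open>A gliding hump on differences: the bound on coordinates gives a pointwise convergent
  subsequence, and its consecutive differences tend to zero in every coordinate, whatever the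
  limit.\<close>

lemma ex_block_differences:
  assumes v: "\<And>q. v q \<in> c00" "\<And>q. N (v q) \<le> M" and \<tau>: "0 < \<tau>"
  obtains i i' :: "nat \<Rightarrow> nat" and y :: "nat \<Rightarrow> nat \<Rightarrow> real" where
    "\<forall>k. i k < i' k \<and> i' k < i (Suc k)" "\<forall>k. y k \<in> c00"
    "\<forall>k k' a b. k < k' \<longrightarrow> a \<in> supp (y k) \<longrightarrow> b \<in> supp (y k') \<longrightarrow> a < b"
    "\<forall>k. N (\<lambda>n. v (i k) n - v (i' k) n - y k n) \<le> \<tau>"
proof -
  have bdd: "norm (v q n) \<le> M" for q n using abs_le_norm[OF v(1), of q n] v(2)[of q] by simp
  obtain r where r: "strict_mono r" "\<And>n. n \<in> UNIV \<Longrightarrow> \<exists>l. (\<lambda>q. v (r q) n) \<longlonglongrightarrow> l"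
    by (rule function_convergent_subsequence[of UNIV v M, OF _ bdd]) auto
  define d where "d q n = v (r q) n - v (r (Suc q)) n" for q n
  have d: "d q \<in> c00" for q unfolding d_def[abs_def] by (rule c00_diff[OF v(1) v(1)])
  have lim: "(\<lambda>q. d q n) \<longlonglongrightarrow> 0" for n
  proof -
    obtain l where l: "(\<lambda>q. v (r q) n) \<longlonglongrightarrow> l" using r(2) by blast
    from tendsto_diff[OF l LIMSEQ_Suc[OF l]] show ?thesis by (simp add: d_def)
  qed
  define P where "P p \<longleftrightarrow> supp (d (fst p)) \<subseteq> {..snd p}" for p :: "nat \<times> nat"
  \<comment> \<open>\<open>Suc (fst p)\<close> enters because a difference uses two consecutive
    terms, which the next one must leave behind. The sum bounds the loss from erasing the
    coordinates up to \<open>snd p\<close>.\<close>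
  define Q where "Q p p' \<longleftrightarrow> Suc (fst p) < fst p' \<and> snd p \<le> snd p' \<and> (\<Sum>n\<le>snd p. \<bar>d (fst p') n\<bar>) \<le> \<tau>"
    for p p' :: "nat \<times> nat"
  have ex: "\<exists>s. b \<le> s \<and> P (q, s)" for b q
  proof -
    obtain s where "\<forall>n\<in>supp (d q). n \<le> s" using finite_supp[OF d] finite_nat_set_iff_bounded_le by blast
    then show ?thesis unfolding P_def by (intro exI[of _ "max b s"]) auto
  qed
  have "\<exists>p. P p" using ex by blast
  moreover have "\<exists>p'. P p' \<and> Q p p'" for p
  proof -
    have "(\<lambda>q. \<Sum>n\<le>snd p. \<bar>d q n\<bar>) \<longlonglongrightarrow> (\<Sum>n\<le>snd p. \<bar>0::real\<bar>)"
      by (intro tendsto_intros lim)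
    then have "(\<lambda>q. \<Sum>n\<le>snd p. \<bar>d q n\<bar>) \<longlonglongrightarrow> 0" by simp
    then have "\<forall>\<^sub>F q in sequentially. (\<Sum>n\<le>snd p. \<bar>d q n\<bar>) < \<tau>"
      using \<tau> by (rule order_tendstoD(2))
    then obtain q\<^sub>0 where q0: "\<forall>q\<ge>q\<^sub>0. (\<Sum>n\<le>snd p. \<bar>d q n\<bar>) < \<tau>"
      unfolding eventually_sequentially by blast
    define q where "q = max q\<^sub>0 (Suc (Suc (fst p)))"
    have q: "(\<Sum>n\<le>snd p. \<bar>d q n\<bar>) < \<tau>" "Suc (fst p) < q" using q0 by (auto simp: q_def)
    obtain s where "snd p \<le> s" "P (q, s)" using ex by blast
    then have "P (q, s) \<and> Q p (q, s)" unfolding Q_def using q by simp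
    then show ?thesis by blast
  qed
  ultimately obtain f where f: "\<And>k. P (f k)" "\<And>k. Q (f k) (f (Suc k))"
    using dependent_nat_choice[of "\<lambda>_. P" "\<lambda>_. Q"] by blast
  define q where "q k = fst (f (Suc k))" for k
  define p where "p k = snd (f k)" for k
  have step: "Suc (q k) < q (Suc k)" "p k \<le> p (Suc k)" "(\<Sum>n\<le>p k. \<bar>d (q k) n\<bar>) \<le> \<tau>"
    "supp (d (q k)) \<subseteq> {..p (Suc k)}" for k
    using f(1)[of "Suc k"] f(2)[of k] f(2)[of "Suc k"] unfolding P_def Q_def q_def p_def by auto
  \<comment> \<open>Nothing is lost on the right, since the support of \<open>d (q k)\<close> ends
    by \<open>p (Suc k)\<close>.\<close>
  define y where "y k = restr {p k<..p (Suc k)} (d (q k))" for k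
  show thesis
  proof (rule that[of "\<lambda>k. r (q k)" "\<lambda>k. r (Suc (q k))" y])
    show "\<forall>k. r (q k) < r (Suc (q k)) \<and> r (Suc (q k)) < r (q (Suc k))"
      using r(1) step(1) by (simp add: strict_mono_less)
    show "\<forall>k. y k \<in> c00" unfolding y_def using c00_restr d by blast
    have sy: "supp (y k) \<subseteq> {p k<..p (Suc k)}" for k by (auto simp: y_def restr_def supp_def)
    have mono: "p k \<le> p k'" if "k \<le> k'" for k k' using step(2) that by (rule lift_Suc_mono_le)
    show "\<forall>k k' a b. k < k' \<longrightarrow> a \<in> supp (y k) \<longrightarrow> b \<in> supp (y k') \<longrightarrow> a < b"
    proof (intro allI impI)
      fix k k' a b assume *: "k < k'" "a \<in> supp (y k)" "b \<in> supp (y k')"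
      have "a \<le> p (Suc k)" "p k' < b" using * sy[of k] sy[of k'] by auto
      moreover have "p (Suc k) \<le> p k'" by (rule mono) (use * in simp)
      ultimately show "a < b" by simp
    qed
    show "\<forall>k. N (\<lambda>n. v (r (q k)) n - v (r (Suc (q k))) n - y k n) \<le> \<tau>"
    proof
      fix k
      have eq: "(\<lambda>n. v (r (q k)) n - v (r (Suc (q k))) n - y k n) = restr {..p k} (d (q k))"
        using step(4)[of k] by (auto simp: fun_eq_iff y_def restr_def d_def supp_def)
      have "N (restr {..p k} (d (q k))) \<le> (\<Sum>n\<in>{..p k}. \<bar>restr {..p k} (d (q k)) n\<bar>)"
        by (rule norm_le_sum_abs[OF c00_restr[OF d]]) (auto simp: supp_def restr_def)
      also have "\<dots> = (\<Sum>n\<le>p k. \<bar>d (q k) n\<bar>)" by (simp add: restr_def)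
      also have "\<dots> \<le> \<tau>" by (rule step(3))
      finally show "N (\<lambda>n. v (r (q k)) n - v (r (Suc (q k))) n - y k n) \<le> \<tau>" unfolding eq .
    qed
  qed
qed

end

section \<open>Transfer to the completion and conclusion\<close>

lemma completionD:
  assumes "completion_of_c00 N J X"
  shows "x \<in> c00 \<Longrightarrow> norm (J x) = N x" "X = closure (J ` c00)"
    "x \<in> c00 \<Longrightarrow> J (\<lambda>n. c * x n) = c *\<^sub>R J x"
    "x \<in> c00 \<Longrightarrow> y \<in> c00 \<Longrightarrow> J (\<lambda>n. x n - y n) = J x - J y"
    "finite K \<Longrightarrow> (\<And>k. k \<in> K \<Longrightarrow> z k \<in> c00) \<Longrightarrow> J (\<lambda>n. \<Sum>k\<in>K. z k n) = (\<Sum>k\<in>K. J (z k))"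
proof -
  have add: "J (\<lambda>n. x n + y n) = J x + J y" if "x \<in> c00" "y \<in> c00" for x y
    using assms that by (simp add: completion_of_c00_def)
  have scale: "J (\<lambda>n. c * x n) = c *\<^sub>R J x" if "x \<in> c00" for x c
    using assms that by (simp add: completion_of_c00_def)
  show "x \<in> c00 \<Longrightarrow> norm (J x) = N x" "X = closure (J ` c00)"
    using assms by (simp_all add: completion_of_c00_def)
  show "x \<in> c00 \<Longrightarrow> J (\<lambda>n. c * x n) = c *\<^sub>R J x" by (rule scale)
  show "J (\<lambda>n. x n - y n) = J x - J y" if "x \<in> c00" "y \<in> c00"
    using add[OF that(1) c00_scale[OF that(2), of "-1"]] scale[OF that(2), of "-1"] by simp
  have z: "(\<lambda>n. 0) \<in> c00" by (simp add: c00_def)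
  from scale[OF z, of 0] have "J (\<lambda>n. 0) = 0" by simp
  note J0 = this
  show "finite K \<Longrightarrow> (\<And>k. k \<in> K \<Longrightarrow> z k \<in> c00) \<Longrightarrow> J (\<lambda>n. \<Sum>k\<in>K. z k n) = (\<Sum>k\<in>K. J (z k))"
    by (induction K rule: finite_induct) (simp_all add: J0 add c00_sum)
qed

text \<open>The differences carry coefficients 1 and -1 on \<open>2 * card K\<close> distinct
  indices. As \<open>k \<le> i k\<close> and \<open>k \<le> i' k\<close>, all of these are at least
  \<open>2 * card K\<close>, so they form a set in \<open>schreier1\<close>.\<close>

lemma l1_lower_bound_differences:
  fixes x :: "nat \<Rightarrow> 'b::real_normed_vector"
  assumes l1: "\<forall>F\<in>schreier1. l1_equivalent_on C F x"
    and step: "\<And>k. i k < i' k" "\<And>k. i' k < i (Suc k)"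
    and K: "finite K" "K \<noteq> {}" "K \<subseteq> {2 * card K..}"
  shows "2 * card K / C \<le> norm (\<Sum>k\<in>K. x (Suc (i k)) - x (Suc (i' k)))"
proof -
  have "strict_mono i" unfolding strict_mono_Suc_iff using step order_less_trans by blast
  then have ile: "i (Suc k) \<le> i k'" if "k < k'" for k k' using that by (simp add: strict_mono_less_eq Suc_le_eq)
  have lt: "i' k < i k'" if "k < k'" for k k' using step(2)[of k] ile[OF that] by simp
  have ne: "i k \<noteq> i' k'" for k k'
    using step(1)[of k] step(1)[of k'] lt[of k' k] \<open>strict_mono i\<close>
    by (metis le_less_trans less_irrefl linorder_not_less strict_mono_less_eq order_less_imp_le)
  have "strict_mono i'" unfolding strict_mono_Suc_iff using step order_less_trans by blast
  define A where "A = (\<lambda>k. Suc (i k)) ` K"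
  define B where "B = (\<lambda>k. Suc (i' k)) ` K"
  have inj: "inj_on (\<lambda>k. Suc (i k)) K" "inj_on (\<lambda>k. Suc (i' k)) K"
    using \<open>strict_mono i\<close> \<open>strict_mono i'\<close> by (auto simp: inj_on_def strict_mono_eq)
  have AB: "finite A" "finite B" "A \<inter> B = {}" using K(1) ne by (auto simp: A_def B_def)
  have cardAB: "card A = card K" "card B = card K" using inj by (simp_all add: A_def B_def card_image)
  define a where "a m = (if m \<in> A then 1 else -1 :: real)" for m
  have sumAB: "(\<Sum>m\<in>A \<union> B. g m) = (\<Sum>k\<in>K. g (Suc (i k))) + (\<Sum>k\<in>K. g (Suc (i' k)))"
    for g :: "nat \<Rightarrow> 'c::comm_monoid_add"
    using sum.union_disjoint[OF AB, of g] inj by (simp add: A_def B_def sum.reindex)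
  have aA: "a (Suc (i k)) = 1" "a (Suc (i' k)) = -1" if "k \<in> K" for k
    using that AB(3) by (auto simp: a_def A_def B_def)
  have "A \<union> B \<in> schreier1"
  proof -
    have big: "2 * card K \<le> m" if m: "m \<in> A \<union> B" for m
    proof -
      obtain k where k: "k \<in> K" "m = Suc (i k) \<or> m = Suc (i' k)" using m by (auto simp: A_def B_def)
      have "k \<le> i k" "k \<le> i' k"
        using \<open>strict_mono i\<close> \<open>strict_mono i'\<close> by (simp_all add: strict_mono_imp_increasing)
      then show ?thesis using k K(3) by auto
    qed
    have ne: "A \<union> B \<noteq> {}" using K(2) by (auto simp: A_def)
    have "card (A \<union> B) = 2 * card K" using card_Un_disjoint[OF AB] cardAB by simp
    also have "\<dots> \<le> Min (A \<union> B)" using big AB ne by (intro Min.boundedI) auto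
    finally have "card (A \<union> B) \<le> Min (A \<union> B)" .
    moreover have "0 \<notin> A \<union> B" by (auto simp: A_def B_def)
    ultimately show ?thesis using AB ne by (simp add: schreier1_def)
  qed
  then have "(1 / C) * (\<Sum>m\<in>A \<union> B. \<bar>a m\<bar>) \<le> norm (\<Sum>m\<in>A \<union> B. a m *\<^sub>R x m)"
    using l1 unfolding l1_equivalent_on_def by blast
  moreover have "(\<Sum>m\<in>A \<union> B. \<bar>a m\<bar>) = 2 * card K" unfolding sumAB by (simp add: aA)
  moreover have "(\<Sum>m\<in>A \<union> B. a m *\<^sub>R x m) = (\<Sum>k\<in>K. x (Suc (i k)) - x (Suc (i' k)))"
    unfolding sumAB by (simp add: aA sum_subtractf sum_negf)
  ultimately show ?thesis by simp
qed

theorem theorem6p4: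
  fixes \<xi> :: countable_ordinal
    and L :: "countable_ordinal \<Rightarrow> nat \<Rightarrow> countable_ordinal"
    and M1 M2 :: "nat set"
    and \<sigma> :: "(nat \<Rightarrow> real) list \<Rightarrow> nat"
    and J :: "(nat \<Rightarrow> real) \<Rightarrow> 'b::banach"
    and X :: "'b set"
  assumes "fundamental_sequences L"
    and "special_coding M1 M2 \<sigma>"
    and "completion_of_c00 (G_norm L M1 \<sigma> \<xi>) J X"
  shows "\<not> (\<exists>x. (\<forall>i\<ge>1. x i \<in> X) \<and> generates_l1_spreading_model x)"
proof
  interpret coding L M1 M2 \<sigma> \<xi> by unfold_locales (rule assms)+
  note J = completionD[OF assms(3)]
  assume "\<exists>x. (\<forall>i\<ge>1. x i \<in> X) \<and> generates_l1_spreading_model x"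
  then obtain x C where x: "\<forall>i\<ge>1. x i \<in> X" "\<forall>i\<ge>1. norm (x i) = 1" and C: "1 \<le> C"
    and l1: "\<forall>F\<in>schreier1. l1_equivalent_on C F x"
    unfolding generates_l1_spreading_model_def by blast
  \<comment> \<open>Per term, approximation and truncation cost
    \<open>3 * \<tau> = 3 / (4 * C)\<close> and the average costs \<open>5 / (6 * C)\<close>: in
    total \<open>19 / (12 * C)\<close>, less than the lower bound \<open>2 / C\<close>.\<close>
  define \<tau> where "\<tau> = 1 / (4 * C)"
  have \<tau>: "0 < \<tau>" "\<tau> \<le> 1" using C by (auto simp: \<tau>_def field_simps)
  have "\<exists>u. u \<in> c00 \<and> norm (J u - x (Suc i)) \<le> \<tau>" for i
  proof -
    have "x (Suc i) \<in> closure (J ` c00)" using x(1) J(2) by simp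
    then obtain w where "w \<in> J ` c00" "dist w (x (Suc i)) < \<tau>"
      using \<tau>(1) closure_approachable by blast
    then show ?thesis by (auto simp: dist_norm intro: less_imp_le)
  qed
  then obtain v where v: "\<And>i. v i \<in> c00" "\<And>i. norm (J (v i) - x (Suc i)) \<le> \<tau>" by metis
  have v2: "norm (J (v i)) \<le> 2" for i
  proof -
    have "norm (J (v i)) \<le> norm (J (v i) - x (Suc i)) + norm (x (Suc i))"
      by (metis diff_add_cancel norm_triangle_ineq)
    then show ?thesis using v(2)[of i] \<tau>(2) x(2) by simp
  qed
  then have Nv: "N (v i) \<le> 2" for i using J(1)[OF v(1)] by simp
  obtain i i' and y :: "nat \<Rightarrow> nat \<Rightarrow> real" where i: "\<forall>k. i k < i' k \<and> i' k < i (Suc k)"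
    and y: "\<forall>k. y k \<in> c00"
    and block: "\<forall>k k' a b. k < k' \<longrightarrow> a \<in> supp (y k) \<longrightarrow> b \<in> supp (y k') \<longrightarrow> a < b"
    and near: "\<forall>k. N (\<lambda>n. v (i k) n - v (i' k) n - y k n) \<le> \<tau>"
    by (rule ex_block_differences[OF v(1) Nv \<tau>(1)])
  have nearJ: "norm (J (v (i k)) - J (v (i' k)) - J (y k)) \<le> \<tau>" for k
  proof -
    have d: "(\<lambda>n. v (i k) n - v (i' k) n) \<in> c00" by (rule c00_diff[OF v(1) v(1)])
    have yk: "y k \<in> c00" using y by blast
    have "norm (J (\<lambda>n. v (i k) n - v (i' k) n - y k n)) \<le> \<tau>"
      using near J(1)[OF c00_diff[OF d yk]] by simp
    then show ?thesis using J(4)[OF d yk] J(4)[OF v(1) v(1)] by simp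
  qed
  \<comment> \<open>\<open>J (y k)\<close> is within \<open>\<tau> \<le> 1\<close> of a difference
    of two vectors of norm at most 2, so 1/5 brings it into the unit ball.\<close>
  define w where "w k = (\<lambda>n. (1/5) * y k n)" for k
  have w: "w k \<in> c00" for k unfolding w_def using c00_scale y by blast
  have Jw: "J (w k) = (1/5) *\<^sub>R J (y k)" for k unfolding w_def using J(3) y by blast
  have Nw: "N (w k) \<le> 1" for k
  proof -
    have "norm (J (y k)) \<le> norm (J (v (i k)) - J (v (i' k))) + norm (J (v (i k)) - J (v (i' k)) - J (y k))"
      by (metis norm_minus_commute norm_triangle_sub)
    also have "norm (J (v (i k)) - J (v (i' k))) \<le> 4"
      using norm_triangle_ineq4[of "J (v (i k))" "J (v (i' k))"] v2[of "i k"] v2[of "i' k"] by linarith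
    finally have "norm (J (y k)) \<le> 5" using nearJ[of k] \<tau>(2) by linarith
    then show ?thesis using J(1)[OF w[of k]] Jw[of k] by simp
  qed
  have wblock: "\<forall>k k' a b. k < k' \<longrightarrow> a \<in> supp (w k) \<longrightarrow> b \<in> supp (w k') \<longrightarrow> a < b"
    using block unfolding w_def supp_def by simp
  have "0 < 1 / (6 * C)" using C by simp
  then obtain K where K: "finite K" "K \<noteq> {}" "K \<subseteq> {2 * card K..}"
    "N (\<lambda>n. \<Sum>k\<in>K. w k n) \<le> 1 / (6 * C) * card K"
    by (rule ex_small_average[OF w Nw wblock])
  have "(1/5) * norm (\<Sum>k\<in>K. J (y k)) = norm (\<Sum>k\<in>K. J (w k))"
    unfolding Jw scaleR_sum_right[symmetric] by simp
  also have "\<dots> = N (\<lambda>n. \<Sum>k\<in>K. w k n)"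
    using J(5)[OF K(1), of w] J(1)[OF c00_sum[OF K(1), of w]] w by simp
  finally have upper: "norm (\<Sum>k\<in>K. J (y k)) \<le> 5 / (6 * C) * card K" using K(4) by simp
  \<comment> \<open>One \<open>\<tau>\<close> for the truncation to a block and one for each of the
    two approximated terms.\<close>
  have err: "norm ((x (Suc (i k)) - x (Suc (i' k))) - J (y k)) \<le> 3 * \<tau>" for k
  proof -
    have "(x (Suc (i k)) - x (Suc (i' k))) - J (y k) =
      (J (v (i k)) - J (v (i' k)) - J (y k)) - (J (v (i k)) - x (Suc (i k))) + (J (v (i' k)) - x (Suc (i' k)))"
      by simp
    also have "norm \<dots> \<le> \<tau> + \<tau> + \<tau>"
      by (intro norm_triangle_le norm_triangle_le_diff add_mono nearJ v(2))
    finally show ?thesis by simp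
  qed
  have "2 * card K / C \<le> norm (\<Sum>k\<in>K. x (Suc (i k)) - x (Suc (i' k)))"
    by (rule l1_lower_bound_differences[OF l1 _ _ K(1-3)]) (use i in auto)
  also have "\<dots> \<le> norm (\<Sum>k\<in>K. J (y k)) + norm ((\<Sum>k\<in>K. x (Suc (i k)) - x (Suc (i' k))) - (\<Sum>k\<in>K. J (y k)))"
    by (rule norm_triangle_sub)
  also have "(\<Sum>k\<in>K. x (Suc (i k)) - x (Suc (i' k))) - (\<Sum>k\<in>K. J (y k)) =
      (\<Sum>k\<in>K. (x (Suc (i k)) - x (Suc (i' k))) - J (y k))"
    by (rule sum_subtractf[symmetric])
  also have "norm \<dots> \<le> (\<Sum>k\<in>K. 3 * \<tau>)" by (rule sum_norm_le) (rule err)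
  finally have "2 * card K / C \<le> 5 / (6 * C) * card K + card K * (3 * \<tau>)" using upper by simp
  moreover have "0 < card K" using K(1,2) by (simp add: card_gt_0_iff)
  ultimately show False using C by (simp add: \<tau>_def field_simps)
qed

end
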